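(* Let $0<p_0<\infty$ and let $\mathcal F$ be a collection of pairs $(f,g)$ of nonnegative measurable functions on $\mathbb R^n$. Assume that for every $(f,g)\in\mathcal F$ and every $w\in A_\infty$ we have $$\|g|L_{p_0,w}(\mathbb R^n)\|\le c_1\|f|L_{p_0,w}(\mathbb R^n)\|$$ whenever the left-hand side is finite, where $c_1$ does not depend on the pair $(f,g)$ and, for $w\in A_q$, depends on $w$ only through $q$ and $[w]_{A_q}$. Then for every $(f,g)\in\mathcal F$, every $0<p<\infty$, every $-n/p\le r<0$ and every $w\in A_\infty$ we have $$\|g|L^r_p(w,\mathbb R^n)\|\le c_2\|f|L^r_p(w,\mathbb R^n)\|$$ whenever the left-hand side is finite. Furthermore, if $w\in A_\infty\cap RH_\sigma$ (with $1<\sigma<\infty$) and $-n/p\le r\le -n/(p\sigma)$, we have $$\|g|L^r_p(\lambda,w,\mathbb R^n)\|\le c_3\|f|L^r_p(\lambda,w,\mathbb R^n)\|$$ whenever the left-hand side is finite. The constants $c_2,c_3$ do not depend on the pair $(f,g)$ but may depend on $w$ and the parameters.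
   Context: Cubes in $\mathbb R^n$ have sides parallel to the axes. A weight is a nonnegative locally integrable function; $w(E)=\int_E w$, $|E|$ is Lebesgue measure, $p'$ is the conjugate exponent. For $0<p<\infty$, $\|f|L_{p,w}(E)\|=(\int_E|f|^pw)^{1/p}$. Muckenhoupt classes: for $1<p<\infty$ and $w>0$ a.e. locally integrable, $w\in A_p$ iff $[w]_{A_p}=\sup_Q\frac{w(Q)}{|Q|}\big(\frac{w^{1-p'}(Q)}{|Q|}\big)^{p-1}<\infty$; $w\in A_1$ iff there is $c$ with $w(Q)/|Q|\le c\,w(x)$ for a.e. $x\in Q$ and every cube $Q$ ($[w]_{A_1}$ is the least such $c$). $w\in A_\infty$ iff $w\in A_p$ for some $p$ ($1\le p<\infty$). Reverse Hölder class: for $1<\sigma<\infty$, $w\in RH_\sigma$ iff there is $c$ with $\big(|Q|^{-1}\int_Q w^\sigma\big)^{1/\sigma}\le c\,|Q|^{-1}\int_Q w$ for all cubes $Q$. Morrey spaces: for $0<p<\infty$, $-n/p\le r<0$ and a weight $w$, the spaces $L^r_p(w,\mathbb R^n)$ and $L^r_p(\lambda,w,\mathbb R^n)$ consist of the (classes of) measurable complex functions $f$ on $\mathbb R^n$ for which, respectively, the following quasinorms are finite (suprema over all cubes; here $\lambda$ is just a label for the second type of space): $$\|f|L^r_p(w,\mathbb R^n)\|=\sup_Q w(Q)^{-(1/p+r/n)}\|f|L_{p,w}(Q)\|,\qquad \|f|L^r_p(\lambda,w,\mathbb R^n)\|=\sup_Q |Q|^{-(1/p+r/n)}\|f|L_{p,w}(Q)\|.$$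 *)

theory Defs
  imports "HOL-Analysis.Analysis"
begin

text \<open>All integrals and suprema are taken in \<^typ>\<open>ennreal\<close>, so a quantity such as a
  supremum over cubes is allowed to be infinite. The library has no powers with real exponent
  on this type.\<close>

definition enn_powr :: "ennreal \<Rightarrow> real \<Rightarrow> ennreal" where
  "enn_powr x a =
     (if a = 0 then 1
      else if x = 0 then (if 0 < a then 0 else \<infinity>)
      else if x = \<infinity> then (if 0 < a then \<infinity> else 0)
      else ennreal (enn2real x powr a))"

definition cubes :: "(real ^ 'n) set set" where
  "cubes = {cbox a (\<chi> i. a $ i + l) | a l. 0 < l}"

definition weight :: "(real ^ 'n \<Rightarrow> real) \<Rightarrow> bool" where
  "weight w \<longleftrightarrow> (\<forall>x. 0 \<le> w x) \<and> (\<forall>K. compact K \<longrightarrow> set_integrable lebesgue K w)"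

definition wmeas :: "(real ^ 'n \<Rightarrow> real) \<Rightarrow> (real ^ 'n) set \<Rightarrow> ennreal" where
  "wmeas w E = (\<integral>\<^sup>+x\<in>E. ennreal (w x) \<partial>lebesgue)"

definition avg :: "(real ^ 'n \<Rightarrow> real) \<Rightarrow> (real ^ 'n) set \<Rightarrow> ennreal" where
  "avg w Q = wmeas w Q / emeasure lebesgue Q"

definition Lp_norm :: "real \<Rightarrow> (real ^ 'n \<Rightarrow> real) \<Rightarrow> (real ^ 'n) set
    \<Rightarrow> (real ^ 'n \<Rightarrow> 'b::real_normed_vector) \<Rightarrow> ennreal" where
  "Lp_norm p w E f =
     enn_powr (\<integral>\<^sup>+x\<in>E. ennreal (norm (f x) powr p * w x) \<partial>lebesgue) (1 / p)"

text \<open>The constant \<open>[w]\<close> of the class with exponent \<open>p\<close>; the value of \<open>1 - p'\<close>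
  is written out with \<open>p' = p / (p - 1)\<close>. It is meaningful for \<open>p \<ge> 1\<close> only.\<close>

definition Ap_const :: "real \<Rightarrow> (real ^ 'n \<Rightarrow> real) \<Rightarrow> ennreal" where
  "Ap_const p w =
     (if p = 1 then Inf {c. \<forall>Q\<in>cubes. AE x in lebesgue. x \<in> Q \<longrightarrow> avg w Q \<le> c * ennreal (w x)}
      else (SUP Q\<in>cubes. avg w Q * enn_powr (avg (\<lambda>x. w x powr (1 - p / (p - 1))) Q) (p - 1)))"

definition Ap :: "real \<Rightarrow> (real ^ 'n \<Rightarrow> real) set" where
  "Ap p = {w. weight w \<and> (AE x in lebesgue. 0 < w x) \<and> Ap_const p w < \<infinity>}"

definition A_inf :: "(real ^ 'n \<Rightarrow> real) set" where
  "A_inf = (\<Union>p\<in>{1..}. Ap p)"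

definition RH :: "real \<Rightarrow> (real ^ 'n \<Rightarrow> real) set" where
  "RH \<sigma> = {w. weight w \<and>
     (\<exists>c::real. \<forall>Q\<in>cubes. enn_powr (avg (\<lambda>x. w x powr \<sigma>) Q) (1 / \<sigma>) \<le> ennreal c * avg w Q)}"

definition morrey_norm :: "real \<Rightarrow> real \<Rightarrow> (real ^ 'n \<Rightarrow> real)
    \<Rightarrow> (real ^ 'n \<Rightarrow> 'b::real_normed_vector) \<Rightarrow> ennreal" where
  "morrey_norm p r w f =
     (SUP Q\<in>cubes. enn_powr (wmeas w Q) (- (1 / p + r / real CARD('n))) * Lp_norm p w Q f)"

definition morrey_norm_lambda :: "real \<Rightarrow> real \<Rightarrow> (real ^ 'n \<Rightarrow> real)
    \<Rightarrow> (real ^ 'n \<Rightarrow> 'b::real_normed_vector) \<Rightarrow> ennreal" where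
  "morrey_norm_lambda p r w f =
     (SUP Q\<in>cubes. enn_powr (emeasure lebesgue Q) (- (1 / p + r / real CARD('n))) * Lp_norm p w Q f)"

end

theory Submission
  imports Defs
begin

text \<open>
  Everything is reduced to weights \<open>w H\<close> with \<open>w \<in> A\<^sub>q\<close>, \<open>q > 1\<close>, and \<open>H\<close> in the class \<open>A\<^sub>1\<close> relative to
  the measure \<open>w dx\<close>, that is, whose \<open>w\<close>-averages over cubes are at most \<open>K H(x)\<close>. Directly from the
  definitions, \<open>w H \<in> A\<^sub>q\<close>, and \<open>w H\<^sup>-\<^sup>k \<in> A\<^sub>r\<close> with \<open>r = (1 + k) q\<close>.
  Since \<open>w dx\<close> is doubling, its maximal operator is bounded on \<open>L\<^sub>2(w)\<close>, and the Rubio de Francia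
  iteration gives every \<open>h \<in> L\<^sub>2(w)\<close> a majorant \<open>H\<close> in this class with comparable norm.

  Extrapolation: using \<open>w H\<close> with a majorant of \<open>g\<^sup>p\<close> passes from the exponent \<open>p\<close> to \<open>2 p\<close>;
  using \<open>w H\<^sup>-\<^sup>k\<close> with a majorant of \<open>(g\<^sup>s\<^sup>p + \<tau> f\<^sup>s\<^sup>p)\<^sup>1\<^sup>/\<^sup>2\<close> passes from \<open>p\<close> to \<open>s p\<close> with \<open>s < 1\<close>.
  Together they reach every exponent.

  Morrey norms: for a cube \<open>Q\<close> with dilates \<open>Q\<^sub>k = 3\<^sup>k Q\<close>, take \<open>H = a\<^sub>k\<close> on \<open>Q\<^sub>k - Q\<^sub>k\<^sub>-\<^sub>1\<close>. It is in
  \<open>A\<^sub>1\<close> relative to \<open>w dx\<close> if the sums of \<open>a\<^sub>j w(Q\<^sub>j)\<close> over \<open>j \<le> k\<close> are controlled by their last term, and the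
  estimate with the weight \<open>w H\<close> localises to \<open>Q\<close> if \<open>a\<^sub>k w(Q\<^sub>k)\<^sup>\<gamma>\<close> (for the \<open>\<lambda>\<close>-norm:
  \<open>a\<^sub>k |Q\<^sub>k|\<^sup>\<gamma>\<close>) decays geometrically, where \<open>\<gamma> = 1 + r p / n\<close>. For the first norm
  \<open>a\<^sub>k = (w(Q) / w(Q\<^sub>k))\<^sup>\<theta>\<close> with \<open>\<gamma> < \<theta> < 1\<close> works, for the second a geometric sequence.
\<close>

section \<open>Maximal functions of doubling measures\<close>

text \<open>The hypothesis speaks only when its left-hand side is finite, so each auxiliary weight
  must make the integral of \<open>g\<close> finite before it may be used. This is why the majorants
  are built from \<open>g\<close> itself: they bound its powers pointwise, and the norm of the
  majorant bounds the new integral. Finiteness also permits absorbing a fraction of the left-hand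
  side in the step from p to 2 p. The A_1 condition is taken relative to w dx because both sides are
  compared in L_2(w). The exponent of the product weight may rise, since the hypothesis covers every
  A_q; this freedom is what makes the single exponent 2 suffice, with repeated doubling to pass the
  target exponent and one shrinking to return to it. The ring weights are discrete stand-ins for the
  powers (M 1_Q)^\<theta> of maximal functions that usually localise weighted estimates to a cube.
  Besides doubling, only the masses of the cubes Q_k enter their A_1 constant. The condition r < 0
  means \<gamma> < 1 and leaves the room for \<theta>; in the second norm the room comes from the
  reverse Hoelder inequality.\<close>

lemma sum_powr2_le:
  assumes "finite J" "\<And>j. j \<in> J \<Longrightarrow> 2 powr real_of_int j \<le> r" "0 \<le> r"
  shows "(\<Sum>j\<in>J. 2 powr real_of_int j) \<le> 2 * r"
proof (cases "J = {}")
  case False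
  define m where "m = Max J"
  have m: "m \<in> J" "\<And>j. j \<in> J \<Longrightarrow> j \<le> m"
    using assms(1) False unfolding m_def by auto
  have "(\<Sum>j\<in>J. 2 powr real_of_int j) = (\<Sum>j\<in>J. 2 powr m * (1 / 2) ^ nat (m - j))"
  proof (rule sum.cong)
    fix j assume "j \<in> J"
    have "(1 / 2 :: real) ^ nat (m - j) = 2 powr - real (nat (m - j))"
      by (simp add: powr_minus powr_realpow power_one_over field_simps)
    also have "real (nat (m - j)) = real_of_int m - j"
      using m(2)[OF \<open>j \<in> J\<close>] by simp
    finally show "2 powr real_of_int j = 2 powr m * (1 / 2) ^ nat (m - j)"
      by (simp add: powr_add[symmetric])
  qed simp
  also have "\<dots> = 2 powr m * (\<Sum>k\<in>(\<lambda>j. nat (m - j)) ` J. (1 / 2) ^ k)"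
  proof -
    have "inj_on (\<lambda>j. nat (m - j)) J"
      using m(2) by (auto simp: inj_on_def eq_nat_nat_iff)
    then show ?thesis by (simp add: sum.reindex sum_distrib_left)
  qed
  also have "\<dots> \<le> 2 powr m * (\<Sum>k. (1 / 2) ^ k)"
    using assms(1) by (intro mult_left_mono sum_le_suminf) (auto intro: summable_geometric)
  also have "\<dots> \<le> 2 * r"
    using assms(2)[OF m(1)] by (simp add: suminf_geometric)
  finally show ?thesis .
qed (use assms in auto)

text \<open>All integer powers of 2, enumerated along \<open>int_decode\<close>, so that a sum over
  the integers becomes a series over the naturals.\<close>

definition dyad :: "nat \<Rightarrow> ennreal" where
  "dyad n = ennreal (2 powr real_of_int (int_decode n))"

lemma dyad_finite: "dyad n < \<infinity>"
  by (simp add: dyad_def)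

text \<open>One layer is enough: the largest j with 2 * 2^j < y has y <= 4 * 2^j, whence the factor
  16. The layer starts at twice the level because truncating a function at height t controls its
  maximal function above 2 t. For infinite y the terms are unbounded.\<close>

lemma square_le_dyadic_layers:
  "y\<^sup>2 \<le> (\<Sum>n. 16 * (dyad n)\<^sup>2 * indicator {y. 2 * dyad n < y} y)" (is "_ \<le> (\<Sum>n. ?t n)")
proof -
  have layer: "16 * (ennreal (2 powr real_of_int j))\<^sup>2 * indicator {y. 2 * ennreal (2 powr real_of_int j) < y} y
      \<le> (\<Sum>n. ?t n)" for j :: int
  proof -
    have "?t (int_encode j) \<le> (\<Sum>n. ?t n)"
    proof -
      have "sum ?t {int_encode j} \<le> (\<Sum>n. ?t n)"
        by (rule sum_le_suminf) (auto intro: summableI)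
      then show ?thesis
        by (simp only: sum.insert finite.emptyI empty_iff not_False_eq_True sum.empty add_0_right)
    qed
    then show ?thesis by (simp add: dyad_def)
  qed
  show ?thesis
  proof (cases y)
    case top
    have "of_nat m \<le> (\<Sum>n. ?t n)" for m :: nat
    proof -
      have "real m \<le> 2 ^ m" 
        using less_exp[of m] by (metis less_imp_le of_nat_le_iff of_nat_numeral of_nat_power)
      also have "\<dots> \<le> 16 * (2 ^ m)\<^sup>2"
      proof -
        have "1 * 2 ^ m \<le> (16 * 2 ^ m) * (2 ^ m :: real)"
          by (intro mult_right_mono) (use one_le_power[of "2::real" m] in linarith, simp)
        then show ?thesis by (simp add: power2_eq_square)
      qed
      finally have "ennreal (real m) \<le> ennreal (16 * (2 ^ m)\<^sup>2)"
        by (rule ennreal_leI)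
      also have "\<dots> = 16 * (ennreal (2 ^ m))\<^sup>2"
        by (subst ennreal_mult) (simp_all only: ennreal_power ennreal_numeral zero_le_numeral zero_le_power zero_le_power2)
      also have "\<dots> \<le> (\<Sum>n. ?t n)"
        using layer[of "int m"] top by (simp add: powr_realpow ennreal_mult_less_top)
      finally show ?thesis by (simp add: ennreal_of_nat_eq_real_of_nat)
    qed
    then have "(SUP m. of_nat m) \<le> (\<Sum>n. ?t n)"
      by (intro SUP_least)
    then show ?thesis
      by (simp add: ennreal_SUP_of_nat_eq_top top_unique)
  next
    case (real r)
    show ?thesis
    proof (cases "r = 0")
      case False
      then have r: "0 < r" using real by simp
      define j where "j = \<lceil>log 2 r\<rceil> - 2"
      have 1: "2 * 2 powr real_of_int j < r"
      proof -
        have "1 + real_of_int j < log 2 r" unfolding j_def by linarith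
        then have "2 powr (1 + real_of_int j) < r" using r by (simp add: less_log_iff)
        then show ?thesis by (simp add: powr_add)
      qed
      have 2: "r \<le> 4 * 2 powr real_of_int j"
      proof -
        have "log 2 r \<le> 2 + real_of_int j" unfolding j_def by linarith
        then have "r \<le> 2 powr (2 + real_of_int j)" using r by (simp add: log_le_iff)
        then show ?thesis by (simp add: powr_add)
      qed
      have "r\<^sup>2 \<le> (4 * 2 powr real_of_int j)\<^sup>2"
        using 2 r by (intro power_mono) auto
      then have "y\<^sup>2 \<le> 16 * (ennreal (2 powr real_of_int j))\<^sup>2"
        using real by (simp add: ennreal_power power_mult_distrib ennreal_mult[symmetric] ennreal_leI flip: ennreal_numeral)
      also have "\<dots> \<le> (\<Sum>n. ?t n)"
        using layer[of j] 1 real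
        by (simp add: ennreal_mult[symmetric] ennreal_less_iff flip: ennreal_numeral)
      finally show ?thesis .
    qed (use real in simp)
  qed
qed

text \<open>The levels below y form a geometric progression ending below y. Together with the
  previous bound this replaces the layer cake integral.\<close>

lemma dyadic_layers_le: "(\<Sum>n. dyad n * indicator {y. dyad n < y} y) \<le> 2 * y"
proof (cases y)
  case (real r)
  show ?thesis
    unfolding suminf_eq_SUP
  proof (rule SUP_least)
    fix N
    let ?A = "{n\<in>{..<N}. dyad n < y}"
    have "(\<Sum>n<N. dyad n * indicator {y. dyad n < y} y) = (\<Sum>n\<in>?A. dyad n)"
      by (intro sum.mono_neutral_cong_right) auto
    also have "\<dots> = ennreal (\<Sum>j\<in>int_decode ` ?A. 2 powr real_of_int j)"
      unfolding dyad_def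
      by (subst sum.reindex) (auto intro!: sum_ennreal inj_on_subset[OF inj_int_decode] simp: comp_def)
    also have "\<dots> \<le> ennreal (2 * r)"
      using real by (intro ennreal_leI sum_powr2_le) (auto simp: dyad_def ennreal_less_iff)
    also have "\<dots> = 2 * y"
      using real by (simp add: ennreal_mult)
    finally show "(\<Sum>n<N. dyad n * indicator {y. dyad n < y} y) \<le> 2 * y" .
  qed
qed (simp add: ennreal_mult_top)

section \<open>Vitali covering, weak type and L_2 bounds, and the iteration of the maximal
  operator\<close>

locale doubling_measure =
  fixes \<mu> :: "'a::euclidean_space measure" and D :: real
  assumes sets_mu [measurable_cong]: "sets \<mu> = sets lebesgue"
    and ball_pos: "\<And>c r. 0 < r \<Longrightarrow> 0 < emeasure \<mu> (cball c r)"
    and ball_finite: "\<And>c r. emeasure \<mu> (cball c r) < \<infinity>"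
    and doubling: "\<And>c r. 0 < r \<Longrightarrow> emeasure \<mu> (cball c (5 * r)) \<le> ennreal D * emeasure \<mu> (cball c r)"
    and D_ge_1: "1 \<le> D"
begin

text \<open>Centres in a countable dense set and rational radii: the supremum over these balls is
  measurable, and every cube still lies in one of them of comparable size.\<close>

definition balls :: "('a \<times> real) set" where
  "balls = (SOME S. countable S \<and> (\<forall>X. open X \<longrightarrow> X \<noteq> {} \<longrightarrow> (\<exists>d\<in>S. d \<in> X))) \<times> {r \<in> \<rat>. 0 < r}"

definition mean :: "('a \<Rightarrow> ennreal) \<Rightarrow> 'a \<Rightarrow> real \<Rightarrow> ennreal" where
  "mean f c r = (\<integral>\<^sup>+x\<in>cball c r. f x \<partial>\<mu>) / emeasure \<mu> (cball c r)"

definition maxf :: "('a \<Rightarrow> ennreal) \<Rightarrow> 'a \<Rightarrow> ennreal" where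
  "maxf f x = (SUP b\<in>balls. mean f (fst b) (snd b) * indicator (cball (fst b) (snd b)) x)"

lemma space_mu [simp]: "space \<mu> = UNIV"
  using sets_eq_imp_space_eq[OF sets_mu] by simp

lemma cball_sets [measurable]: "cball c r \<in> sets \<mu>"
  by (simp add: sets_mu)

lemma countable_balls: "countable balls"
  and balls_pos: "b \<in> balls \<Longrightarrow> 0 < snd b"
  and balls_dense: "\<lbrakk>open X; X \<noteq> {}; 0 < s; s < t\<rbrakk> \<Longrightarrow> \<exists>b\<in>balls. fst b \<in> X \<and> s < snd b \<and> snd b < t"
proof -
  define S where "S = (SOME S::'a set. countable S \<and> (\<forall>X. open X \<longrightarrow> X \<noteq> {} \<longrightarrow> (\<exists>d\<in>S. d \<in> X)))"
  have S: "countable S" "\<And>X. open X \<Longrightarrow> X \<noteq> {} \<Longrightarrow> \<exists>d\<in>S. d \<in> X"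
    using someI_ex[OF countable_dense_exists] unfolding S_def by blast+
  have b: "balls = S \<times> {r \<in> \<rat>. 0 < r}"
    by (simp add: balls_def S_def)
  have "countable {r \<in> \<rat>. 0 < (r::real)}"
    by (rule countable_subset[OF _ countable_rat]) auto
  then show "countable balls"
    unfolding b using S by (intro countable_SIGMA) auto
  show "b \<in> balls \<Longrightarrow> 0 < snd b"
    unfolding b by auto
  show "\<exists>b\<in>balls. fst b \<in> X \<and> s < snd b \<and> snd b < t"
    if X: "open X" "X \<noteq> {}" and st: "0 < s" "s < t" for X s t
  proof -
    obtain d where "d \<in> S" "d \<in> X"
      using S(2)[OF X] by auto
    moreover obtain r where "r \<in> \<rat>" "s < r" "r < t"
      using Rats_dense_in_real[OF st(2)] by auto
    ultimately show ?thesis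
      unfolding b using st by (intro bexI[of _ "(d, r)"]) auto
  qed
qed

lemma balls_nonempty: "balls \<noteq> {}"
  using balls_dense[of UNIV 1 2] by auto

lemma maxf_measurable [measurable]: "maxf f \<in> borel_measurable \<mu>"
  unfolding maxf_def using countable_balls by measurable

lemma superlevel_sets [measurable]:
  fixes g :: "'a \<Rightarrow> ennreal"
  assumes [measurable]: "g \<in> borel_measurable \<mu>"
  shows "{x. t < g x} \<in> sets \<mu>"
proof -
  have "{x \<in> space \<mu>. t < g x} \<in> sets \<mu>" by measurable
  then show ?thesis by simp
qed

lemma mean_times: "0 < r \<Longrightarrow> mean f c r * emeasure \<mu> (cball c r) = (\<integral>\<^sup>+x\<in>cball c r. f x \<partial>\<mu>)"
  unfolding mean_def using ball_pos[of r c] ball_finite[of c r]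
  by (simp add: ennreal_divide_times ennreal_mult_divide_eq)

lemma mean_le_maxf: "b \<in> balls \<Longrightarrow> x \<in> cball (fst b) (snd b) \<Longrightarrow> mean f (fst b) (snd b) \<le> maxf f x"
  unfolding maxf_def by (rule SUP_upper2) auto

text \<open>Vitali's argument: a disjoint subfamily has 5-fold dilates that cover all the balls.
  Doubling, assumed for exactly this dilation, pays for the enlargement, and disjointness lets the
  integrals over the chosen balls add up to at most the integral of f.\<close>

lemma weak_type_finite:
  assumes f [measurable]: "f \<in> borel_measurable \<mu>" and "finite K" "K \<subseteq> balls"
    and K: "\<And>b. b \<in> K \<Longrightarrow> t \<le> mean f (fst b) (snd b)"
  shows "t * emeasure \<mu> (\<Union>b\<in>K. cball (fst b) (snd b)) \<le> ennreal D * (\<integral>\<^sup>+x. f x \<partial>\<mu>)"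
proof -
  let ?B = "\<lambda>b. cball (fst b) (snd b)"
  have r: "0 < snd b \<and> snd b \<le> Max (snd ` K)" if "b \<in> K" for b
    using that assms(2,3) balls_pos[of b] by (auto intro!: Max_ge)
  obtain C where C: "C \<subseteq> K" "pairwise (\<lambda>i j. disjnt (?B i) (?B j)) C"
    "(\<Union>b\<in>K. ?B b) \<subseteq> (\<Union>b\<in>C. cball (fst b) (5 * snd b))"
    by (rule Vitali_covering_lemma_cballs[of "\<Union>b\<in>K. ?B b" fst snd K, OF order_refl r]) auto
  have fin: "finite C"
    using C(1) \<open>finite K\<close> finite_subset by auto
  have one: "(\<Sum>b\<in>C. indicator (?B b) x) \<le> (1::ennreal)" for x
  proof -
    have "disjoint_family_on ?B C"
      using C(2) by (auto simp: pairwise_def disjoint_family_on_def disjnt_def)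
    then have "(\<Sum>b\<in>C. indicator (?B b) x) = (indicator (\<Union>b\<in>C. ?B b) x :: ennreal)"
      using fin by (simp add: indicator_UN_disjoint)
    also have "\<dots> \<le> 1"
      by (simp add: indicator_def)
    finally show ?thesis .
  qed
  have "t * emeasure \<mu> (\<Union>b\<in>K. ?B b) \<le> t * emeasure \<mu> (\<Union>b\<in>C. cball (fst b) (5 * snd b))"
    by (intro mult_left_mono emeasure_mono C(3) sets.finite_UN fin) auto
  also have "\<dots> \<le> t * (\<Sum>b\<in>C. emeasure \<mu> (cball (fst b) (5 * snd b)))"
    by (intro mult_left_mono emeasure_subadditive_finite fin) auto
  also have "\<dots> \<le> t * (\<Sum>b\<in>C. ennreal D * emeasure \<mu> (?B b))"
    using C(1) r by (intro mult_left_mono sum_mono doubling) auto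
  also have "\<dots> = ennreal D * (\<Sum>b\<in>C. t * emeasure \<mu> (?B b))"
    by (simp add: sum_distrib_left mult_ac)
  also have "\<dots> \<le> ennreal D * (\<Sum>b\<in>C. \<integral>\<^sup>+x\<in>?B b. f x \<partial>\<mu>)"
  proof (intro mult_left_mono sum_mono)
    fix b assume "b \<in> C"
    then have b: "b \<in> K" using C(1) by auto
    have "t * emeasure \<mu> (?B b) \<le> mean f (fst b) (snd b) * emeasure \<mu> (?B b)"
      by (intro mult_right_mono K b) auto
    then show "t * emeasure \<mu> (?B b) \<le> (\<integral>\<^sup>+x\<in>?B b. f x \<partial>\<mu>)"
      using r[OF b] by (simp add: mean_times)
  qed auto
  also have "(\<Sum>b\<in>C. \<integral>\<^sup>+x\<in>?B b. f x \<partial>\<mu>) = (\<integral>\<^sup>+x. (\<Sum>b\<in>C. f x * indicator (?B b) x) \<partial>\<mu>)"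
    by (rule nn_integral_sum[symmetric]) measurable
  also have "\<dots> \<le> (\<integral>\<^sup>+x. f x \<partial>\<mu>)"
    unfolding sum_distrib_left[symmetric]
    using mult_left_mono[OF one] by (intro nn_integral_mono) (metis mult.right_neutral zero_le)
  finally show ?thesis
    by (simp add: mult_left_mono)
qed

text \<open>A superlevel set is the union of the balls of the family whose mean exceeds t; along an
  enumeration it is exhausted by finite unions, to which the covering argument applies.\<close>

lemma weak_type:
  assumes [measurable]: "f \<in> borel_measurable \<mu>"
  shows "t * emeasure \<mu> {x. t < maxf f x} \<le> ennreal D * (\<integral>\<^sup>+x. f x \<partial>\<mu>)"
proof -
  let ?B = "\<lambda>b. cball (fst b) (snd b)"
  let ?e = "from_nat_into balls"
  define E where "E n = (\<Union>b\<in>{b \<in> ?e ` {..<n}. t < mean f (fst b) (snd b)}. ?B b)" for n :: nat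
  have e: "range ?e = balls"
    using range_from_nat_into[OF balls_nonempty countable_balls] .
  have ex: "(\<exists>b\<in>balls. P b) \<longleftrightarrow> (\<exists>i. P (?e i))" for P
  proof -
    have "(\<exists>b\<in>range ?e. P b) \<longleftrightarrow> (\<exists>i. P (?e i))" by blast
    then show ?thesis by (simp only: e)
  qed
  have "{x. t < maxf f x} = (\<Union>n. E n)"
  proof (rule set_eqI)
    fix x
    have "t < maxf f x \<longleftrightarrow> (\<exists>b\<in>balls. t < mean f (fst b) (snd b) * indicator (?B b) x)"
      unfolding maxf_def by (rule less_SUP_iff)
    also have "\<dots> \<longleftrightarrow> (\<exists>b\<in>balls. t < mean f (fst b) (snd b) \<and> x \<in> ?B b)"
      by (intro bex_cong refl) (auto simp: indicator_def)
    also have "\<dots> \<longleftrightarrow> (\<exists>i. t < mean f (fst (?e i)) (snd (?e i)) \<and> x \<in> ?B (?e i))"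
      by (rule ex)
    also have "\<dots> \<longleftrightarrow> (\<exists>n. x \<in> E n)"
      unfolding E_def by (auto intro: lessI)
    finally show "x \<in> {x. t < maxf f x} \<longleftrightarrow> x \<in> (\<Union>n. E n)" by simp
  qed
  moreover have [measurable]: "E n \<in> sets \<mu>" for n
    unfolding E_def by (intro sets.finite_UN) auto
  moreover have "incseq E"
    unfolding incseq_def E_def by (force intro!: UN_mono)
  ultimately have "emeasure \<mu> {x. t < maxf f x} = (SUP n. emeasure \<mu> (E n))"
    by (simp add: SUP_emeasure_incseq image_subset_iff)
  then have "t * emeasure \<mu> {x. t < maxf f x} = (SUP n. t * emeasure \<mu> (E n))"
    by (simp add: SUP_mult_left_ennreal)
  also have "\<dots> \<le> ennreal D * (\<integral>\<^sup>+x. f x \<partial>\<mu>)"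
  proof (rule SUP_least)
    fix n
    show "t * emeasure \<mu> (E n) \<le> ennreal D * (\<integral>\<^sup>+x. f x \<partial>\<mu>)"
      unfolding E_def
      by (rule weak_type_finite) (auto intro: less_imp_le simp: from_nat_into[OF balls_nonempty])
  qed
  finally show ?thesis .
qed

lemma mean_add:
  assumes [measurable]: "f \<in> borel_measurable \<mu>" "g \<in> borel_measurable \<mu>"
  shows "mean (\<lambda>x. f x + g x) c r = mean f c r + mean g c r"
  unfolding mean_def by (simp add: distrib_right nn_integral_add add_divide_distrib_ennreal)

lemma mean_suminf:
  assumes [measurable]: "\<And>k. f k \<in> borel_measurable \<mu>"
  shows "mean (\<lambda>x. \<Sum>k. f k x) c r = (\<Sum>k. mean (f k) c r)"
proof -
  have "(\<integral>\<^sup>+x\<in>cball c r. (\<Sum>k. f k x) \<partial>\<mu>) = (\<integral>\<^sup>+x. (\<Sum>k. f k x * indicator (cball c r) x) \<partial>\<mu>)"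
    by simp
  also have "\<dots> = (\<Sum>k. \<integral>\<^sup>+x\<in>cball c r. f k x \<partial>\<mu>)"
    by (rule nn_integral_suminf) measurable
  finally show ?thesis
    unfolding mean_def divide_ennreal_def by simp
qed

lemma maxf_suminf:
  assumes [measurable]: "\<And>k. f k \<in> borel_measurable \<mu>"
  shows "maxf (\<lambda>x. \<Sum>k. f k x) x \<le> (\<Sum>k. maxf (f k) x)"
  unfolding maxf_def
proof (rule SUP_least)
  fix b assume b: "b \<in> balls"
  have "mean (\<lambda>x. \<Sum>k. f k x) (fst b) (snd b) * indicator (cball (fst b) (snd b)) x
      = (\<Sum>k. mean (f k) (fst b) (snd b) * indicator (cball (fst b) (snd b)) x)"
    by (simp add: mean_suminf)
  also have "\<dots> \<le> (\<Sum>k. SUP b\<in>balls. mean (f k) (fst b) (snd b) * indicator (cball (fst b) (snd b)) x)"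
    by (intro suminf_le summableI) (auto intro!: SUP_upper b)
  finally show "mean (\<lambda>x. \<Sum>k. f k x) (fst b) (snd b) * indicator (cball (fst b) (snd b)) x \<le> \<dots>" .
qed

lemma maxf_cmult:
  assumes [measurable]: "f \<in> borel_measurable \<mu>"
  shows "maxf (\<lambda>x. c * f x) x = c * maxf f x"
proof -
  have "mean (\<lambda>x. c * f x) a r = c * mean f a r" for a r
    unfolding mean_def mult.assoc by (subst nn_integral_cmult) (auto simp: ennreal_times_divide)
  then show ?thesis
    unfolding maxf_def SUP_mult_left_ennreal by (simp only: mult.assoc)
qed

text \<open>Cutting \<open>f\<close> at height \<open>t\<close> does not lose more than \<open>t\<close> in the maximal function.\<close>

lemma weak_type_truncated:
  assumes [measurable]: "f \<in> borel_measurable \<mu>" and t: "t < \<infinity>"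
  shows "t * emeasure \<mu> {x. 2 * t < maxf f x} \<le> ennreal D * (\<integral>\<^sup>+x. f x * indicator {x. t < f x} x \<partial>\<mu>)"
proof -
  let ?g = "\<lambda>x. f x * indicator {x. t < f x} x"
  have sub: "maxf f x \<le> t + maxf ?g x" for x
    unfolding maxf_def
  proof (rule SUP_least)
    fix b assume b: "b \<in> balls"
    let ?B = "cball (fst b) (snd b)"
    have "mean f (fst b) (snd b) \<le> mean (\<lambda>x. t + ?g x) (fst b) (snd b)"
      unfolding mean_def
      by (intro divide_right_mono_ennreal nn_integral_mono) (auto simp: indicator_def)
    also have "\<dots> = t + mean ?g (fst b) (snd b)"
    proof -
      have "mean (\<lambda>x. t) (fst b) (snd b) = t"
        unfolding mean_def using ball_pos[of "snd b" "fst b"] ball_finite[of "fst b" "snd b"] balls_pos[OF b]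
        by (simp add: nn_integral_cmult_indicator ennreal_mult_divide_eq)
      then show ?thesis by (simp add: mean_add)
    qed
    finally have "mean f (fst b) (snd b) * indicator ?B x \<le> (t + mean ?g (fst b) (snd b)) * indicator ?B x"
      by (rule mult_right_mono) auto
    also have "\<dots> \<le> t + mean ?g (fst b) (snd b) * indicator ?B x"
      by (auto simp: indicator_def)
    also have "\<dots> \<le> t + (SUP b\<in>balls. mean ?g (fst b) (snd b) * indicator (cball (fst b) (snd b)) x)"
      by (intro add_left_mono SUP_upper b)
    finally show "mean f (fst b) (snd b) * indicator ?B x \<le> \<dots>" .
  qed
  have "{x. 2 * t < maxf f x} \<subseteq> {x. t < maxf ?g x}"
  proof clarify
    fix x assume "2 * t < maxf f x"
    then have "t + t < t + maxf ?g x"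
      using sub[of x] by (metis mult_2 order_less_le_trans)
    then show "t < maxf ?g x"
      by (meson add_left_mono linorder_not_le)
  qed
  then have "t * emeasure \<mu> {x. 2 * t < maxf f x} \<le> t * emeasure \<mu> {x. t < maxf ?g x}"
    by (intro mult_left_mono emeasure_mono) (auto, measurable)
  also have "\<dots> \<le> ennreal D * (\<integral>\<^sup>+x. ?g x \<partial>\<mu>)"
    by (rule weak_type) measurable
  finally show ?thesis .
qed

text \<open>Marcinkiewicz interpolation with dyadic levels: at each level only the part of f above
  that level enters the weak type bound, and exchanging sum and integral leaves a geometric series
  bounded by 2 f. In 32 the factor 16 comes from the layers of the square, the 2 from that
  series.\<close>

lemma maxf_L2:
  assumes [measurable]: "f \<in> borel_measurable \<mu>"
  shows "(\<integral>\<^sup>+x. (maxf f x)\<^sup>2 \<partial>\<mu>) \<le> ennreal (32 * D) * (\<integral>\<^sup>+x. (f x)\<^sup>2 \<partial>\<mu>)"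
proof -
  have "(\<integral>\<^sup>+x. (maxf f x)\<^sup>2 \<partial>\<mu>)
      \<le> (\<integral>\<^sup>+x. (\<Sum>n. 16 * (dyad n)\<^sup>2 * indicator {x. 2 * dyad n < maxf f x} x) \<partial>\<mu>)"
    using square_le_dyadic_layers by (intro nn_integral_mono) (simp add: indicator_def)
  also have "\<dots> = (\<Sum>n. \<integral>\<^sup>+x. 16 * (dyad n)\<^sup>2 * indicator {x. 2 * dyad n < maxf f x} x \<partial>\<mu>)"
    by (rule nn_integral_suminf) measurable
  also have "\<dots> = (\<Sum>n. 16 * dyad n * (dyad n * emeasure \<mu> {x. 2 * dyad n < maxf f x}))"
  proof (rule suminf_cong)
    fix n
    show "(\<integral>\<^sup>+x. 16 * (dyad n)\<^sup>2 * indicator {x. 2 * dyad n < maxf f x} x \<partial>\<mu>)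
        = 16 * dyad n * (dyad n * emeasure \<mu> {x. 2 * dyad n < maxf f x})"
      by (subst nn_integral_cmult_indicator[OF superlevel_sets[OF maxf_measurable]])
         (simp add: power2_eq_square mult.assoc)
  qed
  also have "\<dots> \<le> (\<Sum>n. 16 * dyad n * (ennreal D * (\<integral>\<^sup>+x. f x * indicator {x. dyad n < f x} x \<partial>\<mu>)))"
    by (intro suminf_le summableI mult_left_mono weak_type_truncated) (auto simp: dyad_finite[unfolded infinity_ennreal_def])
  also have "\<dots> = (\<Sum>n. \<integral>\<^sup>+x. 16 * ennreal D * f x * (dyad n * indicator {y. dyad n < y} (f x)) \<partial>\<mu>)"
  proof (rule suminf_cong)
    fix n
    have "(\<integral>\<^sup>+x. 16 * ennreal D * f x * (dyad n * indicator {y. dyad n < y} (f x)) \<partial>\<mu>)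
       = (\<integral>\<^sup>+x. 16 * dyad n * ennreal D * (f x * indicator {x. dyad n < f x} x) \<partial>\<mu>)"
      by (intro nn_integral_cong) (simp add: indicator_def mult_ac)
    also have "\<dots> = 16 * dyad n * ennreal D * (\<integral>\<^sup>+x. f x * indicator {x. dyad n < f x} x \<partial>\<mu>)"
      by (rule nn_integral_cmult) measurable
    finally show "16 * dyad n * (ennreal D * (\<integral>\<^sup>+x. f x * indicator {x. dyad n < f x} x \<partial>\<mu>))
       = (\<integral>\<^sup>+x. 16 * ennreal D * f x * (dyad n * indicator {y. dyad n < y} (f x)) \<partial>\<mu>)"
      by (simp add: mult.assoc)
  qed
  also have "\<dots> = (\<integral>\<^sup>+x. (\<Sum>n. 16 * ennreal D * f x * (dyad n * indicator {y. dyad n < y} (f x))) \<partial>\<mu>)"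
    by (rule nn_integral_suminf[symmetric]) measurable
  also have "\<dots> \<le> (\<integral>\<^sup>+x. ennreal (32 * D) * (f x)\<^sup>2 \<partial>\<mu>)"
  proof (rule nn_integral_mono)
    fix x
    have "(\<Sum>n. 16 * ennreal D * f x * (dyad n * indicator {y. dyad n < y} (f x)))
        \<le> 16 * ennreal D * f x * (2 * f x)"
      unfolding ennreal_suminf_cmult by (intro mult_left_mono dyadic_layers_le) auto
    also have "\<dots> = ennreal (32 * D) * (f x)\<^sup>2"
    proof -
      have "ennreal (32 * D) = 16 * 2 * ennreal D"
        using D_ge_1 by (simp add: ennreal_mult)
      then show ?thesis by (simp add: power2_eq_square mult_ac)
    qed
    finally show "(\<Sum>n. 16 * ennreal D * f x * (dyad n * indicator {y. dyad n < y} (f x)))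
        \<le> ennreal (32 * D) * (f x)\<^sup>2" .
  qed
  also have "\<dots> = ennreal (32 * D) * (\<integral>\<^sup>+x. (f x)\<^sup>2 \<partial>\<mu>)"
    by (rule nn_integral_cmult) measurable
  finally show ?thesis .
qed

text \<open>\<open>H\<close> is the series of the iterates M^k h / (2 c)^k, where c bounds the norm
  of M on L_2. Applying M shifts the series by one place, which costs the factor 2 c; the term k = 0
  is h.\<close>

lemma rubio_de_francia:
  fixes h :: "'a \<Rightarrow> ennreal"
  defines "c \<equiv> sqrt (32 * D)"
  assumes h [measurable]: "h \<in> borel_measurable \<mu>"
  obtains H where "H \<in> borel_measurable \<mu>" "\<And>x. h x \<le> H x"
    "(\<integral>\<^sup>+x. (H x)\<^sup>2 \<partial>\<mu>) \<le> 4 * (\<integral>\<^sup>+x. (h x)\<^sup>2 \<partial>\<mu>)"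
    "\<And>x. maxf H x \<le> ennreal (2 * c) * H x"
proof -
  have c: "0 < c" "c\<^sup>2 = 32 * D"
    using D_ge_1 by (auto simp: c_def)
  define u where "u k = (maxf ^^ k) h" for k :: nat
  have u0: "u 0 = h" and uS: "u (Suc k) = maxf (u k)" for k
    by (simp_all add: u_def)
  have [measurable]: "u k \<in> borel_measurable \<mu>" for k
    by (cases k) (simp_all add: u0 uS)
  have uL: "(\<integral>\<^sup>+x. (u k x)\<^sup>2 \<partial>\<mu>) \<le> ennreal (c ^ k) ^ 2 * (\<integral>\<^sup>+x. (h x)\<^sup>2 \<partial>\<mu>)" for k
  proof (induction k)
    case (Suc k)
    have "(\<integral>\<^sup>+x. (u (Suc k) x)\<^sup>2 \<partial>\<mu>) \<le> ennreal (32 * D) * (\<integral>\<^sup>+x. (u k x)\<^sup>2 \<partial>\<mu>)"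
      unfolding uS by (rule maxf_L2) measurable
    also have "\<dots> \<le> ennreal (32 * D) * (ennreal (c ^ k) ^ 2 * (\<integral>\<^sup>+x. (h x)\<^sup>2 \<partial>\<mu>))"
      by (intro mult_left_mono Suc.IH) auto
    also have "\<dots> = ennreal (c ^ Suc k) ^ 2 * (\<integral>\<^sup>+x. (h x)\<^sup>2 \<partial>\<mu>)"
    proof -
      have "ennreal (c ^ Suc k) ^ 2 = ennreal (32 * D) * ennreal (c ^ k) ^ 2"
        using c D_ge_1 by (simp add: ennreal_power power_mult_distrib ennreal_mult)
      then show ?thesis by (simp add: mult.assoc)
    qed
    finally show ?case .
  qed (simp add: u0)
  define b where "b k x = ennreal (1 / c ^ k) * u k x" for k x
  have [measurable]: "b k \<in> borel_measurable \<mu>" for k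
    unfolding b_def by measurable
  have bL: "(\<integral>\<^sup>+x. (b k x)\<^sup>2 \<partial>\<mu>) \<le> (\<integral>\<^sup>+x. (h x)\<^sup>2 \<partial>\<mu>)" for k
  proof -
    have "(\<integral>\<^sup>+x. (b k x)\<^sup>2 \<partial>\<mu>) = ennreal (1 / c ^ k) ^ 2 * (\<integral>\<^sup>+x. (u k x)\<^sup>2 \<partial>\<mu>)"
      unfolding b_def power_mult_distrib by (rule nn_integral_cmult) measurable
    also have "\<dots> \<le> ennreal (1 / c ^ k) ^ 2 * (ennreal (c ^ k) ^ 2 * (\<integral>\<^sup>+x. (h x)\<^sup>2 \<partial>\<mu>))"
      by (intro mult_left_mono uL) auto
    also have "\<dots> = (ennreal (1 / c ^ k) * ennreal (c ^ k)) ^ 2 * (\<integral>\<^sup>+x. (h x)\<^sup>2 \<partial>\<mu>)"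
      by (simp add: power_mult_distrib mult.assoc)
    also have "ennreal (1 / c ^ k) * ennreal (c ^ k) = 1"
      using c by (simp add: ennreal_mult[symmetric])
    finally show ?thesis by simp
  qed
  define H where "H x = (\<Sum>k. ennreal ((1 / 2) ^ k) * b k x)" for x
  have [measurable]: "H \<in> borel_measurable \<mu>"
    unfolding H_def by measurable
  have half: "(\<Sum>k. ennreal ((1 / 2) ^ k)) = 2"
  proof -
    have "(\<lambda>k. (1 / 2 :: real) ^ k) sums 2"
      using geometric_sums[of "1 / 2 :: real"] by simp
    then have "(\<Sum>k. ennreal ((1 / 2) ^ k)) = ennreal 2"
      by (intro suminf_ennreal_eq) auto
    then show ?thesis by simp
  qed
  show thesis
  proof (rule that)
    show "H \<in> borel_measurable \<mu>" by measurable
    show "h x \<le> H x" for x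
    proof -
      have "ennreal ((1 / 2) ^ 0) * b 0 x \<le> H x"
        using sum_le_suminf[of "\<lambda>k. ennreal ((1 / 2) ^ k) * b k x" "{0}"]
        unfolding H_def by (simp add: summableI)
      then show ?thesis by (simp add: b_def u0)
    qed
    \<comment> \<open>Cauchy-Schwarz with the weight (1/2)^k split into two square roots stands in
      for the triangle inequality in L_2. It costs 2 here; summing the weights after integration
      costs another 2, which gives the 4.\<close>
    have H2: "(H x)\<^sup>2 \<le> 2 * (\<Sum>k. ennreal ((1 / 2) ^ k) * (b k x)\<^sup>2)" for x
    proof -
      let ?a = "\<lambda>k. ennreal (sqrt (1 / 2) ^ k)"
      have a: "?a k * ?a k = ennreal ((1 / 2) ^ k)" for k
        by (simp add: ennreal_mult[symmetric] power_mult_distrib[symmetric])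
      have "(H x)\<^sup>2 = (\<integral>\<^sup>+k. ?a k * (?a k * b k x) \<partial>count_space UNIV)\<^sup>2"
        unfolding H_def by (simp add: nn_integral_count_space_nat a mult.assoc[symmetric])
      also have "\<dots> \<le> (\<integral>\<^sup>+k. ?a k ^ 2 \<partial>count_space UNIV) * (\<integral>\<^sup>+k. (?a k * b k x)\<^sup>2 \<partial>count_space UNIV)"
        by (rule Cauchy_Schwarz_nn_integral) auto
      also have "\<dots> = 2 * (\<Sum>k. ennreal ((1 / 2) ^ k) * (b k x)\<^sup>2)"
        by (simp add: nn_integral_count_space_nat power2_eq_square a half mult_ac)
      finally show ?thesis .
    qed
    have "(\<integral>\<^sup>+x. (H x)\<^sup>2 \<partial>\<mu>) \<le> (\<integral>\<^sup>+x. 2 * (\<Sum>k. ennreal ((1 / 2) ^ k) * (b k x)\<^sup>2) \<partial>\<mu>)"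
      by (intro nn_integral_mono H2)
    also have "\<dots> = 2 * (\<Sum>k. \<integral>\<^sup>+x. ennreal ((1 / 2) ^ k) * (b k x)\<^sup>2 \<partial>\<mu>)"
      by (subst nn_integral_cmult, measurable, subst nn_integral_suminf, measurable)
    also have "\<dots> = 2 * (\<Sum>k. ennreal ((1 / 2) ^ k) * (\<integral>\<^sup>+x. (b k x)\<^sup>2 \<partial>\<mu>))"
      by (subst nn_integral_cmult) simp_all
    also have "\<dots> \<le> 2 * (\<Sum>k. ennreal ((1 / 2) ^ k) * (\<integral>\<^sup>+x. (h x)\<^sup>2 \<partial>\<mu>))"
      by (intro mult_left_mono suminf_le summableI bL) auto
    also have "\<dots> = 2 * ((\<Sum>k. ennreal ((1 / 2) ^ k)) * (\<integral>\<^sup>+x. (h x)\<^sup>2 \<partial>\<mu>))"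
      by (simp only: ennreal_suminf_multc)
    also have "\<dots> = 4 * (\<integral>\<^sup>+x. (h x)\<^sup>2 \<partial>\<mu>)"
      unfolding half by (simp add: mult.assoc[symmetric])
    finally show "(\<integral>\<^sup>+x. (H x)\<^sup>2 \<partial>\<mu>) \<le> 4 * (\<integral>\<^sup>+x. (h x)\<^sup>2 \<partial>\<mu>)" .
    show "maxf H x \<le> ennreal (2 * c) * H x" for x
    proof -
      let ?F = "\<lambda>k. ennreal ((1 / 2) ^ k) * b k x"
      have "maxf H x \<le> (\<Sum>k. maxf (\<lambda>x. ennreal ((1 / 2) ^ k) * b k x) x)"
        unfolding H_def by (rule maxf_suminf) measurable
      also have "\<dots> = (\<Sum>k. ennreal (2 * c) * ?F (Suc k))"
      proof (rule suminf_cong)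
        fix k
        have "maxf (\<lambda>x. ennreal ((1 / 2) ^ k) * b k x) x = ennreal ((1 / 2) ^ k) * ennreal (1 / c ^ k) * u (Suc k) x"
          unfolding b_def uS mult.assoc[symmetric] by (rule maxf_cmult) measurable
        also have "ennreal ((1 / 2) ^ k) * ennreal (1 / c ^ k) = ennreal (2 * c) * (ennreal ((1 / 2) ^ Suc k) * ennreal (1 / c ^ Suc k))"
          using c by (simp add: ennreal_mult[symmetric])
        finally show "maxf (\<lambda>x. ennreal ((1 / 2) ^ k) * b k x) x = ennreal (2 * c) * ?F (Suc k)"
          by (simp only: b_def mult.assoc)
      qed
      also have "\<dots> = ennreal (2 * c) * (\<Sum>k. ?F (Suc k))"
        by (rule ennreal_suminf_cmult)
      also have "\<dots> \<le> ennreal (2 * c) * H x"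
      proof (rule mult_left_mono)
        have "(\<Sum>k. ?F (Suc k)) + (\<Sum>k<1. ?F k) = H x"
          unfolding H_def using suminf_offset[of ?F 1] by (simp add: summableI)
        moreover have "(\<Sum>k. ?F (Suc k)) \<le> (\<Sum>k. ?F (Suc k)) + (\<Sum>k<1. ?F k)"
          by simp
        ultimately show "(\<Sum>k. ?F (Suc k)) \<le> H x"
          by (simp only:)
      qed auto
      finally show ?thesis .
    qed
  qed
qed

end

section \<open>Cubes and Muckenhoupt weights\<close>

lemma enn_powr_ennreal: "0 \<le> x \<Longrightarrow> 0 < a \<Longrightarrow> enn_powr (ennreal x) a = ennreal (x powr a)"
  by (auto simp: enn_powr_def)

lemma enn_powr_ennreal_pos: "0 < x \<Longrightarrow> enn_powr (ennreal x) a = ennreal (x powr a)"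
  by (auto simp: enn_powr_def)

lemma enn_powr_infinity: "0 < a \<Longrightarrow> enn_powr \<infinity> a = \<infinity>"
  by (auto simp: enn_powr_def)

text \<open>The parameters x and y will be bounds for the integrals of f and g. The right side is
  linear in f and g, so it can be integrated term by term.\<close>

lemma young_powr:
  fixes f g :: real
  assumes \<theta>: "0 < \<theta>" "\<theta> < 1" and "0 < x" "0 < y" "0 \<le> f" "0 \<le> g"
  shows "f powr \<theta> * g powr (1 - \<theta>) \<le> x powr \<theta> * y powr (1 - \<theta>) * (\<theta> / x * f + (1 - \<theta>) / y * g)"
proof (cases "f = 0 \<or> g = 0")
  case False
  then have fg: "0 < f" "0 < g" using assms by auto
  have "(f / x) powr \<theta> * (g / y) powr (1 - \<theta>) \<le> \<theta> * (f / x) + (1 - \<theta>) * (g / y)"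
    using assms fg by (intro Youngs_inequality_0) auto
  then have "x powr \<theta> * y powr (1 - \<theta>) * ((f / x) powr \<theta> * (g / y) powr (1 - \<theta>))
      \<le> x powr \<theta> * y powr (1 - \<theta>) * (\<theta> * (f / x) + (1 - \<theta>) * (g / y))"
    by (intro mult_left_mono) auto
  moreover have "x powr \<theta> * y powr (1 - \<theta>) * ((f / x) powr \<theta> * (g / y) powr (1 - \<theta>)) = f powr \<theta> * g powr (1 - \<theta>)"
    using assms fg by (simp add: powr_divide)
  ultimately show ?thesis by simp
qed (use assms in auto)

text \<open>Integrating the scaled Young inequality gives the factor \<theta> + (1 - \<theta>) = 1.
  The form with positive upper bounds x, y in place of the integrals themselves removes the case of
  a vanishing integral.\<close>

lemma nn_integral_Holder:
  fixes f g :: "'a \<Rightarrow> real"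
  assumes [measurable]: "f \<in> borel_measurable M" "g \<in> borel_measurable M" "A \<in> sets M"
    and fg: "\<And>x. 0 \<le> f x" "\<And>x. 0 \<le> g x" and \<theta>: "0 < \<theta>" "\<theta> < 1" and xy: "0 < x" "0 < y"
    and f: "(\<integral>\<^sup>+t\<in>A. ennreal (f t) \<partial>M) \<le> ennreal x" and g: "(\<integral>\<^sup>+t\<in>A. ennreal (g t) \<partial>M) \<le> ennreal y"
  shows "(\<integral>\<^sup>+t\<in>A. ennreal (f t powr \<theta> * g t powr (1 - \<theta>)) \<partial>M) \<le> ennreal (x powr \<theta> * y powr (1 - \<theta>))"
proof -
  let ?c = "x powr \<theta> * y powr (1 - \<theta>)"
  have "(\<integral>\<^sup>+t\<in>A. ennreal (f t powr \<theta> * g t powr (1 - \<theta>)) \<partial>M)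
      \<le> (\<integral>\<^sup>+t. ennreal (?c * \<theta> / x) * (ennreal (f t) * indicator A t) + ennreal (?c * (1 - \<theta>) / y) * (ennreal (g t) * indicator A t) \<partial>M)"
  proof (rule nn_integral_mono)
    fix t
    have "ennreal (f t powr \<theta> * g t powr (1 - \<theta>)) \<le> ennreal (?c * (\<theta> / x * f t + (1 - \<theta>) / y * g t))"
      by (intro ennreal_leI young_powr \<theta> xy fg)
    also have "\<dots> = ennreal (?c * \<theta> / x) * ennreal (f t) + ennreal (?c * (1 - \<theta>) / y) * ennreal (g t)"
    proof -
      have "?c * (\<theta> / x * f t + (1 - \<theta>) / y * g t) = ?c * \<theta> / x * f t + ?c * (1 - \<theta>) / y * g t"
        by (simp add: distrib_left)
      then show ?thesis
        using \<theta> xy fg[of t] by (simp add: ennreal_mult del: times_divide_eq_left times_divide_eq_right)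
    qed
    finally show "ennreal (f t powr \<theta> * g t powr (1 - \<theta>)) * indicator A t
       \<le> ennreal (?c * \<theta> / x) * (ennreal (f t) * indicator A t) + ennreal (?c * (1 - \<theta>) / y) * (ennreal (g t) * indicator A t)"
      by (auto simp: indicator_def)
  qed
  also have "\<dots> = ennreal (?c * \<theta> / x) * (\<integral>\<^sup>+t\<in>A. ennreal (f t) \<partial>M) + ennreal (?c * (1 - \<theta>) / y) * (\<integral>\<^sup>+t\<in>A. ennreal (g t) \<partial>M)"
    by (simp add: nn_integral_add nn_integral_cmult)
  also have "\<dots> \<le> ennreal (?c * \<theta> / x) * ennreal x + ennreal (?c * (1 - \<theta>) / y) * ennreal y"
    by (intro add_mono mult_left_mono f g) auto
  also have "\<dots> = ennreal (?c * \<theta> + ?c * (1 - \<theta>))"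
    using \<theta> xy by (subst ennreal_plus) (simp_all add: ennreal_mult[symmetric])
  also have "?c * \<theta> + ?c * (1 - \<theta>) = ?c"
    by (simp add: algebra_simps)
  finally show ?thesis .
qed

text \<open>Centre and half side in place of corner and side, so that concentric dilation only
  scales \<open>s\<close>.\<close>

definition cb :: "real ^ 'n \<Rightarrow> real \<Rightarrow> (real ^ 'n) set" where
  "cb z s = cbox (\<chi> i. z $ i - s) (\<chi> i. z $ i + s)"

lemma mem_cb: "x \<in> cb z s \<longleftrightarrow> (\<forall>i. \<bar>x $ i - z $ i\<bar> \<le> s)"
  by (simp add: cb_def mem_box_cart abs_diff_le_iff)

lemma cubes_eq: "cubes = {cb z s | z s. 0 < s}"
proof -
  have 1: "cbox a (\<chi> i. a $ i + l) = cb (\<chi> i. a $ i + l / 2) (l / 2)" for a :: "real ^ 'n" and l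
    unfolding cb_def by (rule arg_cong2[where f = cbox]) (simp_all add: vec_eq_iff)
  have 2: "cb z s = cbox (\<chi> i. z $ i - s) (\<chi> i. (\<chi> i. z $ i - s) $ i + 2 * s)" for z :: "real ^ 'n" and s
    unfolding cb_def by (rule arg_cong2[where f = cbox]) (simp_all add: vec_eq_iff)
  show ?thesis
    unfolding cubes_def
  proof (intro set_eqI iffI; clarify)
    show "\<exists>z s. cbox a (\<chi> i. a $ i + l) = cb z s \<and> 0 < s" if "0 < l" for a :: "real ^ 'n" and l
      using that 1 by (intro exI[of _ "\<chi> i. a $ i + l / 2"] exI[of _ "l / 2"]) auto
    show "\<exists>a l. cb z s = cbox a (\<chi> i. a $ i + l) \<and> 0 < l" if "0 < s" for z :: "real ^ 'n" and s
      using that by (intro exI[of _ "\<chi> i. z $ i - s"] exI[of _ "2 * s"] conjI 2) auto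
  qed
qed

lemma cb_sets [measurable]: "cb z s \<in> sets lebesgue"
  by (simp add: cb_def)

lemma center_in_cb: "0 \<le> s \<Longrightarrow> z \<in> cb z s"
  by (simp add: mem_cb)

lemma cb_mono: "s \<le> t \<Longrightarrow> cb z s \<subseteq> cb z t"
  unfolding subset_iff mem_cb by (meson order_trans)

lemma emeasure_cb:
  fixes z :: "real ^ 'n"
  assumes "0 < s"
  shows "emeasure lebesgue (cb z s) = ennreal ((2 * s) ^ CARD('n))"
proof -
  have "cb z s \<noteq> {}" using center_in_cb[of s z] assms by auto
  then have "measure lebesgue (cb z s) = (2 * s) ^ CARD('n)"
    unfolding cb_def by (simp add: content_cbox_cart)
  moreover have "emeasure lebesgue (cb z s) = ennreal (measure lebesgue (cb z s))"
    unfolding cb_def using emeasure_lborel_cbox_finite by (intro emeasure_eq_ennreal_measure) (auto simp: less_top)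
  ultimately show ?thesis by simp
qed

lemma AE_cb_witness:
  fixes z :: "real ^ 'n"
  assumes "AE x in lebesgue. x \<in> cb z s \<longrightarrow> P x" "0 < s"
  shows "\<exists>x\<in>cb z s. P x"
proof (rule ccontr)
  assume "\<not> (\<exists>x\<in>cb z s. P x)"
  with assms(1) have "AE x in lebesgue. x \<notin> cb z s" by (auto elim: eventually_mono)
  then have "emeasure lebesgue (cb z s) = 0"
    by (subst (asm) AE_iff_measurable[OF cb_sets]) auto
  moreover have "0 < (2 * s) ^ CARD('n)" using assms(2) by simp
  ultimately show False
    unfolding emeasure_cb[OF assms(2)] using not_le by (simp only: ennreal_eq_0_iff)
qed

lemma bounded_subset_cb:
  assumes "bounded S" obtains s where "0 < s" "S \<subseteq> cb z s"
proof -
  obtain e where e: "0 < e" "S \<subseteq> ball z e"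
    using bounded_subset_ballD[OF assms] by blast
  have "S \<subseteq> cb z e"
  proof
    fix x assume "x \<in> S"
    then have "norm (x - z) < e" using e by (auto simp: dist_norm norm_minus_commute)
    then show "x \<in> cb z e"
      unfolding mem_cb using component_le_norm_cart[of "x - z"] 
      by (metis less_eq_real_def order_trans vector_minus_component)
  qed
  with e that show ?thesis by blast
qed

section \<open>The A_q condition in terms of masses of cubes\<close>

definition dualw :: "real \<Rightarrow> (real ^ 'n \<Rightarrow> real) \<Rightarrow> real ^ 'n \<Rightarrow> real" where
  "dualw q w x = w x powr (1 - q / (q - 1))"

definition cmass :: "(real ^ 'n \<Rightarrow> real) \<Rightarrow> real ^ 'n \<Rightarrow> real \<Rightarrow> real" where
  "cmass w z s = enn2real (wmeas w (cb z s))"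

text \<open>The A_q condition with constant at most \<open>B\<close>, multiplied out by |Q|^q.
  Finiteness is required separately because \<open>cmass\<close> turns an infinite mass into 0,
  which would satisfy the inequality for the wrong reason.\<close>

definition muckenhoupt :: "real \<Rightarrow> real \<Rightarrow> (real ^ 'n \<Rightarrow> real) \<Rightarrow> bool" where
  "muckenhoupt q B w \<longleftrightarrow> w \<in> borel_measurable lebesgue \<and> (\<forall>x. 0 \<le> w x) \<and> (AE x in lebesgue. 0 < w x) \<and>
     (\<forall>z s. 0 < s \<longrightarrow> wmeas w (cb z s) < \<infinity> \<and> wmeas (dualw q w) (cb z s) < \<infinity> \<and>
        cmass w z s * cmass (dualw q w) z s powr (q - 1) \<le> B * ((2 * s) ^ CARD('n)) powr q)"

lemma wmeas_mono: "A \<subseteq> A' \<Longrightarrow> wmeas w A \<le> wmeas w A'"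
  unfolding wmeas_def by (intro nn_integral_mono) (auto simp: indicator_def)

lemma wmeas_pos:
  assumes "w \<in> borel_measurable lebesgue" "AE x in lebesgue. 0 < w x" "0 < s"
  shows "0 < wmeas w (cb z s)"
proof (rule ccontr)
  assume "\<not> 0 < wmeas w (cb z s)"
  then have "(\<integral>\<^sup>+x\<in>cb z s. ennreal (w x) \<partial>lebesgue) = 0"
    unfolding wmeas_def by simp
  then have "AE x in lebesgue. ennreal (w x) * indicator (cb z s) x = 0"
    using assms(1) by (subst (asm) nn_integral_0_iff_AE) auto
  with assms(2) have "AE x in lebesgue. x \<in> cb z s \<longrightarrow> False"
    by eventually_elim (auto simp: indicator_def split: if_splits)
  from AE_cb_witness[OF this assms(3)] show False by simp
qed

lemma cmass_nonneg [simp]: "0 \<le> cmass w z s"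
  by (simp add: cmass_def)

lemma wmeas_eq_cmass: "wmeas w (cb z s) < \<infinity> \<Longrightarrow> wmeas w (cb z s) = ennreal (cmass w z s)"
  by (simp add: cmass_def)

lemma cmass_leI: "wmeas w (cb z s) \<le> ennreal c \<Longrightarrow> 0 \<le> c \<Longrightarrow> cmass w z s \<le> c"
  unfolding cmass_def by (rule enn2real_leI)

lemma dualw_measurable [measurable]: "w \<in> borel_measurable lebesgue \<Longrightarrow> dualw q w \<in> borel_measurable lebesgue"
  unfolding dualw_def by measurable

context
  fixes q B :: real and w :: "real ^ 'n \<Rightarrow> real"
  assumes m: "muckenhoupt q B w"
begin

lemma muck_measurable: "w \<in> borel_measurable lebesgue"
  and muck_nonneg: "0 \<le> w x"
  and muck_pos: "AE x in lebesgue. 0 < w x"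
  and muck_dual_pos: "AE x in lebesgue. 0 < dualw q w x"
  using m by (auto simp: muckenhoupt_def dualw_def elim: eventually_mono)

lemma muck_wmeas: "0 < s \<Longrightarrow> wmeas w (cb z s) = ennreal (cmass w z s)"
  and muck_dual_wmeas: "0 < s \<Longrightarrow> wmeas (dualw q w) (cb z s) = ennreal (cmass (dualw q w) z s)"
  and muck_ineq: "0 < s \<Longrightarrow> cmass w z s * cmass (dualw q w) z s powr (q - 1) \<le> B * ((2 * s) ^ CARD('n)) powr q"
  using m by (auto simp: muckenhoupt_def intro!: wmeas_eq_cmass)

lemma muck_cmass_pos: "0 < s \<Longrightarrow> 0 < cmass w z s"
  and muck_dual_cmass_pos: "0 < s \<Longrightarrow> 0 < cmass (dualw q w) z s"
  using wmeas_pos[OF muck_measurable muck_pos, of s z] muck_wmeas[of s z]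
    wmeas_pos[OF dualw_measurable[OF muck_measurable] muck_dual_pos, of s z] muck_dual_wmeas[of s z]
  by (auto simp: ennreal_zero_less_mult_iff)

end

lemma dual_exponent: "1 < q \<Longrightarrow> 1 - q / (q - 1) = - (1 / (q - 1))" for q :: real
  by (simp add: field_simps)

lemma Ap_const_cb:
  fixes w :: "real ^ 'n \<Rightarrow> real"
  assumes "1 < q" "0 < s" "wmeas w (cb z s) < \<infinity>" "wmeas (dualw q w) (cb z s) < \<infinity>"
  shows "avg w (cb z s) * enn_powr (avg (\<lambda>x. w x powr (1 - q / (q - 1))) (cb z s)) (q - 1)
    = ennreal (cmass w z s * cmass (dualw q w) z s powr (q - 1) / ((2 * s) ^ CARD('n)) powr q)"
proof -
  let ?m = "(2 * s) ^ CARD('n)"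
  have m: "0 < ?m" using assms by simp
  have a: "avg v (cb z s) = ennreal (cmass v z s / ?m)" if "wmeas v (cb z s) < \<infinity>" for v
    unfolding avg_def wmeas_eq_cmass[OF that] emeasure_cb[OF assms(2)]
    using m by (simp add: divide_ennreal)
  have "avg w (cb z s) * enn_powr (avg (dualw q w) (cb z s)) (q - 1)
      = ennreal (cmass w z s / ?m * (cmass (dualw q w) z s / ?m) powr (q - 1))"
    unfolding a[OF assms(3)] a[OF assms(4)]
    using assms(1) m by (simp add: enn_powr_ennreal ennreal_mult[symmetric])
  also have "cmass w z s / ?m * (cmass (dualw q w) z s / ?m) powr (q - 1)
      = cmass w z s * cmass (dualw q w) z s powr (q - 1) / (?m powr 1 * ?m powr (q - 1))"
    using m by (simp add: powr_divide)
  also have "?m powr 1 * ?m powr (q - 1) = ?m powr q"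
    unfolding powr_add[symmetric] by simp
  finally show ?thesis
    by (simp add: dualw_def[abs_def])
qed

text \<open>Local integrability gives measurability only after restriction to a compact set; the
  weight is the pointwise limit of its restrictions to growing cubes.\<close>

lemma weight_measurable:
  fixes w :: "real ^ 'n \<Rightarrow> real"
  assumes "weight w" shows "w \<in> borel_measurable lebesgue"
proof (rule borel_measurable_LIMSEQ_real)
  fix x :: "real ^ 'n"
  obtain s where s: "{x} \<subseteq> cb 0 s" using bounded_subset_cb[of "{x}" 0] by auto
  have "\<forall>\<^sub>F n in sequentially. indicator (cb 0 (real n)) x *\<^sub>R w x = w x"
    using eventually_ge_at_top[of "nat \<lceil>s\<rceil>"]
  proof eventually_elim
    case (elim n)
    then have "s \<le> real n" by linarith
    then have "x \<in> cb 0 (real n)" using s cb_mono by blast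
    then show ?case by simp
  qed
  then show "(\<lambda>n. indicator (cb 0 (real n)) x *\<^sub>R w x) \<longlonglongrightarrow> w x"
    by (rule tendsto_eventually)
next
  fix n
  have "compact (cb (0 :: real ^ 'n) (real n))" by (simp add: cb_def)
  then have "set_integrable lebesgue (cb 0 (real n)) w" using assms by (auto simp: weight_def)
  then show "(\<lambda>x. indicator (cb 0 (real n)) x *\<^sub>R w x) \<in> borel_measurable lebesgue"
    unfolding set_integrable_def by (rule borel_measurable_integrable)
qed

lemma weight_wmeas_finite:
  assumes "weight w" shows "wmeas w (cb z s) < \<infinity>"
proof -
  have "set_integrable lebesgue (cb z s) w" using assms by (auto simp: weight_def cb_def)
  then have "(\<integral>\<^sup>+x. ennreal (norm (indicator (cb z s) x *\<^sub>R w x)) \<partial>lebesgue) < \<infinity>"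
    unfolding set_integrable_def by (simp add: integrable_iff_bounded)
  moreover have "wmeas w (cb z s) = (\<integral>\<^sup>+x. ennreal (norm (indicator (cb z s) x *\<^sub>R w x)) \<partial>lebesgue)"
    unfolding wmeas_def using assms by (intro nn_integral_cong) (auto simp: indicator_def weight_def)
  ultimately show ?thesis by simp
qed

lemma weightI:
  fixes w :: "real ^ 'n \<Rightarrow> real"
  assumes [measurable]: "w \<in> borel_measurable lebesgue" and "\<And>x. 0 \<le> w x" "\<And>s. 0 < s \<Longrightarrow> wmeas w (cb 0 s) < \<infinity>"
  shows "weight w"
  unfolding weight_def
proof (intro conjI allI impI)
  fix K :: "(real ^ 'n) set" assume "compact K"
  then obtain s where s: "0 < s" "K \<subseteq> cb 0 s" using bounded_subset_cb compact_imp_bounded by blast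
  have [measurable]: "K \<in> sets lebesgue" using \<open>compact K\<close> by (simp add: lmeasurable_compact fmeasurableD)
  have "(\<integral>\<^sup>+x. ennreal (norm (indicator K x *\<^sub>R w x)) \<partial>lebesgue) \<le> wmeas w (cb 0 s)"
    unfolding wmeas_def using assms(2) s by (intro nn_integral_mono) (auto simp: indicator_def)
  also have "\<dots> < \<infinity>" using assms(3)[OF s(1)] .
  finally show "set_integrable lebesgue K w"
    unfolding set_integrable_def by (intro integrableI_bounded) measurable
qed (use assms in auto)

lemma muckenhoupt_iff:
  fixes w :: "real ^ 'n \<Rightarrow> real"
  assumes q: "1 < q" and B: "0 \<le> B"
  shows "muckenhoupt q B w \<longleftrightarrow> w \<in> Ap q \<and> Ap_const q w \<le> ennreal B"
proof
  assume m: "muckenhoupt q B w"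
  have fin: "wmeas w (cb z s) < \<infinity>" "wmeas (dualw q w) (cb z s) < \<infinity>" if "0 < s" for z s
    using m that by (auto simp: muckenhoupt_def)
  have "Ap_const q w \<le> ennreal B"
    unfolding Ap_const_def cubes_eq using q
  proof (simp, intro SUP_least, clarify)
    fix z :: "real ^ 'n" and s :: real assume s: "0 < s"
    show "avg w (cb z s) * enn_powr (avg (\<lambda>x. w x powr (1 - q / (q - 1))) (cb z s)) (q - 1) \<le> ennreal B"
      unfolding Ap_const_cb[OF q s fin[OF s]]
      using muck_ineq[OF m s, of z] s B by (intro ennreal_leI) (simp add: divide_le_eq)
  qed
  moreover have "weight w"
    using muck_measurable[OF m] muck_nonneg[OF m] fin by (intro weightI) auto
  ultimately show "w \<in> Ap q \<and> Ap_const q w \<le> ennreal B"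
    using muck_pos[OF m] by (auto simp: Ap_def intro: le_less_trans)
next
  assume *: "w \<in> Ap q \<and> Ap_const q w \<le> ennreal B"
  then have w: "weight w" "AE x in lebesgue. 0 < w x" by (auto simp: Ap_def)
  note meas = weight_measurable[OF w(1)]
  show "muckenhoupt q B w"
    unfolding muckenhoupt_def
  proof (intro conjI allI impI)
    fix z :: "real ^ 'n" and s :: real assume s: "0 < s"
    show fin: "wmeas w (cb z s) < \<infinity>" by (rule weight_wmeas_finite[OF w(1)])
    have m: "0 < (2 * s) ^ CARD('n)" using s by simp
    have le: "avg w (cb z s) * enn_powr (avg (\<lambda>x. w x powr (1 - q / (q - 1))) (cb z s)) (q - 1) \<le> ennreal B"
    proof (rule order_trans)
      have "cb z s \<in> cubes" using s by (auto simp: cubes_eq)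
      then show "avg w (cb z s) * enn_powr (avg (\<lambda>x. w x powr (1 - q / (q - 1))) (cb z s)) (q - 1)
          \<le> (SUP Q\<in>cubes. avg w Q * enn_powr (avg (\<lambda>x. w x powr (1 - q / (q - 1))) Q) (q - 1))"
        by (rule SUP_upper)
      show "(SUP Q\<in>cubes. avg w Q * enn_powr (avg (\<lambda>x. w x powr (1 - q / (q - 1))) Q) (q - 1)) \<le> ennreal B"
        using * q by (simp add: Ap_const_def)
    qed
    \<comment> \<open>An infinite dual mass would make the product of averages infinite, since the
      average of w over a cube is positive.\<close>
    show fin2: "wmeas (dualw q w) (cb z s) < \<infinity>"
    proof (rule ccontr)
      assume "\<not> ?thesis"
      then have "avg (\<lambda>x. w x powr (1 - q / (q - 1))) (cb z s) = \<infinity>"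
        unfolding avg_def emeasure_cb[OF s] dualw_def[abs_def] using m
        by (simp add: not_less ennreal_top_divide top_unique)
      moreover have "0 < avg w (cb z s)"
        unfolding avg_def emeasure_cb[OF s] using wmeas_pos[OF meas w(2) s, of z] m
        by (simp add: ennreal_zero_less_divide)
      ultimately show False
        using le q by (auto simp: enn_powr_infinity[simplified] ennreal_mult_top top_unique split: if_splits)
    qed
    have "cmass w z s * cmass (dualw q w) z s powr (q - 1) / ((2 * s) ^ CARD('n)) powr q \<le> B"
      using le B unfolding Ap_const_cb[OF q s fin fin2] by (simp add: ennreal_le_iff)
    then show "cmass w z s * cmass (dualw q w) z s powr (q - 1) \<le> B * ((2 * s) ^ CARD('n)) powr q"
      using m s by (simp add: divide_le_eq)
  qed (use w meas in \<open>auto simp: weight_def\<close>)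
qed

section \<open>Doubling and majorants in \<open>A\<^sub>1(w)\<close>\<close>

lemma cmass_mono:
  assumes "cb y t \<subseteq> cb z s" "wmeas w (cb z s) < \<infinity>"
  shows "cmass w y t \<le> cmass w z s"
  unfolding cmass_def using assms by (intro enn2real_mono wmeas_mono) auto

context
  fixes q B :: real and w :: "real ^ 'n \<Rightarrow> real"
  assumes q: "1 < q" and m: "muckenhoupt q B w"
begin

text \<open>Hoelder applied to 1 = w^(1/q) (w^(1-q'))^(1-1/q). This is the A_q inequality reversed,
  with constant 1.\<close>

lemma muck_cube_lower:
  assumes t: "0 < t"
  shows "((2 * t) ^ CARD('n)) powr q \<le> cmass w y t * cmass (dualw q w) y t powr (q - 1)"
proof -
  note [measurable] = muck_measurable[OF m]
  let ?a = "cmass w y t" and ?b = "cmass (dualw q w) y t"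
  have pos: "0 < ?a" "0 < ?b"
    using muck_cmass_pos[OF m t] muck_dual_cmass_pos[OF m t] by auto
  have ae: "AE x in lebesgue. w x powr (1 / q) * dualw q w x powr (1 - 1 / q) = 1"
    using muck_pos[OF m]
  proof eventually_elim
    case (elim x)
    have "1 / q + (1 - q / (q - 1)) * (1 - 1 / q) = 0"
      using q by (simp add: field_simps)
    then show ?case
      using elim by (simp add: dualw_def powr_powr powr_add[symmetric])
  qed
  have "ennreal ((2 * t) ^ CARD('n)) = (\<integral>\<^sup>+x\<in>cb y t. 1 \<partial>lebesgue)"
    using nn_integral_indicator[of "cb y t" lebesgue] emeasure_cb[OF t, of y] by (simp only: mult_1 cb_sets)
  also have "\<dots> = (\<integral>\<^sup>+x\<in>cb y t. ennreal (w x powr (1 / q) * dualw q w x powr (1 - 1 / q)) \<partial>lebesgue)"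
    using ae by (intro nn_integral_cong_AE) auto
  also have "\<dots> \<le> ennreal (?a powr (1 / q) * ?b powr (1 - 1 / q))"
    using q pos muck_nonneg[OF m] muck_wmeas[OF m t] muck_dual_wmeas[OF m t]
    by (intro nn_integral_Holder) (auto simp: wmeas_def dualw_def)
  finally have "(2 * t) ^ CARD('n) \<le> ?a powr (1 / q) * ?b powr (1 - 1 / q)"
    using pos by (simp add: ennreal_le_iff)
  then have "((2 * t) ^ CARD('n)) powr q \<le> (?a powr (1 / q) * ?b powr (1 - 1 / q)) powr q"
    using q t by (intro powr_mono2) auto
  also have "\<dots> = ?a * ?b powr (q - 1)"
    using q pos by (simp add: powr_mult powr_powr left_diff_distrib)
  finally show ?thesis .
qed

lemma muck_ge_1: "1 \<le> B"
proof -
  have "((2 * 1) ^ CARD('n)) powr q \<le> B * ((2 * 1) ^ CARD('n)) powr q"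
    using muck_cube_lower[of 1 0] muck_ineq[OF m, of 1 0] by linarith
  then show ?thesis by simp
qed

text \<open>Reversed inequality on the inner cube, A_q on the outer one: the dual mass of the inner
  cube is enlarged to that of the outer cube, which A_q then removes. The cubes need not be
  concentric; off-centre subcubes are used below.\<close>

lemma muck_doubling:
  assumes sub: "cb y t \<subseteq> cb z s" and t: "0 < t" and s: "0 < s"
  shows "cmass w z s \<le> B * (s / t) powr (real CARD('n) * q) * cmass w y t"
proof -
  let ?P = "((2 * t) ^ CARD('n)) powr q" and ?Q = "((2 * s) ^ CARD('n)) powr q"
  have P: "0 < ?P" using t by simp
  have "cmass (dualw q w) y t powr (q - 1) \<le> cmass (dualw q w) z s powr (q - 1)"
    using q muck_dual_wmeas[OF m s] by (intro powr_mono2 cmass_mono sub) auto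
  then have "?P \<le> cmass w y t * cmass (dualw q w) z s powr (q - 1)"
    using muck_cube_lower[OF t, of y] by (smt (verit) cmass_nonneg mult_left_mono)
  then have "cmass w z s * ?P \<le> cmass w z s * (cmass w y t * cmass (dualw q w) z s powr (q - 1))"
    by (intro mult_left_mono) auto
  also have "\<dots> = cmass w y t * (cmass w z s * cmass (dualw q w) z s powr (q - 1))"
    by simp
  also have "\<dots> \<le> cmass w y t * (B * ?Q)"
    by (intro mult_left_mono muck_ineq[OF m s]) auto
  finally have "cmass w z s \<le> B * (?Q / ?P) * cmass w y t"
    using P by (simp add: field_simps)
  also have "?Q / ?P = (s / t) powr (real CARD('n) * q)"
  proof -
    have "?Q / ?P = (((2 * s) ^ CARD('n)) / ((2 * t) ^ CARD('n))) powr q"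
      using s t by (intro powr_divide[symmetric])
    also have "((2 * s) ^ CARD('n)) / ((2 * t) ^ CARD('n)) = (s / t) powr CARD('n)"
      using s t by (simp add: powr_realpow power_divide[symmetric] del: power_divide)
    finally show ?thesis by (simp add: powr_powr)
  qed
  finally show ?thesis .
qed

text \<open>The number 6 is the ratio of the half sides 3 s and s / 2: by doubling, a subcube of
  half side s / 2 carries at least the fraction 1 / (B 6^(n q)) of the mass of
  \<open>cb z (3 * s)\<close>, and the rest is left for \<open>cb z s\<close>.\<close>

definition rev_const :: real where
  "rev_const = 1 - 1 / (B * 6 powr (real CARD('n) * q))"

lemma rev_const_bounds: "0 \<le> rev_const" "rev_const < 1"
proof -
  have "1 \<le> (6::real) powr (real CARD('n) * q)"
    using q by (intro ge_one_powr_ge_zero) auto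
  then have "1 * 1 \<le> B * 6 powr (real CARD('n) * q)"
    using muck_ge_1 by (intro mult_mono) auto
  then show "0 \<le> rev_const" "rev_const < 1"
    unfolding rev_const_def by auto
qed

text \<open>The cube \<open>cb z (3 * s)\<close> contains a cube disjoint from \<open>cb z s\<close> of comparable size.\<close>

lemma muck_reverse_doubling:
  assumes s: "0 < s"
  shows "cmass w z s \<le> rev_const * cmass w z (3 * s)"
proof -
  note [measurable] = muck_measurable[OF m]
  \<comment> \<open>In every coordinate the cube of half side s / 2 about \<open>y\<close> lies at
    distance between 3 s / 2 and 5 s / 2 from \<open>z\<close>, hence outside \<open>cb z s\<close>
    and inside \<open>cb z (3 * s)\<close>.\<close>
  define y where "y = (\<chi> i. z $ i + 2 * s)"
  have "\<bar>x $ i - z $ i\<bar> \<le> 3 * s" if "\<bar>x $ i - y $ i\<bar> \<le> s / 2" for x i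
  proof -
    have "y $ i = z $ i + 2 * s" by (simp add: y_def)
    with that s show ?thesis by linarith
  qed
  then have sub: "cb y (s / 2) \<subseteq> cb z (3 * s)"
    unfolding subset_iff mem_cb by blast
  have disj: "cb z s \<inter> cb y (s / 2) = {}"
  proof safe
    fix x assume "x \<in> cb z s" "x \<in> cb y (s / 2)"
    then have "\<bar>x $ i - z $ i\<bar> \<le> s" "\<bar>x $ i - (z $ i + 2 * s)\<bar> \<le> s / 2" for i
      by (auto simp: mem_cb y_def)
    from this[of undefined] show "x \<in> {}" using s by (simp add: abs_le_iff)
  qed
  have "wmeas w (cb z s) + wmeas w (cb y (s / 2)) = (\<integral>\<^sup>+x. ennreal (w x) * indicator (cb z s) x + ennreal (w x) * indicator (cb y (s / 2)) x \<partial>lebesgue)"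
    unfolding wmeas_def by (rule nn_integral_add[symmetric]) measurable
  also have "\<dots> \<le> wmeas w (cb z (3 * s))"
    unfolding wmeas_def using sub s cb_mono[of s "3 * s" z] disj by (intro nn_integral_mono) (auto simp: indicator_def)
  finally have "cmass w z s + cmass w y (s / 2) \<le> cmass w z (3 * s)"
    using s by (simp add: muck_wmeas[OF m] ennreal_plus[symmetric] ennreal_le_iff del: ennreal_plus)
  moreover have "cmass w z (3 * s) \<le> B * 6 powr (real CARD('n) * q) * cmass w y (s / 2)"
    using muck_doubling[OF sub] s by simp
  then have "cmass w z (3 * s) / (B * 6 powr (real CARD('n) * q)) \<le> cmass w y (s / 2)"
    using muck_ge_1 by (simp add: field_simps)
  ultimately show ?thesis
    unfolding rev_const_def by (simp add: algebra_simps)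
qed

end

section \<open>From cubes to balls: the doubling measure w dx\<close>

lemma cb_subset_cball: "cb z s \<subseteq> cball z (real CARD('n) * s)" for z :: "real ^ 'n"
proof
  fix x assume "x \<in> cb z s"
  then have "(\<Sum>i\<in>UNIV. \<bar>(x - z) $ i\<bar>) \<le> (\<Sum>i\<in>(UNIV :: 'n set). s)"
    by (intro sum_mono) (auto simp: mem_cb)
  with norm_le_l1_cart[of "x - z"] show "x \<in> cball z (real CARD('n) * s)"
    by (simp add: dist_norm norm_minus_commute)
qed

lemma cball_subset_cb: "cball z s \<subseteq> cb z s" for z :: "real ^ 'n"
proof
  fix x assume "x \<in> cball z s"
  then have "norm (x - z) \<le> s" by (simp add: dist_norm norm_minus_commute)
  then show "x \<in> cb z s"
    unfolding mem_cb using component_le_norm_cart[of "x - z"]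
    by (metis order_trans vector_minus_component)
qed

text \<open>The ball of radius r contains the concentric cube of half side r / n, and the ball of
  radius 5 r lies in the cube of half side 5 r; the ratio of the half sides is 5 n.\<close>

definition doub_const :: "'n itself \<Rightarrow> real \<Rightarrow> real \<Rightarrow> real" where
  "doub_const _ q B = B * (5 * real CARD('n)) powr (real CARD('n) * q)"

lemma muck_doubling_measure:
  fixes w :: "real ^ 'n \<Rightarrow> real"
  assumes q: "1 < q" and m: "muckenhoupt q B w"
  shows "doubling_measure (density lebesgue (\<lambda>x. ennreal (w x))) (doub_const TYPE('n) q B)"
proof
  note [measurable] = muck_measurable[OF m]
  let ?\<mu> = "density lebesgue (\<lambda>x. ennreal (w x))" and ?n = "real CARD('n)"
  have em: "emeasure ?\<mu> A = wmeas w A" if "A \<in> sets lebesgue" for A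
    unfolding wmeas_def using that by (subst emeasure_density) auto
  have n: "1 \<le> ?n" by (simp add: Suc_leI)
  have inner: "cb c (r / ?n) \<subseteq> cball c r" for c :: "real ^ 'n" and r
    using cb_subset_cball[of c "r / ?n"] n by simp
  show "sets ?\<mu> = sets lebesgue" by simp
  show "0 < emeasure ?\<mu> (cball c r)" if r: "0 < r" for c r
  proof -
    have "0 < wmeas w (cb c (r / ?n))"
      using wmeas_pos[OF muck_measurable[OF m] muck_pos[OF m]] r n by simp
    also have "\<dots> \<le> wmeas w (cball c r)"
      by (rule wmeas_mono[OF inner])
    finally show ?thesis by (simp add: em)
  qed
  show "emeasure ?\<mu> (cball c r) < \<infinity>" for c r
  proof -
    have "cball c r \<subseteq> cball c (max r 1)" by (auto)
    then have "wmeas w (cball c r) \<le> wmeas w (cb c (max r 1))"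
      using cball_subset_cb by (intro wmeas_mono) blast
    also have "\<dots> < \<infinity>" by (simp add: muck_wmeas[OF m])
    finally show ?thesis by (simp add: em)
  qed
  show "emeasure ?\<mu> (cball c (5 * r)) \<le> ennreal (doub_const TYPE('n) q B) * emeasure ?\<mu> (cball c r)"
    if r: "0 < r" for c r
  proof -
    have le: "r / ?n \<le> 5 * r"
    proof -
      have "r / ?n \<le> r / 1" using r n by (intro divide_left_mono) auto
      then show ?thesis using r by simp
    qed
    have "wmeas w (cball c (5 * r)) \<le> wmeas w (cb c (5 * r))"
      by (rule wmeas_mono[OF cball_subset_cb])
    also have "\<dots> = ennreal (cmass w c (5 * r))"
      using r by (simp add: muck_wmeas[OF m])
    also have "\<dots> \<le> ennreal (doub_const TYPE('n) q B * cmass w c (r / ?n))"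
      using muck_doubling[OF q m cb_mono[OF le], of c] r n
      unfolding doub_const_def by (intro ennreal_leI) (simp add: mult.commute)
    also have "\<dots> = ennreal (doub_const TYPE('n) q B) * wmeas w (cb c (r / ?n))"
      using r n muck_ge_1[OF q m] by (simp add: muck_wmeas[OF m] ennreal_mult doub_const_def)
    also have "\<dots> \<le> ennreal (doub_const TYPE('n) q B) * wmeas w (cball c r)"
      by (intro mult_left_mono wmeas_mono[OF inner]) auto
    finally show ?thesis by (simp add: em)
  qed
  show "1 \<le> doub_const TYPE('n) q B"
  proof -
    have "1 \<le> 5 * ?n" using n by linarith
    then have "1 \<le> (5 * ?n) powr (?n * q)" by (rule ge_one_powr_ge_zero) (use q in simp)
    then have "1 * 1 \<le> B * (5 * ?n) powr (?n * q)"
      using muck_ge_1[OF q m] by (intro mult_mono) auto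
    then show ?thesis by (simp add: doub_const_def)
  qed
qed

text \<open>Positivity is demanded everywhere and not just almost everywhere, so that negative
  powers of \<open>H\<close> create no exceptional set.\<close>

definition A1_rel :: "real \<Rightarrow> (real ^ 'n \<Rightarrow> real) \<Rightarrow> (real ^ 'n \<Rightarrow> real) \<Rightarrow> bool" where
  "A1_rel K w H \<longleftrightarrow> H \<in> borel_measurable lebesgue \<and> (\<forall>x. 0 < H x) \<and>
     (\<forall>z s. 0 < s \<longrightarrow> (AE x in lebesgue. x \<in> cb z s \<longrightarrow>
        wmeas (\<lambda>y. w y * H y) (cb z s) \<le> ennreal (K * H x * cmass w z s)))"

text \<open>The first factor is the 2 c of the iteration. The second pays for replacing a cube of
  half side s by a ball of the countable family, which lies in the concentric cube of half side (n +
  3) s.\<close>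

definition A1_const :: "'n itself \<Rightarrow> real \<Rightarrow> real \<Rightarrow> real" where
  "A1_const T q B = 2 * sqrt (32 * doub_const T q B) * (B * (real CARD('n) + 3) powr (real CARD('n) * q))"

text \<open>The iteration is run for the measure w dx and carried back to Lebesgue measure, with
  real values. The condition \<open>nz\<close> makes the majorant positive everywhere, because a
  single zero of it would spread over the whole space.\<close>

lemma A1_majorant:
  fixes w h :: "real ^ 'n \<Rightarrow> real"
  assumes q: "1 < q" and m: "muckenhoupt q B w"
    and h [measurable]: "h \<in> borel_measurable lebesgue" and h0: "\<And>x. 0 \<le> h x"
    and fin: "(\<integral>\<^sup>+x. ennreal (h x ^ 2 * w x) \<partial>lebesgue) < \<infinity>"
    and nz: "(\<integral>\<^sup>+x. ennreal (h x ^ 2 * w x) \<partial>lebesgue) \<noteq> 0"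
  obtains H where "A1_rel (A1_const TYPE('n) q B) w H" "\<And>x. h x \<le> H x"
    "(\<integral>\<^sup>+x. ennreal (H x ^ 2 * w x) \<partial>lebesgue) \<le> 4 * (\<integral>\<^sup>+x. ennreal (h x ^ 2 * w x) \<partial>lebesgue)"
proof -
  note [measurable] = muck_measurable[OF m]
  note w0 = muck_nonneg[OF m]
  let ?n = "real CARD('n)"
  define \<mu> where "\<mu> = density lebesgue (\<lambda>x. ennreal (w x))"
  define D where "D = doub_const TYPE('n) q B"
  define c where "c = 2 * sqrt (32 * D)"
  interpret doubling_measure \<mu> D
    unfolding \<mu>_def D_def by (rule muck_doubling_measure[OF q m])
  have em: "emeasure \<mu> A = wmeas w A" if "A \<in> sets lebesgue" for A
    unfolding wmeas_def \<mu>_def using that by (subst emeasure_density) auto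
  have int: "(\<integral>\<^sup>+x. f x \<partial>\<mu>) = (\<integral>\<^sup>+x. ennreal (w x) * f x \<partial>lebesgue)" if "f \<in> borel_measurable lebesgue" for f
    unfolding \<mu>_def using that by (intro nn_integral_density) auto
  \<comment> \<open>Null sets of w dx are Lebesgue null because w is positive almost
    everywhere.\<close>
  have AE: "AE x in lebesgue. P x" if "AE x in \<mu>. P x" for P
  proof -
    have "AE x in lebesgue. 0 < ennreal (w x) \<longrightarrow> P x"
      using that unfolding \<mu>_def by (subst (asm) AE_density) auto
    with muck_pos[OF m] show ?thesis by eventually_elim auto
  qed
  have bm: "borel_measurable \<mu> = borel_measurable lebesgue"
    by (rule measurable_cong_sets) (simp_all add: sets_mu)
  have hL: "(\<integral>\<^sup>+x. (ennreal (h x))\<^sup>2 \<partial>\<mu>) = (\<integral>\<^sup>+x. ennreal (h x ^ 2 * w x) \<partial>lebesgue)"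
    using h0 w0 by (subst int) (auto simp: ennreal_power ennreal_mult[symmetric] mult.commute)
  obtain G where G: "G \<in> borel_measurable \<mu>" "\<And>x. ennreal (h x) \<le> G x"
    "(\<integral>\<^sup>+x. (G x)\<^sup>2 \<partial>\<mu>) \<le> 4 * (\<integral>\<^sup>+x. (ennreal (h x))\<^sup>2 \<partial>\<mu>)"
    "\<And>x. maxf G x \<le> ennreal c * G x"
    using rubio_de_francia[of "\<lambda>x. ennreal (h x)"] unfolding bm c_def by auto
  note [measurable] = G(1) G(1)[unfolded bm]
  have c: "0 < c" using D_ge_1 by (simp add: c_def)
  \<comment> \<open>If G vanishes at x, so does its maximal function, and G has mean zero over every
    ball of the family through x. Every bounded set lies in such a ball, so h vanishes almost
    everywhere, against \<open>nz\<close>.\<close>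
  have Gpos: "0 < G x" for x
  proof (rule ccontr)
    assume "\<not> 0 < G x"
    then have "maxf G x = 0" using G(4)[of x] by simp
    have "AE y in \<mu>. y \<in> ball x (real N) \<longrightarrow> h y = 0" for N :: nat
    proof -
      obtain b where b: "b \<in> balls" "fst b \<in> ball x 1" "real N + 1 < snd b"
        using balls_dense[of "ball x 1" "real N + 1" "real N + 2"] by auto
      have "x \<in> cball (fst b) (snd b)" using b by (simp add: dist_commute)
      then have "mean G (fst b) (snd b) = 0"
        using mean_le_maxf[OF b(1), of x G] \<open>maxf G x = 0\<close> by simp
      then have "(\<integral>\<^sup>+y\<in>cball (fst b) (snd b). G y \<partial>\<mu>) = 0"
        using mean_times[of "snd b" G "fst b"] balls_pos[OF b(1)] by simp
      then have "AE y in \<mu>. G y * indicator (cball (fst b) (snd b)) y = 0"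
        by (subst (asm) nn_integral_0_iff_AE) auto
      have sub: "y \<in> cball (fst b) (snd b)" if "y \<in> ball x (real N)" for y
        using that b dist_triangle[of "fst b" y x] by (simp add: dist_commute)
      show ?thesis
        using \<open>AE y in \<mu>. G y * indicator (cball (fst b) (snd b)) y = 0\<close>
      proof eventually_elim
        case (elim y)
        show ?case
        proof
          assume "y \<in> ball x (real N)"
          then have "G y = 0" using elim sub[of y] by simp
          then show "h y = 0" using G(2)[of y] h0[of y] by (simp add: ennreal_eq_0_iff)
        qed
      qed
    qed
    then have "AE y in \<mu>. \<forall>N. y \<in> ball x (real N) \<longrightarrow> h y = 0"
      unfolding AE_all_countable by blast
    then have "AE y in \<mu>. h y = 0"
    proof eventually_elim
      case (elim y)
      obtain N where "dist x y < real N" using reals_Archimedean2 by blast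
      with elim show ?case by auto
    qed
    then have "(\<integral>\<^sup>+x. (ennreal (h x))\<^sup>2 \<partial>\<mu>) = (\<integral>\<^sup>+x. 0 \<partial>\<mu>)"
      by (intro nn_integral_cong_AE) (auto elim: eventually_mono)
    with nz show False by (simp add: hL)
  qed
  have "(\<integral>\<^sup>+x. (G x)\<^sup>2 \<partial>\<mu>) < \<infinity>"
    using G(3) fin by (auto simp: hL ennreal_mult_less_top intro: le_less_trans)
  then have "AE x in \<mu>. (G x)\<^sup>2 \<noteq> \<infinity>"
    by (intro nn_integral_PInf_AE) auto
  then have Gfin: "AE x in lebesgue. G x \<noteq> \<infinity>"
    by (rule AE[OF eventually_mono]) (auto simp: power2_eq_square)
  \<comment> \<open>On the null set where G is infinite any real value that is positive and at least
    h serves; h + 1 is one.\<close>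
  define H where "H x = (if G x = \<infinity> then h x + 1 else enn2real (G x))" for x
  have [measurable]: "H \<in> borel_measurable lebesgue"
    unfolding H_def by measurable
  have H: "AE x in lebesgue. ennreal (H x) = G x"
    using Gfin by eventually_elim (simp add: H_def less_top)
  have H0: "0 < H x" for x
    using Gpos[of x] h0[of x] by (auto simp: H_def enn2real_positive_iff less_top add_nonneg_pos)
  show thesis
  proof (rule that)
    show "h x \<le> H x" for x
      using G(2)[of x] h0[of x] by (cases "G x") (auto simp: H_def)
    have "(\<integral>\<^sup>+x. ennreal (H x ^ 2 * w x) \<partial>lebesgue) = (\<integral>\<^sup>+x. ennreal (w x) * (G x)\<^sup>2 \<partial>lebesgue)"
    proof (rule nn_integral_cong_AE)
      show "AE x in lebesgue. ennreal (H x ^ 2 * w x) = ennreal (w x) * (G x)\<^sup>2"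
        using H
      proof eventually_elim
        case (elim x)
        show ?case
          unfolding elim[symmetric] using H0[of x] w0[of x]
          by (simp add: ennreal_power ennreal_mult[symmetric] mult.commute)
      qed
    qed
    also have "\<dots> = (\<integral>\<^sup>+x. (G x)\<^sup>2 \<partial>\<mu>)"
      by (rule int[symmetric]) measurable
    finally show "(\<integral>\<^sup>+x. ennreal (H x ^ 2 * w x) \<partial>lebesgue) \<le> 4 * (\<integral>\<^sup>+x. ennreal (h x ^ 2 * w x) \<partial>lebesgue)"
      using G(3) by (simp add: hL)
    show "A1_rel (A1_const TYPE('n) q B) w H"
      unfolding A1_rel_def
    proof (intro conjI allI impI H0)
      fix z :: "real ^ 'n" and s :: real assume s: "0 < s"
      have n: "1 \<le> ?n" by (simp add: Suc_leI)
      \<comment> \<open>A ball with centre within s of z and radius above (n + 1) s contains the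
        cube; the bound (n + 2) s on its radius keeps it within distance (n + 3) s of z.\<close>
      have "0 < ?n * s + s" using s n by (simp add: add_nonneg_pos)
      then obtain b where b: "b \<in> balls" "fst b \<in> ball z s" "?n * s + s < snd b" "snd b < ?n * s + 2 * s"
        using balls_dense[of "ball z s" "?n * s + s" "?n * s + 2 * s"] s by auto
      let ?b = "cball (fst b) (snd b)"
      have sub: "cb z s \<subseteq> ?b"
      proof
        fix x assume "x \<in> cb z s"
        then have "dist z x \<le> ?n * s" using cb_subset_cball[of z s] by auto
        then show "x \<in> ?b" using b dist_triangle[of "fst b" x z] by (simp add: dist_commute)
      qed
      have "?b \<subseteq> cball z ((?n + 3) * s)"
      proof
        fix x assume "x \<in> ?b"
        then show "x \<in> cball z ((?n + 3) * s)"
          using b dist_triangle[of z x "fst b"] by (simp add: distrib_right)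
      qed
      then have sup: "?b \<subseteq> cb z ((?n + 3) * s)" using cball_subset_cb by blast
      have "emeasure \<mu> ?b \<le> wmeas w (cb z ((?n + 3) * s))"
        using wmeas_mono[OF sup] by (simp add: em)
      also have "\<dots> = ennreal (cmass w z ((?n + 3) * s))"
        using s n by (intro muck_wmeas[OF m]) auto
      also have "\<dots> \<le> ennreal (B * (?n + 3) powr (?n * q) * cmass w z s)"
      proof (rule ennreal_leI)
        have "s \<le> (?n + 3) * s" using s n by simp
        from muck_doubling[OF q m cb_mono[OF this] s] 
        show "cmass w z ((?n + 3) * s) \<le> B * (?n + 3) powr (?n * q) * cmass w z s"
          using s n by simp
      qed
      finally have mub: "emeasure \<mu> ?b \<le> ennreal (B * (?n + 3) powr (?n * q) * cmass w z s)" .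
      have "wmeas (\<lambda>y. w y * H y) (cb z s) = (\<integral>\<^sup>+x. ennreal (w x) * (G x * indicator (cb z s) x) \<partial>lebesgue)"
        unfolding wmeas_def
      proof (rule nn_integral_cong_AE)
        show "AE x in lebesgue. ennreal (w x * H x) * indicator (cb z s) x = ennreal (w x) * (G x * indicator (cb z s) x)"
          using H
        proof eventually_elim
          case (elim x)
          show ?case
            unfolding elim[symmetric] using H0[of x] w0[of x] by (simp add: ennreal_mult mult.assoc)
        qed
      qed
      also have "\<dots> = (\<integral>\<^sup>+x\<in>cb z s. G x \<partial>\<mu>)"
        by (rule int[symmetric]) measurable
      also have "\<dots> \<le> (\<integral>\<^sup>+x\<in>?b. G x \<partial>\<mu>)"
        using sub by (intro nn_integral_mono) (auto simp: indicator_def)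
      also have "\<dots> = mean G (fst b) (snd b) * emeasure \<mu> ?b"
        using mean_times balls_pos[OF b(1)] by simp
      finally have I: "wmeas (\<lambda>y. w y * H y) (cb z s) \<le> mean G (fst b) (snd b) * emeasure \<mu> ?b" .
      show "AE x in lebesgue. x \<in> cb z s \<longrightarrow>
          wmeas (\<lambda>y. w y * H y) (cb z s) \<le> ennreal (A1_const TYPE('n) q B * H x * cmass w z s)"
        using H
      proof eventually_elim
        case (elim x)
        show ?case
        proof
          assume "x \<in> cb z s"
          then have "mean G (fst b) (snd b) \<le> maxf G x"
            using sub by (intro mean_le_maxf b) auto
          also have "\<dots> \<le> ennreal c * ennreal (H x)" using G(4)[of x] elim by simp
          finally have "wmeas (\<lambda>y. w y * H y) (cb z s)
              \<le> ennreal c * ennreal (H x) * ennreal (B * (?n + 3) powr (?n * q) * cmass w z s)"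
            using I mub by (meson mult_mono order_trans zero_le)
          also have "\<dots> = ennreal (A1_const TYPE('n) q B * H x * cmass w z s)"
            using c H0[of x] muck_ge_1[OF q m]
            by (simp add: ennreal_mult[symmetric] A1_const_def c_def D_def mult_ac)
          finally show "wmeas (\<lambda>y. w y * H y) (cb z s) \<le> ennreal (A1_const TYPE('n) q B * H x * cmass w z s)" .
        qed
      qed
    qed measurable
  qed
qed

section \<open>Products of weights\<close>

lemma A1_const_pos:
  fixes w :: "real ^ 'n \<Rightarrow> real"
  assumes "1 < q" "muckenhoupt q B w"
  shows "0 < A1_const TYPE('n) q B"
proof -
  have "1 \<le> B" using muck_ge_1[OF assms] .
  then show ?thesis
    by (simp add: A1_const_def doub_const_def)
qed

lemma powr_dual_exponent:
  fixes q \<alpha> b :: real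
  assumes "1 < q" "0 < \<alpha>" "0 \<le> b"
  shows "(\<alpha> powr (- (1 / (q - 1))) * b) powr (q - 1) = b powr (q - 1) / \<alpha>"
proof -
  have "(\<alpha> powr (- (1 / (q - 1)))) powr (q - 1) = inverse \<alpha>"
    using assms unfolding powr_powr by (simp add: powr_minus)
  then show ?thesis
    by (simp add: powr_mult divide_inverse mult.commute)
qed

text \<open>The exponent 1 - q' = -1/(q-1) is negative, so a lower bound for v becomes an upper
  bound for its dual weight. After raising to the power q - 1 the factor is just 1 /
  \<alpha>.\<close>

lemma dual_mass_le:
  fixes v w :: "real ^ 'n \<Rightarrow> real"
  assumes q: "1 < q" and m: "muckenhoupt q B w" and s: "0 < s" and a: "0 < \<alpha>"
    and le: "AE x in lebesgue. x \<in> cb z s \<longrightarrow> \<alpha> * w x \<le> v x"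
  shows "wmeas (dualw q v) (cb z s) \<le> ennreal (\<alpha> powr (- (1 / (q - 1))) * cmass (dualw q w) z s)"
proof -
  note [measurable] = muck_measurable[OF m]
  let ?e = "1 / (q - 1)"
  have e: "0 < ?e" using q by simp
  have "wmeas (dualw q v) (cb z s) \<le> (\<integral>\<^sup>+x. ennreal (\<alpha> powr (- ?e)) * (ennreal (dualw q w x) * indicator (cb z s) x) \<partial>lebesgue)"
    unfolding wmeas_def
  proof (rule nn_integral_mono_AE)
    show "AE x in lebesgue. ennreal (dualw q v x) * indicator (cb z s) x
        \<le> ennreal (\<alpha> powr (- ?e)) * (ennreal (dualw q w x) * indicator (cb z s) x)"
      using le muck_pos[OF m]
    proof eventually_elim
      case (elim x)
      show ?case
      proof (cases "x \<in> cb z s")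
        case True
        have "dualw q v x \<le> (\<alpha> * w x) powr (- ?e)"
          unfolding dualw_def dual_exponent[OF q] using elim True a e by (intro powr_mono2') auto
        also have "\<dots> = \<alpha> powr (- ?e) * dualw q w x"
          unfolding dualw_def dual_exponent[OF q] using elim a by (intro powr_mult) 
        finally show ?thesis
          using True by (simp add: ennreal_mult'[symmetric] dualw_def ennreal_leI)
      qed simp
    qed
  qed
  also have "\<dots> = ennreal (\<alpha> powr (- ?e)) * wmeas (dualw q w) (cb z s)"
    unfolding wmeas_def by (rule nn_integral_cmult) measurable
  also have "\<dots> = ennreal (\<alpha> powr (- ?e) * cmass (dualw q w) z s)"
    by (simp add: muck_dual_wmeas[OF m s] ennreal_mult)
  finally show ?thesis .
qed

lemma muck_comparable:
  fixes v w :: "real ^ 'n \<Rightarrow> real"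
  assumes q: "1 < q" and m: "muckenhoupt q B w" and [measurable]: "v \<in> borel_measurable lebesgue"
    and a: "0 < \<alpha>" and lower: "\<And>x. \<alpha> * w x \<le> v x" and upper: "\<And>x. v x \<le> \<beta> * w x" and b: "0 \<le> \<beta>"
  shows "muckenhoupt q (\<beta> / \<alpha> * B) v"
  unfolding muckenhoupt_def
proof (intro conjI allI impI)
  note [measurable] = muck_measurable[OF m]
  show "0 \<le> v x" for x
    using lower[of x] a muck_nonneg[OF m, of x] by (smt (verit) mult_nonneg_nonneg)
  show "AE x in lebesgue. 0 < v x"
    using muck_pos[OF m]
  proof eventually_elim
    case (elim x)
    then show ?case using lower[of x] a by (smt (verit) mult_pos_pos)
  qed
  fix z :: "real ^ 'n" and s :: real assume s: "0 < s"
  have "wmeas v (cb z s) \<le> (\<integral>\<^sup>+x. ennreal \<beta> * (ennreal (w x) * indicator (cb z s) x) \<partial>lebesgue)"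
    unfolding wmeas_def using upper b muck_nonneg[OF m]
    by (intro nn_integral_mono) (auto simp: indicator_def ennreal_mult[symmetric] ennreal_leI)
  also have "\<dots> = ennreal \<beta> * wmeas w (cb z s)"
    unfolding wmeas_def by (rule nn_integral_cmult) measurable
  also have "\<dots> = ennreal (\<beta> * cmass w z s)"
    using b by (simp add: muck_wmeas[OF m s] ennreal_mult)
  finally have v: "wmeas v (cb z s) \<le> ennreal (\<beta> * cmass w z s)" .
  then show "wmeas v (cb z s) < \<infinity>" by (rule le_less_trans) simp
  have d: "wmeas (dualw q v) (cb z s) \<le> ennreal (\<alpha> powr (- (1 / (q - 1))) * cmass (dualw q w) z s)"
    using lower by (intro dual_mass_le[OF q m s a]) auto
  then show "wmeas (dualw q v) (cb z s) < \<infinity>" by (rule le_less_trans) simp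
  have "cmass v z s * cmass (dualw q v) z s powr (q - 1)
      \<le> (\<beta> * cmass w z s) * (\<alpha> powr (- (1 / (q - 1))) * cmass (dualw q w) z s) powr (q - 1)"
    using q b by (intro mult_mono powr_mono2 cmass_leI v d) auto
  also have "\<dots> = \<beta> / \<alpha> * (cmass w z s * cmass (dualw q w) z s powr (q - 1))"
    using powr_dual_exponent[OF q a] by simp
  also have "\<dots> \<le> \<beta> / \<alpha> * (B * ((2 * s) ^ CARD('n)) powr q)"
    using a b by (intro mult_left_mono muck_ineq[OF m s]) auto
  finally show "cmass v z s * cmass (dualw q v) z s powr (q - 1) \<le> \<beta> / \<alpha> * B * ((2 * s) ^ CARD('n)) powr q"
    by (simp add: mult.assoc)
qed simp

text \<open>The form in which A_1 is used: on each cube H is bounded below by its w-average up to K,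
  so that negative powers of H, whether in a dual weight or in w H^(-k), are bounded above.\<close>

lemma A1_rel_cube:
  fixes w H :: "real ^ 'n \<Rightarrow> real" and z :: "real ^ 'n"
  assumes m: "muckenhoupt q B w" and A1: "A1_rel K w H" and K: "0 < K" and s: "0 < s"
  defines "I \<equiv> cmass (\<lambda>x. w x * H x) z s"
  shows "wmeas (\<lambda>x. w x * H x) (cb z s) = ennreal I" "0 < I"
    "AE x in lebesgue. x \<in> cb z s \<longrightarrow> I / (K * cmass w z s) \<le> H x"
proof -
  note [measurable] = muck_measurable[OF m]
  have [measurable]: "H \<in> borel_measurable lebesgue" and H0: "\<And>x. 0 < H x"
    and ae: "AE x in lebesgue. x \<in> cb z s \<longrightarrow> wmeas (\<lambda>y. w y * H y) (cb z s) \<le> ennreal (K * H x * cmass w z s)"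
    using A1 s by (auto simp: A1_rel_def)
  \<comment> \<open>One point where the condition holds is enough for finiteness, its right-hand
    side being a real number.\<close>
  obtain x where "wmeas (\<lambda>y. w y * H y) (cb z s) \<le> ennreal (K * H x * cmass w z s)"
    using AE_cb_witness[OF ae s] by auto
  then have fin: "wmeas (\<lambda>y. w y * H y) (cb z s) < \<infinity>"
    by (rule le_less_trans) simp
  then show eq: "wmeas (\<lambda>x. w x * H x) (cb z s) = ennreal I"
    unfolding I_def by (rule wmeas_eq_cmass)
  have "0 < wmeas (\<lambda>x. w x * H x) (cb z s)"
    using muck_pos[OF m] H0 s by (intro wmeas_pos) (auto elim: eventually_mono)
  then show "0 < I" unfolding eq by simp
  show "AE x in lebesgue. x \<in> cb z s \<longrightarrow> I / (K * cmass w z s) \<le> H x"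
    using ae
  proof eventually_elim
    case (elim x)
    show ?case
    proof
      assume "x \<in> cb z s"
      then have "I \<le> K * H x * cmass w z s"
        using elim K H0[of x] unfolding eq by (simp add: ennreal_le_iff)
      then show "I / (K * cmass w z s) \<le> H x"
        using K muck_cmass_pos[OF m s, of z] by (simp add: divide_le_eq mult_ac)
    qed
  qed
qed

text \<open>With H >= \<alpha> on the cube the dual factor gains 1 / \<alpha>. Since \<alpha> is the
  mass of w H divided by K w(Q), the mass of w H cancels and K times the A_q product of w
  remains.\<close>

lemma muck_mult:
  fixes w H :: "real ^ 'n \<Rightarrow> real"
  assumes q: "1 < q" and m: "muckenhoupt q B w" and A1: "A1_rel K w H" and K: "0 < K"
  shows "muckenhoupt q (K * B) (\<lambda>x. w x * H x)"
  unfolding muckenhoupt_def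
proof (intro conjI allI impI)
  note [measurable] = muck_measurable[OF m]
  have [measurable]: "H \<in> borel_measurable lebesgue" and H0: "\<And>x. 0 < H x"
    using A1 by (auto simp: A1_rel_def)
  show "(\<lambda>x. w x * H x) \<in> borel_measurable lebesgue" by measurable
  show "0 \<le> w x * H x" for x using muck_nonneg[OF m, of x] H0[of x] by simp
  show "AE x in lebesgue. 0 < w x * H x"
    using muck_pos[OF m] H0 by (auto elim: eventually_mono)
  fix z :: "real ^ 'n" and s :: real assume s: "0 < s"
  define I where "I = cmass (\<lambda>x. w x * H x) z s"
  define \<alpha> where "\<alpha> = I / (K * cmass w z s)"
  note cube = A1_rel_cube[OF m A1 K s, of z, folded I_def, folded \<alpha>_def]
  note pos = muck_cmass_pos[OF m s, of z]
  have a: "0 < \<alpha>" using cube(2) K pos by (simp add: \<alpha>_def)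
  show "wmeas (\<lambda>x. w x * H x) (cb z s) < \<infinity>" by (simp add: cube(1))
  have "AE x in lebesgue. x \<in> cb z s \<longrightarrow> \<alpha> * w x \<le> w x * H x"
    using cube(3) by eventually_elim (auto simp: mult.commute intro!: mult_right_mono muck_nonneg[OF m])
  from dual_mass_le[OF q m s a this]
  have d: "wmeas (dualw q (\<lambda>x. w x * H x)) (cb z s) \<le> ennreal (\<alpha> powr (- (1 / (q - 1))) * cmass (dualw q w) z s)" .
  then show "wmeas (dualw q (\<lambda>x. w x * H x)) (cb z s) < \<infinity>" by (rule le_less_trans) simp
  have "I * cmass (dualw q (\<lambda>x. w x * H x)) z s powr (q - 1)
      \<le> I * (\<alpha> powr (- (1 / (q - 1))) * cmass (dualw q w) z s) powr (q - 1)"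
    using q cube(2) by (intro mult_left_mono powr_mono2 cmass_leI d) auto
  also have "\<dots> = I / \<alpha> * cmass (dualw q w) z s powr (q - 1)"
    using powr_dual_exponent[OF q a] by simp
  also have "I / \<alpha> = K * cmass w z s"
    using cube(2) K pos by (simp add: \<alpha>_def)
  also have "K * cmass w z s * cmass (dualw q w) z s powr (q - 1) \<le> K * (B * ((2 * s) ^ CARD('n)) powr q)"
    using muck_ineq[OF m s, of z] K by simp
  finally show "cmass (\<lambda>x. w x * H x) z s * cmass (dualw q (\<lambda>x. w x * H x)) z s powr (q - 1)
      \<le> K * B * ((2 * s) ^ CARD('n)) powr q"
    by (simp add: I_def mult.assoc)
qed

text \<open>The mass of w H^(-k) is controlled by the lower bound for H. Its dual weight contains a
  positive power of H, which Hoelder trades for the mass of w H: it equals (w H)^\<theta>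
  (w^(1-q'))^(1-\<theta>). Matching the powers of H forces \<theta> = k / (r - 1), and matching
  those of w then forces r = (1 + k) q. The powers of the mass of w H cancel in the product.\<close>

lemma muck_mult_neg_power:
  fixes w H :: "real ^ 'n \<Rightarrow> real"
  assumes q: "1 < q" and m: "muckenhoupt q B w" and A1: "A1_rel K w H" and K: "0 < K" and k: "0 < k"
  shows "muckenhoupt ((1 + k) * q) (K powr k * B powr (1 + k)) (\<lambda>x. w x * H x powr - k)"
  unfolding muckenhoupt_def
proof (intro conjI allI impI)
  let ?v = "\<lambda>x. w x * H x powr - k" and ?r = "(1 + k) * q"
  note [measurable] = muck_measurable[OF m]
  have [measurable]: "H \<in> borel_measurable lebesgue" and H0: "\<And>x. 0 < H x"
    using A1 by (auto simp: A1_rel_def)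
  show "?v \<in> borel_measurable lebesgue" by measurable
  show "0 \<le> ?v x" for x using muck_nonneg[OF m, of x] by simp
  show "AE x in lebesgue. 0 < ?v x"
    using muck_pos[OF m] 
  proof eventually_elim
    case (elim x)
    then show ?case using H0[of x] by simp
  qed
  fix z :: "real ^ 'n" and s :: real assume s: "0 < s"
  define I where "I = cmass (\<lambda>x. w x * H x) z s"
  define \<alpha> where "\<alpha> = I / (K * cmass w z s)"
  define a where "a = cmass w z s"
  define b where "b = cmass (dualw q w) z s"
  note cube = A1_rel_cube[OF m A1 K s, of z, folded I_def, folded \<alpha>_def]
  have ab: "0 < a" "0 < b" unfolding a_def b_def using muck_cmass_pos[OF m s] muck_dual_cmass_pos[OF m s] by auto
  have \<alpha>: "0 < \<alpha>" using cube(2) K ab by (simp add: \<alpha>_def a_def[symmetric])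
  have "wmeas ?v (cb z s) \<le> (\<integral>\<^sup>+x. ennreal (\<alpha> powr - k) * (ennreal (w x) * indicator (cb z s) x) \<partial>lebesgue)"
    unfolding wmeas_def
  proof (rule nn_integral_mono_AE)
    show "AE x in lebesgue. ennreal (w x * H x powr - k) * indicator (cb z s) x
        \<le> ennreal (\<alpha> powr - k) * (ennreal (w x) * indicator (cb z s) x)"
      using cube(3)
    proof eventually_elim
      case (elim x)
      show ?case
      proof (cases "x \<in> cb z s")
        case True
        have H: "H x powr - k \<le> \<alpha> powr - k" using elim True \<alpha> k by (intro powr_mono2') auto
        then have "w x * H x powr - k \<le> \<alpha> powr - k * w x"
          using mult_left_mono[OF H muck_nonneg[OF m, of x]] by (simp add: mult.commute)
        then show ?thesis
          using True by (simp add: ennreal_mult'[symmetric] ennreal_leI)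
      qed simp
    qed
  qed
  also have "\<dots> = ennreal (\<alpha> powr - k) * wmeas w (cb z s)"
    unfolding wmeas_def by (rule nn_integral_cmult) measurable
  also have "\<dots> = ennreal (\<alpha> powr - k * a)"
    by (simp add: muck_wmeas[OF m s] a_def ennreal_mult)
  finally have v: "wmeas ?v (cb z s) \<le> ennreal (\<alpha> powr - k * a)" .
  then show "wmeas ?v (cb z s) < \<infinity>" by (rule le_less_trans) simp
  define \<theta> where "\<theta> = k / (?r - 1)"
  have r: "?r - 1 = k + (1 + k) * (q - 1)" by (simp add: algebra_simps)
  have r0: "0 < ?r - 1" unfolding r using q k by (intro add_pos_pos mult_pos_pos) auto
  then have r1: "1 < ?r" by simp
  have \<theta>: "0 < \<theta>" "\<theta> < 1"
    unfolding \<theta>_def using r0 k q unfolding r by auto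
  have \<theta>1: "1 - \<theta> = (1 + k) * (q - 1) / (?r - 1)"
    unfolding \<theta>_def using r0 by (simp add: diff_divide_distrib[symmetric] field_simps)
  have eq: "AE x in lebesgue. dualw ?r ?v x = (w x * H x) powr \<theta> * dualw q w x powr (1 - \<theta>)"
    using muck_pos[OF m]
  proof eventually_elim
    case (elim x)
    have "(w x * H x) powr \<theta> * dualw q w x powr (1 - \<theta>) = H x powr \<theta> * w x powr (\<theta> + - (1 / (q - 1)) * (1 - \<theta>))"
      unfolding dualw_def dual_exponent[OF q] using elim H0[of x]
      by (simp add: powr_mult powr_powr mult_ac powr_add[symmetric])
    also have "\<theta> + - (1 / (q - 1)) * (1 - \<theta>) = - (1 / (?r - 1))"
    proof -
      have "1 / (q - 1) * (1 - \<theta>) = (1 + k) / (?r - 1)"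
        unfolding \<theta>1 using q by simp
      then show ?thesis
        unfolding \<theta>_def by (simp add: diff_divide_distrib[symmetric])
    qed
    also have "H x powr \<theta> * w x powr - (1 / (?r - 1)) = dualw ?r ?v x"
      unfolding dualw_def dual_exponent[OF r1] using elim H0[of x]
      by (simp add: powr_mult powr_powr \<theta>_def)
    finally show ?case by simp
  qed
  have "wmeas (dualw ?r ?v) (cb z s) = (\<integral>\<^sup>+x\<in>cb z s. ennreal ((w x * H x) powr \<theta> * dualw q w x powr (1 - \<theta>)) \<partial>lebesgue)"
    unfolding wmeas_def using eq by (intro nn_integral_cong_AE) auto
  also have "\<dots> \<le> ennreal (I powr \<theta> * b powr (1 - \<theta>))"
  proof (rule nn_integral_Holder)
    show "(\<integral>\<^sup>+t\<in>cb z s. ennreal (w t * H t) \<partial>lebesgue) \<le> ennreal I"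
      using cube(1) by (simp add: wmeas_def)
    show "(\<integral>\<^sup>+t\<in>cb z s. ennreal (dualw q w t) \<partial>lebesgue) \<le> ennreal b"
      using muck_dual_wmeas[OF m s, of z] by (simp add: wmeas_def b_def)
    show "0 \<le> w x * H x" for x using muck_nonneg[OF m, of x] H0[of x] by simp
  qed (use \<theta> ab cube(2) in \<open>auto simp: dualw_def\<close>)
  finally have d: "wmeas (dualw ?r ?v) (cb z s) \<le> ennreal (I powr \<theta> * b powr (1 - \<theta>))" .
  then show "wmeas (dualw ?r ?v) (cb z s) < \<infinity>" by (rule le_less_trans) simp
  have "cmass ?v z s * cmass (dualw ?r ?v) z s powr (?r - 1)
      \<le> (\<alpha> powr - k * a) * (I powr \<theta> * b powr (1 - \<theta>)) powr (?r - 1)"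
    using r0 ab by (intro mult_mono powr_mono2 cmass_leI v d) auto
  also have "(I powr \<theta> * b powr (1 - \<theta>)) powr (?r - 1) = I powr k * b powr ((1 + k) * (q - 1))"
    unfolding \<theta>1 unfolding \<theta>_def using r0 ab cube(2) by (simp add: powr_mult powr_powr)
  also have "\<alpha> powr - k * a * (I powr k * b powr ((1 + k) * (q - 1)))
      = K powr k * (a powr (1 + k) * b powr ((1 + k) * (q - 1)))"
    unfolding \<alpha>_def a_def[symmetric] using ab cube(2) K
    by (simp add: powr_minus powr_divide powr_mult powr_add)
  also have "a powr (1 + k) * b powr ((1 + k) * (q - 1)) = (a * b powr (q - 1)) powr (1 + k)"
    using ab by (simp add: powr_mult powr_powr mult.commute)
  also have "K powr k * (a * b powr (q - 1)) powr (1 + k) \<le> K powr k * (B * ((2 * s) ^ CARD('n)) powr q) powr (1 + k)"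
    using muck_ineq[OF m s, of z] k ab unfolding a_def[symmetric] b_def[symmetric]
    by (intro mult_left_mono powr_mono2) auto
  also have "\<dots> = K powr k * B powr (1 + k) * ((2 * s) ^ CARD('n)) powr ?r"
    using muck_ge_1[OF q m] s by (simp add: powr_mult powr_powr mult_ac)
  finally show "cmass ?v z s * cmass (dualw ?r ?v) z s powr (?r - 1)
      \<le> K powr k * B powr (1 + k) * ((2 * s) ^ CARD('n)) powr ?r" .
qed

section \<open>Uniform estimates\<close>

text \<open>The hypothesis of the theorem gives no monotonicity of \<open>c\<^sub>1\<close> in the constant of the weight.
  Uniformity over \<open>[w] \<le> B\<close> is recovered by replacing \<open>w\<close> with a comparable weight whose
  constant is exactly \<open>B\<close>: multiply \<open>w\<close> by \<open>1 + t\<close> on a cube, and increase \<open>t\<close> continuously.\<close>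

lemma Ap_const_exact:
  fixes w :: "real ^ 'n \<Rightarrow> real"
  assumes q: "1 < q" and m: "muckenhoupt q B w"
  obtains v where "v \<in> Ap q" "Ap_const q v = ennreal B" "\<And>x. w x \<le> v x"
    "\<And>x. v x \<le> (1 + B * B * 18 powr (real CARD('n) * q)) * w x"
proof -
  note [measurable] = muck_measurable[OF m]
  note w0 = muck_nonneg[OF m]
  have B: "1 \<le> B" by (rule muck_ge_1[OF q m])
  let ?N = "real CARD('n) * q"
  \<comment> \<open>Large enough to push the constant up to \<open>B\<close>. The argument for
    \<phi> S gives S <= B 18^(n q) \<phi> S, where 3^(n q) comes from doubling from the unit half
    side to 3 and 6^(n q) is the measure of \<open>cb 0 3\<close> to the power q.\<close>
  define S where "S = B * B * 18 powr ?N"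
  have S: "0 \<le> S" using B by (simp add: S_def)
  define v where "v t x = w x * (1 + t * indicator (cb 0 1) x)" for t :: real and x
  define \<phi> where "\<phi> t = enn2real (Ap_const q (v t))" for t
  have [measurable]: "v t \<in> borel_measurable lebesgue" for t
    unfolding v_def by measurable
  have lower: "w x \<le> v t x" and upper: "v t x \<le> (1 + t) * w x" if "0 \<le> t" for t x
    using that w0[of x] by (auto simp: v_def indicator_def algebra_simps)
  have mv: "muckenhoupt q ((1 + t) * B) (v t)" if "0 \<le> t" for t
  proof -
    have "muckenhoupt q ((1 + t) / 1 * B) (v t)"
      using that lower[OF that] upper[OF that] by (intro muck_comparable[OF q m]) auto
    then show ?thesis by simp
  qed
  have Ap: "v t \<in> Ap q" and eq: "Ap_const q (v t) = ennreal (\<phi> t)" if "0 \<le> t" for t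
  proof -
    have *: "v t \<in> Ap q \<and> Ap_const q (v t) \<le> ennreal ((1 + t) * B)"
      using mv[OF that] that B by (subst muckenhoupt_iff[OF q, symmetric]) auto
    then show "v t \<in> Ap q" by simp
    have "Ap_const q (v t) < \<infinity>" using * by (auto intro: le_less_trans)
    then show "Ap_const q (v t) = ennreal (\<phi> t)" by (simp add: \<phi>_def)
  qed
  have \<phi>0: "0 \<le> \<phi> t" for t by (simp add: \<phi>_def)
  have m\<phi>: "muckenhoupt q (\<phi> t) (v t)" if "0 \<le> t" for t
    using Ap[OF that] eq[OF that] \<phi>0 by (simp add: muckenhoupt_iff[OF q])
  have \<phi>_le: "\<phi> t \<le> X" if "muckenhoupt q X (v t)" "0 \<le> X" "0 \<le> t" for t X
    using that eq[OF that(3)] by (simp add: muckenhoupt_iff[OF q])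
  have \<phi>_bound: "\<phi> t \<le> (1 + t) * B" if "0 \<le> t" for t
    using \<phi>_le[OF mv[OF that]] that B by simp
  \<comment> \<open>The two weights differ at most by the factor 1 + (t' - t), and so do their
    constants, in both directions. With the a priori bound (1 + t) B this gives a Lipschitz
    estimate.\<close>
  have step: "\<phi> t' \<le> (1 + (t' - t)) * \<phi> t \<and> \<phi> t \<le> (1 + (t' - t)) * \<phi> t'" if t: "0 \<le> t" "t \<le> t'" for t t'
  proof -
    let ?r = "1 + (t' - t)"
    have up: "v t' x \<le> ?r * v t x" for x
    proof -
      have "1 + t' * indicator (cb 0 1) x \<le> ?r * (1 + t * indicator (cb 0 1) x)"
        using t mult_nonneg_nonneg[of "t' - t" t] by (auto simp: indicator_def algebra_simps)
      from mult_left_mono[OF this w0[of x]] show ?thesis by (simp add: v_def mult_ac)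
    qed
    have lo: "v t x \<le> v t' x" for x
      unfolding v_def using t w0[of x] by (intro mult_left_mono add_left_mono mult_right_mono) auto
    have "muckenhoupt q (?r / 1 * \<phi> t) (v t')"
      using t lo up by (intro muck_comparable[OF q m\<phi>]) auto
    moreover have "muckenhoupt q (1 / (1 / ?r) * \<phi> t') (v t)"
      using t lo up by (intro muck_comparable[OF q m\<phi>]) (auto simp: divide_le_eq mult.commute)
    ultimately show ?thesis
      using t \<phi>0 by (auto intro!: \<phi>_le)
  qed
  have lip: "\<bar>\<phi> t - \<phi> t'\<bar> \<le> (1 + S) * B * \<bar>t - t'\<bar>" if "t \<in> {0..S}" "t' \<in> {0..S}" for t t'
  proof -
    have bound: "d * \<phi> u \<le> (1 + S) * B * d" if "u \<in> {0..S}" "0 \<le> d" for d u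
    proof -
      have "(1 + u) * B \<le> (1 + S) * B" using that B by (intro mult_right_mono) auto
      then have "\<phi> u \<le> (1 + S) * B" using \<phi>_bound[of u] that by simp
      then show ?thesis using that by (metis mult.commute mult_right_mono)
    qed
    have *: "\<bar>\<phi> a - \<phi> b\<bar> \<le> (1 + S) * B * (b - a)" if "a \<in> {0..S}" "b \<in> {0..S}" "a \<le> b" for a b
      using step[of a b] bound[of a "b - a"] bound[of b "b - a"] that by (auto simp: algebra_simps)
    show ?thesis
      using *[of t t'] *[of t' t] that by (cases "t \<le> t'") (auto simp: abs_minus_commute)
  qed
  have cont: "continuous_on {0..S} \<phi>"
    using lip S B
    by (intro lipschitz_on_continuous_on[of "(1 + S) * B"] lipschitz_onI) (auto simp: dist_real_def)
  \<comment> \<open>Inside \<open>cb 0 3\<close> the modified cube carries mass at least S w(cb 0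
    1), while the cube about \<open>y\<close> is disjoint from it and keeps its old dual mass. The
    A_q product on \<open>cb 0 3\<close> therefore grows at least linearly in S.\<close>
  have "B \<le> \<phi> S"
  proof -
    define y :: "real ^ 'n" where "y = (\<chi> i. 2)"
    have y: "1 / 2 \<le> x $ i - 1" if "\<bar>x $ i - y $ i\<bar> \<le> 1 / 2" for x :: "real ^ 'n" and i
    proof -
      have "y $ i = 2" by (simp add: y_def)
      with that show ?thesis by linarith
    qed
    have sub: "cb y (1 / 2) \<subseteq> cb 0 3"
    proof
      fix x assume x: "x \<in> cb y (1 / 2)"
      have "\<bar>x $ i\<bar> \<le> 3" for i
      proof -
        have "y $ i = 2" by (simp add: y_def)
        with x[unfolded mem_cb, rule_format, of i] show ?thesis by linarith
      qed
      then show "x \<in> cb 0 3" by (simp add: mem_cb)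
    qed
    have out: "x \<notin> cb 0 1" if "x \<in> cb y (1 / 2)" for x
    proof
      assume "x \<in> cb 0 1"
      then have "\<bar>x $ undefined\<bar> \<le> 1" by (auto simp: mem_cb)
      moreover have "\<bar>x $ undefined - y $ undefined\<bar> \<le> 1 / 2" using that mem_cb by blast
      ultimately show False using y[of x undefined] by linarith
    qed
    have sub1: "cb (0 :: real ^ 'n) 1 \<subseteq> cb 0 3" by (rule cb_mono) simp
    note mS = m\<phi>[OF S]
    have 1: "S * cmass w 0 1 \<le> cmass (v S) 0 3"
    proof -
      have "ennreal S * wmeas w (cb 0 1) = (\<integral>\<^sup>+x. ennreal S * (ennreal (w x) * indicator (cb 0 1) x) \<partial>lebesgue)"
        unfolding wmeas_def by (rule nn_integral_cmult[symmetric]) measurable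
      also have "\<dots> \<le> wmeas (v S) (cb 0 3)"
        unfolding wmeas_def using S w0 sub1
        by (intro nn_integral_mono) (auto simp: indicator_def v_def ennreal_mult'[symmetric] algebra_simps intro!: ennreal_leI)
      finally show ?thesis
        using S muck_wmeas[OF m, of 1 0] muck_wmeas[OF mS, of 3 0]
        by (simp add: ennreal_mult'[symmetric] ennreal_le_iff)
    qed
    have 2: "cmass (dualw q w) y (1 / 2) \<le> cmass (dualw q (v S)) 0 3"
    proof -
      have "wmeas (dualw q w) (cb y (1 / 2)) = wmeas (dualw q (v S)) (cb y (1 / 2))"
        unfolding wmeas_def using out
        by (intro nn_integral_cong) (auto simp: dualw_def v_def indicator_def)
      also have "\<dots> \<le> wmeas (dualw q (v S)) (cb 0 3)"
        by (rule wmeas_mono[OF sub])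
      finally show ?thesis
        using muck_dual_wmeas[OF mS, of 3 0] muck_dual_wmeas[OF m, of "1 / 2" y] by simp
    qed
    have 3: "1 \<le> cmass w y (1 / 2) * cmass (dualw q w) y (1 / 2) powr (q - 1)"
      using muck_cube_lower[OF q m, of "1 / 2" y] by simp
    have 4: "cmass w y (1 / 2) \<le> B * 3 powr ?N * cmass w 0 1"
      using cmass_mono[OF sub, of w] muck_wmeas[OF m, of 3 0] muck_doubling[OF q m sub1] by simp
    have "6 powr ?N * \<phi> S \<ge> cmass (v S) 0 3 * cmass (dualw q (v S)) 0 3 powr (q - 1)"
      using muck_ineq[OF mS, of 3 0] by (simp add: powr_realpow[symmetric] powr_powr mult.commute)
    also have "cmass (v S) 0 3 * cmass (dualw q (v S)) 0 3 powr (q - 1)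
        \<ge> (S * cmass w 0 1) * cmass (dualw q w) y (1 / 2) powr (q - 1)"
      using 1 2 q by (intro mult_mono powr_mono2) auto
    finally have 5: "S * (cmass w 0 1 * cmass (dualw q w) y (1 / 2) powr (q - 1)) \<le> 6 powr ?N * \<phi> S"
      by (simp add: mult.assoc)
    have "1 \<le> (B * 3 powr ?N * cmass w 0 1) * cmass (dualw q w) y (1 / 2) powr (q - 1)"
      using 3 mult_right_mono[OF 4 powr_ge_zero[of "cmass (dualw q w) y (1 / 2)" "q - 1"]] by linarith
    then have "S \<le> S * (B * 3 powr ?N * cmass w 0 1 * cmass (dualw q w) y (1 / 2) powr (q - 1))"
      using S mult_left_mono by fastforce
    also have "\<dots> = B * 3 powr ?N * (S * (cmass w 0 1 * cmass (dualw q w) y (1 / 2) powr (q - 1)))"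
      by simp
    also have "\<dots> \<le> B * 3 powr ?N * (6 powr ?N * \<phi> S)"
      using 5 B by (intro mult_left_mono) auto
    also have "\<dots> = B * 18 powr ?N * \<phi> S"
      by (simp add: powr_mult[symmetric])
    finally show ?thesis
      using B unfolding S_def by (simp add: mult_ac)
  qed
  moreover have "\<phi> 0 \<le> B" using \<phi>_bound[of 0] by simp
  ultimately obtain t where t: "0 \<le> t" "t \<le> S" "\<phi> t = B"
    using IVT'[of \<phi> 0 B S] cont S by auto
  show thesis
  proof (rule that)
    show "v t \<in> Ap q" by (rule Ap[OF t(1)])
    show "Ap_const q (v t) = ennreal B" using eq[OF t(1)] t(3) by simp
    show "w x \<le> v t x" for x by (rule lower[OF t(1)])
    show "v t x \<le> (1 + B * B * 18 powr ?N) * w x" for x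
      using upper[OF t(1), of x] mult_right_mono[of "1 + t" "1 + S" "w x"] t w0[of x]
      unfolding S_def by auto
  qed
qed

section \<open>The hypothesis as an estimate between integrals, uniform over weights\<close>

definition pint :: "real \<Rightarrow> (real ^ 'n \<Rightarrow> real) \<Rightarrow> (real ^ 'n \<Rightarrow> real) \<Rightarrow> ennreal" where
  "pint p w f = (\<integral>\<^sup>+x. ennreal (f x powr p * w x) \<partial>lebesgue)"

text \<open>The constant is fixed before the pair and the weight: extrapolation applies the estimate
  to weights built from the pair itself, about which only an exponent and a bound \<open>B\<close>
  are known.\<close>

definition dominated :: "((real ^ 'n \<Rightarrow> real) \<times> (real ^ 'n \<Rightarrow> real)) set \<Rightarrow> real \<Rightarrow> bool" where
  "dominated F p \<longleftrightarrow> (\<forall>q>1. \<forall>B. \<exists>C>0. \<forall>(f, g)\<in>F. \<forall>w. muckenhoupt q B w \<longrightarrow>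
     pint p w g < \<infinity> \<longrightarrow> pint p w g \<le> ennreal C * pint p w f)"

lemma dominatedE:
  assumes "dominated F p" "1 < q"
  obtains C where "0 < C" "\<And>f g w. (f, g) \<in> F \<Longrightarrow> muckenhoupt q B w \<Longrightarrow> pint p w g < \<infinity> \<Longrightarrow> pint p w g \<le> ennreal C * pint p w f"
proof -
  have "\<exists>C>0. \<forall>(f, g)\<in>F. \<forall>w. muckenhoupt q B w \<longrightarrow> pint p w g < \<infinity> \<longrightarrow> pint p w g \<le> ennreal C * pint p w f"
    using assms unfolding dominated_def by blast
  then obtain C where "0 < C" "\<forall>(f, g)\<in>F. \<forall>w. muckenhoupt q B w \<longrightarrow> pint p w g < \<infinity> \<longrightarrow> pint p w g \<le> ennreal C * pint p w f"
    by blast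
  then show ?thesis by (intro that[of C]) auto
qed

lemma enn_powr_finite_iff: "0 < e \<Longrightarrow> enn_powr a e < \<infinity> \<longleftrightarrow> a < \<infinity>"
  by (cases a) (auto simp: enn_powr_def)

lemma enn_powr_le_iff:
  assumes e: "0 < e" and c: "0 < c"
  shows "enn_powr a e \<le> ennreal c * enn_powr b e \<longleftrightarrow> a \<le> ennreal (c powr (1 / e)) * b"
proof (cases b)
  case top
  have "0 < c powr (1 / e)" using c by simp
  then show ?thesis using top e c by (simp add: enn_powr_infinity[simplified] ennreal_mult_top)
next
  case (real y)
  have *: "ennreal c * enn_powr b e = ennreal ((c powr (1 / e) * y) powr e)"
    using real e c by (simp add: enn_powr_ennreal ennreal_mult[symmetric] powr_mult powr_powr)
  show ?thesis
  proof (cases a)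
    case top
    then show ?thesis unfolding * using real e c by (simp add: enn_powr_infinity[simplified] ennreal_mult[symmetric] top_unique)
  next
    case (real x)
    have "x powr e \<le> (c powr (1 / e) * y) powr e \<longleftrightarrow> x \<le> c powr (1 / e) * y"
      using real \<open>0 \<le> y\<close> e c by (meson linorder_not_le mult_nonneg_nonneg powr_ge_zero powr_less_mono2 powr_mono2 less_imp_le)
    then show ?thesis
      unfolding * using real \<open>b = ennreal y\<close> \<open>0 \<le> y\<close> e c by (simp add: enn_powr_ennreal ennreal_mult[symmetric] ennreal_le_iff)
  qed
qed

lemma Lp_norm_pint:
  assumes "\<And>x. 0 \<le> f x"
  shows "Lp_norm p w UNIV f = enn_powr (pint p w f) (1 / p)"
  using assms by (simp add: Lp_norm_def pint_def)

lemma pint_mono: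
  assumes "\<And>x. w x \<le> v x" shows "pint p w f \<le> pint p v f"
  unfolding pint_def using assms by (intro nn_integral_mono ennreal_leI mult_left_mono) auto

lemma pint_cmult_le:
  assumes [measurable]: "v \<in> borel_measurable lebesgue" "f \<in> borel_measurable lebesgue"
    and "\<And>x. w x \<le> c * v x" "0 \<le> c" "\<And>x. 0 \<le> v x"
  shows "pint p w f \<le> ennreal c * pint p v f"
proof -
  have "pint p w f \<le> (\<integral>\<^sup>+x. ennreal c * ennreal (f x powr p * v x) \<partial>lebesgue)"
    unfolding pint_def
  proof (rule nn_integral_mono)
    fix x
    have "f x powr p * w x \<le> f x powr p * (c * v x)"
      by (intro mult_left_mono assms) auto
    then show "ennreal (f x powr p * w x) \<le> ennreal c * ennreal (f x powr p * v x)"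
      using assms by (simp add: ennreal_mult[symmetric] mult_ac ennreal_leI)
  qed
  also have "\<dots> = ennreal c * pint p v f"
    unfolding pint_def by (rule nn_integral_cmult) measurable
  finally show ?thesis .
qed

text \<open>The hypothesis is applied not to w but to the comparable weight whose constant is
  exactly \<open>B\<close>; this gives the same \<open>c q (ennreal B)\<close> for all w, and
  comparability costs the factor \<open>?L\<close>.\<close>

lemma dominated_base:
  fixes F :: "((real ^ 'n \<Rightarrow> real) \<times> (real ^ 'n \<Rightarrow> real)) set"
  assumes p: "0 < p"
    and F: "\<And>f g. (f, g) \<in> F \<Longrightarrow> f \<in> borel_measurable lebesgue \<and> g \<in> borel_measurable lebesgue
           \<and> (\<forall>x. 0 \<le> f x) \<and> (\<forall>x. 0 \<le> g x)"
    and c: "\<And>q t. 0 < c q t"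
    and est: "\<And>f g q w. (f, g) \<in> F \<Longrightarrow> 1 \<le> q \<Longrightarrow> w \<in> Ap q \<Longrightarrow> Lp_norm p w UNIV g < \<infinity>
       \<Longrightarrow> Lp_norm p w UNIV g \<le> ennreal (c q (Ap_const q w)) * Lp_norm p w UNIV f"
  shows "dominated F p"
  unfolding dominated_def
proof (intro allI impI)
  fix q B :: real assume q: "1 < q"
  let ?L = "1 + B * B * 18 powr (real CARD('n) * q)" and ?c = "c q (ennreal B) powr p"
  have L: "0 < ?L" by (intro add_pos_nonneg) auto
  show "\<exists>C>0. \<forall>(f, g)\<in>F. \<forall>w. muckenhoupt q B w \<longrightarrow> pint p w g < \<infinity> \<longrightarrow> pint p w g \<le> ennreal C * pint p w f"
  proof (intro exI[of _ "?c * ?L"] conjI)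
    have "0 < c q (ennreal B)" by (rule c)
    then show "0 < ?c * ?L" using L by simp
    have "pint p w g \<le> ennreal (?c * ?L) * pint p w f"
      if fg: "(f, g) \<in> F" and m: "muckenhoupt q B w" and fin: "pint p w g < \<infinity>"
      for f g and w :: "real ^ 'n \<Rightarrow> real"
    proof -
      note [measurable] = muck_measurable[OF m]
      have [measurable]: "f \<in> borel_measurable lebesgue" "g \<in> borel_measurable lebesgue"
        and nn: "\<And>x. 0 \<le> f x" "\<And>x. 0 \<le> g x"
        using F[OF fg] by auto
      obtain v where v: "v \<in> Ap q" "Ap_const q v = ennreal B" "\<And>x. w x \<le> v x" "\<And>x. v x \<le> ?L * w x"
        using Ap_const_exact[OF q m] by blast
      have vle: "pint p v h \<le> ennreal ?L * pint p w h" if [measurable]: "h \<in> borel_measurable lebesgue" for h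
        using v(4) L muck_nonneg[OF m] by (intro pint_cmult_le) auto
      have "pint p v g < \<infinity>"
        using vle[of g] fin by (auto intro!: le_less_trans[OF vle] simp: ennreal_mult_less_top)
      then have "Lp_norm p v UNIV g \<le> ennreal (c q (Ap_const q v)) * Lp_norm p v UNIV f"
        using p q by (intro est[OF fg _ v(1)]) (auto simp: Lp_norm_pint[OF nn(2)] enn_powr_finite_iff[simplified])
      then have "pint p v g \<le> ennreal ?c * pint p v f"
        unfolding v(2) Lp_norm_pint[OF nn(1)] Lp_norm_pint[OF nn(2)]
        using p c by (subst (asm) enn_powr_le_iff) auto
      also have "\<dots> \<le> ennreal ?c * (ennreal ?L * pint p w f)"
        by (intro mult_left_mono vle) auto
      also have "\<dots> = ennreal (?c * ?L) * pint p w f"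
        using L by (simp add: ennreal_mult mult.assoc)
      finally have "pint p v g \<le> ennreal (?c * ?L) * pint p w f" .
      moreover have "pint p w g \<le> pint p v g" by (rule pint_mono[OF v(3)])
      ultimately show ?thesis by simp
    qed
    then show "\<forall>(f, g)\<in>F. \<forall>w. muckenhoupt q B w \<longrightarrow> pint p w g < \<infinity> \<longrightarrow> pint p w g \<le> ennreal (?c * ?L) * pint p w f"
      by blast
  qed
qed

section \<open>Extrapolation\<close>

lemma ennreal_lin_comb:
  "0 \<le> a \<Longrightarrow> 0 \<le> b \<Longrightarrow> 0 \<le> x \<Longrightarrow> 0 \<le> y \<Longrightarrow>
    ennreal (a * x + b * y) = ennreal a * ennreal x + ennreal b * ennreal y"
  by (simp add: ennreal_mult ennreal_plus)

lemma dominated_double: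
  fixes F :: "((real ^ 'n \<Rightarrow> real) \<times> (real ^ 'n \<Rightarrow> real)) set"
  assumes F: "\<And>f g. (f, g) \<in> F \<Longrightarrow> f \<in> borel_measurable lebesgue \<and> g \<in> borel_measurable lebesgue
           \<and> (\<forall>x. 0 \<le> f x) \<and> (\<forall>x. 0 \<le> g x)"
    and dom: "dominated F p"
  shows "dominated F (2 * p)"
  unfolding dominated_def
proof (intro allI impI)
  fix q B :: real assume q: "1 < q"
  define K where "K = A1_const TYPE('n) q B"
  obtain C where C: "0 < C"
    "\<And>f g w. (f, g) \<in> F \<Longrightarrow> muckenhoupt q (K * B) w \<Longrightarrow> pint p w g < \<infinity> \<Longrightarrow> pint p w g \<le> ennreal C * pint p w f"
    using dominatedE[OF dom q] by blast
  have main: "pint (2 * p) w g \<le> ennreal (4 * C\<^sup>2) * pint (2 * p) w f"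
    if fg: "(f, g) \<in> F" and m: "muckenhoupt q B w" and fin: "pint (2 * p) w g < \<infinity>" for f g w
  proof (cases "pint (2 * p) w g = 0 \<or> pint (2 * p) w f = \<infinity>")
    case True
    then show ?thesis using C(1) by (auto simp: ennreal_mult_top)
  next
    case False
    note [measurable] = muck_measurable[OF m]
    note w0 = muck_nonneg[OF m]
    have [measurable]: "f \<in> borel_measurable lebesgue" "g \<in> borel_measurable lebesgue"
      using F[OF fg] by auto
    have sq: "(u powr p)\<^sup>2 = u powr (2 * p)" for u :: real
      unfolding mult_2 powr_add power2_eq_square ..
    have K: "0 < K" unfolding K_def by (rule A1_const_pos[OF q m])
    obtain H where H: "A1_rel K w H" "\<And>x. g x powr p \<le> H x"
      "(\<integral>\<^sup>+x. ennreal (H x ^ 2 * w x) \<partial>lebesgue) \<le> 4 * pint (2 * p) w g"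
      using A1_majorant[OF q m, of "\<lambda>x. g x powr p"] fin False
      unfolding sq pint_def[symmetric] K_def by auto
    have [measurable]: "H \<in> borel_measurable lebesgue" and H0: "\<And>x. 0 < H x"
      using H(1) by (auto simp: A1_rel_def)
    let ?v = "\<lambda>x. w x * H x"
    have "pint p ?v g \<le> (\<integral>\<^sup>+x. ennreal (H x ^ 2 * w x) \<partial>lebesgue)"
      unfolding pint_def
    proof (intro nn_integral_mono ennreal_leI)
      fix x
      have "g x powr p * (w x * H x) \<le> H x * (w x * H x)"
        using H(2)[of x] w0[of x] H0[of x] by (intro mult_right_mono) auto
      then show "g x powr p * (w x * H x) \<le> H x ^ 2 * w x" by (simp add: power2_eq_square mult_ac)
    qed
    also have "\<dots> < \<infinity>"
      using H(3) fin by (auto simp: ennreal_mult_less_top intro: le_less_trans)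
    finally have fin': "pint p ?v g < \<infinity>" .
    obtain a where a: "0 \<le> a" "pint (2 * p) w g = ennreal a"
      using fin by (cases "pint (2 * p) w g") auto
    obtain b where b: "0 \<le> b" "pint (2 * p) w f = ennreal b"
      using False by (cases "pint (2 * p) w f") auto
    have "ennreal a \<le> pint p ?v g"
      unfolding a(2)[symmetric] pint_def
    proof (intro nn_integral_mono ennreal_leI)
      fix x
      have "g x powr (2 * p) * w x = (g x powr p * w x) * g x powr p"
        unfolding sq[symmetric] by (simp add: power2_eq_square)
      also have "\<dots> \<le> (g x powr p * w x) * H x"
        using H(2)[of x] w0[of x] by (intro mult_left_mono) auto
      finally show "g x powr (2 * p) * w x \<le> g x powr p * (w x * H x)" by (simp add: mult_ac)
    qed
    also have "\<dots> \<le> ennreal C * pint p ?v f"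
      by (rule C(2)[OF fg muck_mult[OF q m H(1) K] fin'])
    also have "pint p ?v f \<le> (\<integral>\<^sup>+x. ennreal (2 * C) * ennreal (f x powr (2 * p) * w x) + ennreal (1 / (8 * C)) * ennreal (H x ^ 2 * w x) \<partial>lebesgue)"
      unfolding pint_def
    proof (rule nn_integral_mono)
      fix x
      \<comment> \<open>The coefficient 1 / (8 C), multiplied by C and by the 4 from the majorant,
        leaves one half of the integral of g, which is then absorbed into the left-hand
        side.\<close>
      have "f x powr p * H x \<le> 2 * C * (f x powr p)\<^sup>2 + 1 / (8 * C) * H x ^ 2"
      proof -
        have "0 \<le> (4 * C * f x powr p - H x)\<^sup>2 / (8 * C)" using C(1) by simp
        then show ?thesis using C(1) by (simp add: power2_eq_square field_simps)
      qed
      from mult_right_mono[OF this w0[of x]]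
      have "f x powr p * (w x * H x) \<le> 2 * C * (f x powr (2 * p) * w x) + 1 / (8 * C) * (H x ^ 2 * w x)"
        unfolding sq by (simp add: algebra_simps)
      then have "ennreal (f x powr p * (w x * H x)) \<le> ennreal (2 * C * (f x powr (2 * p) * w x) + 1 / (8 * C) * (H x ^ 2 * w x))"
        by (rule ennreal_leI)
      also have "\<dots> = ennreal (2 * C) * ennreal (f x powr (2 * p) * w x) + ennreal (1 / (8 * C)) * ennreal (H x ^ 2 * w x)"
        using C(1) w0[of x] by (intro ennreal_lin_comb) auto
      finally show "ennreal (f x powr p * (w x * H x))
          \<le> ennreal (2 * C) * ennreal (f x powr (2 * p) * w x) + ennreal (1 / (8 * C)) * ennreal (H x ^ 2 * w x)" .
    qed
    also have "\<dots> = ennreal (2 * C) * pint (2 * p) w f + ennreal (1 / (8 * C)) * (\<integral>\<^sup>+x. ennreal (H x ^ 2 * w x) \<partial>lebesgue)"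
      unfolding pint_def by (simp add: nn_integral_add nn_integral_cmult)
    also have "\<dots> \<le> ennreal (2 * C) * ennreal b + ennreal (1 / (8 * C)) * (4 * ennreal a)"
      using H(3) unfolding a(2) b(2) by (intro add_left_mono mult_left_mono) auto
    also have "\<dots> = ennreal (2 * C * b + a / (2 * C))"
    proof -
      have "ennreal (1 / (8 * C)) * (4 * ennreal a) = ennreal (1 / (8 * C)) * ennreal (4 * a)"
        using a by (simp add: ennreal_mult)
      also have "\<dots> = ennreal (1 / (8 * C) * (4 * a))"
        using a C(1) by (intro ennreal_mult[symmetric]) auto
      finally have "ennreal (1 / (8 * C)) * (4 * ennreal a) = ennreal (1 / (8 * C) * (4 * a))" .
      then show ?thesis using a b C(1) by (simp add: ennreal_mult ennreal_plus)
    qed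
    finally have "ennreal a \<le> ennreal C * ennreal (2 * C * b + a / (2 * C))"
      by (simp add: mult_left_mono)
    also have "\<dots> = ennreal (C * (2 * C * b + a / (2 * C)))"
      using C(1) a b by (simp add: ennreal_mult)
    finally have "a \<le> C * (2 * C * b + a / (2 * C))"
      using C(1) a b by (subst (asm) ennreal_le_iff) auto
    then have "a \<le> 4 * C\<^sup>2 * b"
      using C(1) by (simp add: power2_eq_square field_simps)
    then show ?thesis
      unfolding a(2) b(2) using a b by (simp add: ennreal_mult[symmetric] ennreal_leI)
  qed
  show "\<exists>C>0. \<forall>(f, g)\<in>F. \<forall>w. muckenhoupt q B w \<longrightarrow> pint (2 * p) w g < \<infinity> \<longrightarrow> pint (2 * p) w g \<le> ennreal C * pint (2 * p) w f"
    using C(1) main by (intro exI[of _ "4 * C\<^sup>2"]) auto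
qed

text \<open>Hoelder writes g^(sp) w as (g^p w H^(-k))^s (H^2 w)^(1-s). Since H^2 dominates g^(sp)
  and \<tau> f^(sp), the weight w H^(-k) turns the p-th powers of both functions into their s p-th
  powers up to constants: for g this gives finiteness, for f the bound.\<close>

lemma dominated_shrink:
  fixes F :: "((real ^ 'n \<Rightarrow> real) \<times> (real ^ 'n \<Rightarrow> real)) set"
  assumes F: "\<And>f g. (f, g) \<in> F \<Longrightarrow> f \<in> borel_measurable lebesgue \<and> g \<in> borel_measurable lebesgue
           \<and> (\<forall>x. 0 \<le> f x) \<and> (\<forall>x. 0 \<le> g x)"
    and dom: "dominated F p" and s: "0 < s" "s < 1"
  shows "dominated F (s * p)"
  unfolding dominated_def
proof (intro allI impI)
  fix q B :: real assume q: "1 < q"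
  define K where "K = A1_const TYPE('n) q B"
  \<comment> \<open>The value for which H cancels in the Hoelder splitting: k s = 2 (1 - s). It also
    makes H^(-k) match a negative power of g^(sp) with total exponent -(1 - s) p.\<close>
  define k where "k = 2 * (1 - s) / s"
  have k: "0 < k" using s by (simp add: k_def)
  have r: "1 < (1 + k) * q" using q k by (smt (verit) mult_le_cancel_left1)
  obtain C where C: "0 < C"
    "\<And>f g w. (f, g) \<in> F \<Longrightarrow> muckenhoupt ((1 + k) * q) (K powr k * B powr (1 + k)) w \<Longrightarrow> pint p w g < \<infinity> \<Longrightarrow> pint p w g \<le> ennreal C * pint p w f"
    using dominatedE[OF dom r] by blast
  define C' where "C' = C powr s * 8 powr (1 - s)"
  have C': "0 < C'" using C by (simp add: C'_def)
  have main: "pint (s * p) w g \<le> ennreal C' * pint (s * p) w f"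
    if fg: "(f, g) \<in> F" and m: "muckenhoupt q B w" and fin: "pint (s * p) w g < \<infinity>" for f g w
  proof (cases "pint (s * p) w g = 0 \<or> pint (s * p) w f = \<infinity>")
    case True
    then show ?thesis using C' by (auto simp: ennreal_mult_top)
  next
    case False
    note [measurable] = muck_measurable[OF m]
    note w0 = muck_nonneg[OF m]
    have [measurable]: "f \<in> borel_measurable lebesgue" "g \<in> borel_measurable lebesgue"
      using F[OF fg] by auto
    have K: "0 < K" unfolding K_def by (rule A1_const_pos[OF q m])
    obtain a where a: "0 < a" "pint (s * p) w g = ennreal a"
      using fin False by (cases "pint (s * p) w g") (auto simp: less_le)
    obtain b where b: "0 \<le> b" "pint (s * p) w f = ennreal b"
      using False by (cases "pint (s * p) w f") auto
    \<comment> \<open>A number above the integral b of f is used because b may be 0, where the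
      balancing factor a / b would be undefined; letting b' decrease to b finishes the
      proof.\<close>
    have bound: "a \<le> C' * b'" if b': "b < b'" for b'
    proof -
      have b'0: "0 < b'" using b b' by simp
      \<comment> \<open>Balances the two summands of h^2: the integral of the f-part is at most a,
        so the majorant has squared norm at most 4 (a + a).\<close>
      define \<tau> where "\<tau> = a / b'"
      have \<tau>: "0 < \<tau>" using a b'0 by (simp add: \<tau>_def)
      define h where "h x = sqrt (g x powr (s * p) + \<tau> * f x powr (s * p))" for x
      have h2: "h x ^ 2 = g x powr (s * p) + \<tau> * f x powr (s * p)" for x
        unfolding h_def using \<tau> by simp
      have [measurable]: "h \<in> borel_measurable lebesgue" unfolding h_def by measurable
      have "(\<integral>\<^sup>+x. ennreal (h x ^ 2 * w x) \<partial>lebesgue)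
          = (\<integral>\<^sup>+x. ennreal (g x powr (s * p) * w x) + ennreal \<tau> * ennreal (f x powr (s * p) * w x) \<partial>lebesgue)"
        using \<tau> w0 by (intro nn_integral_cong) (simp add: h2 distrib_right ennreal_mult mult.assoc)
      also have "\<dots> = pint (s * p) w g + ennreal \<tau> * pint (s * p) w f"
        unfolding pint_def by (simp add: nn_integral_add nn_integral_cmult)
      also have "\<dots> = ennreal (a + \<tau> * b)"
        unfolding a(2) b(2) using a b \<tau> by (simp add: ennreal_mult)
      finally have hL: "(\<integral>\<^sup>+x. ennreal (h x ^ 2 * w x) \<partial>lebesgue) = ennreal (a + \<tau> * b)" .
      have ab: "0 < a + \<tau> * b" using a b \<tau> by (simp add: add_pos_nonneg)
      obtain H where H: "A1_rel K w H" "\<And>x. h x \<le> H x"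
        "(\<integral>\<^sup>+x. ennreal (H x ^ 2 * w x) \<partial>lebesgue) \<le> 4 * ennreal (a + \<tau> * b)"
        using A1_majorant[OF q m, of h] \<tau> ab unfolding hL K_def by (auto simp: h_def)
      have [measurable]: "H \<in> borel_measurable lebesgue" and H0: "\<And>x. 0 < H x"
        using H(1) by (auto simp: A1_rel_def)
      have HL: "(\<integral>\<^sup>+x. ennreal (H x ^ 2 * w x) \<partial>lebesgue) \<le> ennreal (8 * a)"
      proof -
        have "\<tau> * b \<le> a" using b b' a b'0 by (simp add: \<tau>_def field_simps)
        then have "4 * ennreal (a + \<tau> * b) \<le> ennreal (4 * (a + a))"
          using ab a by (simp add: ennreal_mult[symmetric] ennreal_leI flip: ennreal_numeral)
        then show ?thesis using H(3) by simp
      qed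
      have H2: "g x powr (s * p) \<le> H x ^ 2" "\<tau> * f x powr (s * p) \<le> H x ^ 2" for x
      proof -
        have "0 \<le> h x" using \<tau> by (simp add: h_def)
        then have "h x ^ 2 \<le> H x ^ 2" using H(2)[of x] by (intro power_mono)
        moreover have "0 \<le> \<tau> * f x powr (s * p)" using \<tau> by simp
        ultimately show "g x powr (s * p) \<le> H x ^ 2" "\<tau> * f x powr (s * p) \<le> H x ^ 2"
          unfolding h2 using powr_ge_zero[of "g x" "s * p"] by linarith+
      qed
      have Hpow: "(H x ^ 2) powr e = H x powr (2 * e)" for x e
      proof -
        have "H x ^ 2 = H x powr 2" using H0[of x] by simp
        then show ?thesis by (simp only: powr_powr)
      qed
      \<comment> \<open>Used with \<rho> = 1 for g and \<rho> = \<tau> for f. The case u = 0 is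
        separate because u is raised to a negative power.\<close>
      have neg: "u powr p * H x powr - k \<le> \<rho> powr - (k / 2) * u powr (s * p)"
        if "\<rho> * u powr (s * p) \<le> H x ^ 2" "0 < \<rho>" "0 \<le> u" for u x \<rho>
      proof (cases "u = 0")
        case False
        then have u: "0 < u" using that by simp
        have "H x powr - k = (H x ^ 2) powr - (k / 2)"
          by (simp add: Hpow)
        also have "\<dots> \<le> (\<rho> * u powr (s * p)) powr - (k / 2)"
          using that u k by (intro powr_mono2') auto
        also have "\<dots> = \<rho> powr - (k / 2) * u powr (- (1 - s) * p)"
        proof -
          have "s * p * - (k / 2) = - (1 - s) * p" using s by (simp add: k_def field_simps)
          then have "(u powr (s * p)) powr - (k / 2) = u powr (- (1 - s) * p)"
            by (simp only: powr_powr)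
          then show ?thesis using that by (simp add: powr_mult)
        qed
        finally have "u powr p * H x powr - k \<le> u powr p * (\<rho> powr - (k / 2) * u powr (- (1 - s) * p))"
          by (intro mult_left_mono) auto
        also have "\<dots> = \<rho> powr - (k / 2) * u powr (s * p)"
          by (simp add: powr_add[symmetric] algebra_simps)
        finally show ?thesis .
      qed simp
      let ?v = "\<lambda>x. w x * H x powr - k"
      have gk: "g x powr p * H x powr - k \<le> g x powr (s * p)" for x
        using neg[of 1 "g x" x] H2(1)[of x] F[OF fg] by simp
      have "pint p ?v g \<le> pint (s * p) w g"
        unfolding pint_def
      proof (intro nn_integral_mono ennreal_leI)
        fix x show "g x powr p * (w x * H x powr - k) \<le> g x powr (s * p) * w x"
          using mult_right_mono[OF gk[of x] w0[of x]] by (simp add: mult_ac)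
      qed
      then have fin': "pint p ?v g < \<infinity>" using fin by simp
      define X where "X = C * (\<tau> powr - (k / 2) * b')"
      have X: "0 < X" using C(1) \<tau> b'0 by (simp add: X_def)
      have "pint p ?v g \<le> ennreal C * pint p ?v f"
        by (rule C(2)[OF fg muck_mult_neg_power[OF q m H(1) K k] fin'])
      also have "\<dots> \<le> ennreal C * (ennreal (\<tau> powr - (k / 2)) * pint (s * p) w f)"
      proof (rule mult_left_mono)
        have "pint p ?v f \<le> (\<integral>\<^sup>+x. ennreal (\<tau> powr - (k / 2)) * ennreal (f x powr (s * p) * w x) \<partial>lebesgue)"
          unfolding pint_def
        proof (rule nn_integral_mono)
          fix x
          have "f x powr p * H x powr - k \<le> \<tau> powr - (k / 2) * f x powr (s * p)"
            using F[OF fg] \<tau> by (intro neg H2) auto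
          from mult_right_mono[OF this w0[of x]]
          show "ennreal (f x powr p * (w x * H x powr - k)) \<le> ennreal (\<tau> powr - (k / 2)) * ennreal (f x powr (s * p) * w x)"
            using w0[of x] by (simp add: ennreal_mult[symmetric] mult_ac ennreal_leI)
        qed
        also have "\<dots> = ennreal (\<tau> powr - (k / 2)) * pint (s * p) w f"
          unfolding pint_def by (rule nn_integral_cmult) measurable
        finally show "pint p ?v f \<le> ennreal (\<tau> powr - (k / 2)) * pint (s * p) w f" .
      qed simp
      also have "\<dots> = ennreal (C * (\<tau> powr - (k / 2) * b))"
        unfolding b(2) using C(1) b by (simp add: ennreal_mult)
      also have "\<dots> \<le> ennreal X"
        unfolding X_def using C(1) b' by (intro ennreal_leI mult_left_mono) auto
      finally have gX: "pint p ?v g \<le> ennreal X" .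
      have "ennreal a = (\<integral>\<^sup>+x\<in>UNIV. ennreal ((g x powr p * ?v x) powr s * (H x ^ 2 * w x) powr (1 - s)) \<partial>lebesgue)"
        unfolding a(2)[symmetric] pint_def
      proof (intro nn_integral_cong)
        fix x
        have "(g x powr p * ?v x) powr s * (H x ^ 2 * w x) powr (1 - s)
            = g x powr (s * p) * (w x powr s * w x powr (1 - s)) * (H x powr - (k * s) * H x powr (2 * (1 - s)))"
          using H0[of x] w0[of x] by (simp add: powr_mult powr_powr Hpow mult_ac)
        also have "H x powr - (k * s) * H x powr (2 * (1 - s)) = 1"
          using H0[of x] s by (simp add: powr_add[symmetric] k_def)
        also have "w x powr s * w x powr (1 - s) = w x"
          using w0[of x] by (simp add: powr_add[symmetric])
        finally show "ennreal (g x powr (s * p) * w x)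
           = ennreal ((g x powr p * ?v x) powr s * (H x ^ 2 * w x) powr (1 - s)) * indicator UNIV x"
          by simp
      qed
      also have "\<dots> \<le> ennreal (X powr s * (8 * a) powr (1 - s))"
        using gX HL s X a w0 H0 by (intro nn_integral_Holder) (auto simp: pint_def)
      finally have "a \<le> X powr s * (8 * a) powr (1 - s)"
        using a by (simp add: ennreal_le_iff)
      \<comment> \<open>The factor a^(-(1-s)) contained in the power of \<tau> cancels the a^(1-s)
        from the majorant; what remains is linear in b'.\<close>
      also have "X powr s = C powr s * (\<tau> powr - (1 - s) * b' powr s)"
      proof -
        have "- (k / 2) * s = - (1 - s)" using s by (simp add: k_def field_simps)
        then have "(\<tau> powr - (k / 2)) powr s = \<tau> powr - (1 - s)"
          by (simp only: powr_powr)
        then show ?thesis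
          unfolding X_def using C(1) b'0 by (simp add: powr_mult)
      qed
      also have "\<tau> powr - (1 - s) = b' powr (1 - s) / a powr (1 - s)"
        unfolding \<tau>_def powr_divide[of a b'] powr_minus by simp
      also have "C powr s * (b' powr (1 - s) / a powr (1 - s) * b' powr s) * (8 * a) powr (1 - s)
          = C' * (b' powr (1 - s) * b' powr s)"
        unfolding C'_def using a by (simp add: powr_mult)
      also have "b' powr (1 - s) * b' powr s = b'"
        using b'0 by (simp add: powr_add[symmetric])
      finally show ?thesis .
    qed
    have "a / C' \<le> b"
    proof (rule dense_ge)
      fix b' assume "b < b'"
      from bound[OF this] show "a / C' \<le> b'" using C' by (simp add: divide_le_eq mult.commute)
    qed
    then have "a \<le> C' * b" using C' by (simp add: divide_le_eq mult.commute)
    then show ?thesis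
      unfolding a(2) b(2) using C' b by (simp add: ennreal_mult[symmetric] ennreal_leI)
  qed
  show "\<exists>C>0. \<forall>(f, g)\<in>F. \<forall>w. muckenhoupt q B w \<longrightarrow> pint (s * p) w g < \<infinity> \<longrightarrow> pint (s * p) w g \<le> ennreal C * pint (s * p) w f"
    using C' main by (intro exI[of _ C']) auto
qed

lemma dominated_all:
  fixes F :: "((real ^ 'n \<Rightarrow> real) \<times> (real ^ 'n \<Rightarrow> real)) set"
  assumes F: "\<And>f g. (f, g) \<in> F \<Longrightarrow> f \<in> borel_measurable lebesgue \<and> g \<in> borel_measurable lebesgue
           \<and> (\<forall>x. 0 \<le> f x) \<and> (\<forall>x. 0 \<le> g x)"
    and dom: "dominated F p0" and p0: "0 < p0" and p: "0 < p"
  shows "dominated F p"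
proof -
  have up: "dominated F (2 ^ n * p0)" for n
    by (induction n) (use dom dominated_double[OF F] in \<open>auto simp: mult.assoc\<close>)
  obtain n where "p / p0 < 2 ^ n"
    using real_arch_pow[of 2 "p / p0"] by auto
  then have n: "p < 2 ^ n * p0" using p0 by (simp add: divide_less_eq)
  define s where "s = p / (2 ^ n * p0)"
  have s: "0 < s" "s < 1" "s * (2 ^ n * p0) = p" using n p p0 by (auto simp: s_def)
  show ?thesis
    using dominated_shrink[OF F up s(1,2), of n] unfolding s(3) by simp
qed

section \<open>Ring weights and Morrey norms\<close>

text \<open>For exponent 1 the dual weight has no meaning, so A_1 is placed inside A_2: the dual
  weight is then 1 / w, and the A_1 condition bounds it on each cube by C |Q| / w(Q).\<close>

lemma A_inf_muckenhoupt:
  fixes w :: "real ^ 'n \<Rightarrow> real"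
  assumes "w \<in> A_inf"
  obtains q B where "1 < q" "muckenhoupt q B w"
proof -
  obtain p where p: "1 \<le> p" "w \<in> Ap p" using assms by (auto simp: A_inf_def)
  have w: "weight w" "AE x in lebesgue. 0 < w x" "Ap_const p w < \<infinity>"
    using p by (auto simp: Ap_def)
  show thesis
  proof (cases "p = 1")
    case False
    then have "1 < p" using p by simp
    have "Ap_const p w = ennreal (enn2real (Ap_const p w))" using w(3) by simp
    then have "muckenhoupt p (enn2real (Ap_const p w)) w"
      using p by (subst muckenhoupt_iff[OF \<open>1 < p\<close>]) auto
    with that \<open>1 < p\<close> show ?thesis by blast
  next
    case True
    note [measurable] = weight_measurable[OF w(1)]
    have "Inf {c. \<forall>Q\<in>cubes. AE x in lebesgue. x \<in> Q \<longrightarrow> avg w Q \<le> c * ennreal (w x)} < \<infinity>"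
      using w(3) True by (simp add: Ap_const_def)
    then obtain c where c: "\<forall>Q\<in>cubes. AE x in lebesgue. x \<in> Q \<longrightarrow> avg w Q \<le> c * ennreal (w x)" "c < \<infinity>"
      unfolding Inf_less_iff by blast
    obtain C where C: "0 \<le> C" "c = ennreal C" using c(2) by (cases c) auto
    have "muckenhoupt 2 C w"
      unfolding muckenhoupt_def
    proof (intro conjI allI impI)
      show "w \<in> borel_measurable lebesgue" by measurable
      show "0 \<le> w x" for x using w by (simp add: weight_def)
      show "AE x in lebesgue. 0 < w x" by (rule w)
      fix z :: "real ^ 'n" and s :: real assume s: "0 < s"
      define l where "l = (2 * s) ^ CARD('n)"
      have l: "0 < l" using s by (simp add: l_def)
      show fin: "wmeas w (cb z s) < \<infinity>" by (rule weight_wmeas_finite[OF w(1)])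
      define a where "a = cmass w z s"
      have wa: "wmeas w (cb z s) = ennreal a" unfolding a_def by (rule wmeas_eq_cmass[OF fin])
      have a: "0 < a"
        using wmeas_pos[OF weight_measurable[OF w(1)] w(2) s, of z] by (simp add: wa)
      have avg: "avg w (cb z s) = ennreal (a / l)"
        unfolding avg_def wa emeasure_cb[OF s] l_def[symmetric] using a l by (simp add: divide_ennreal)
      have "cb z s \<in> cubes" using s by (auto simp: cubes_eq)
      from c(1)[rule_format, OF this] have ae: "AE x in lebesgue. x \<in> cb z s \<longrightarrow> a / l \<le> C * w x"
        using w(2)
      proof eventually_elim
        case (elim x)
        then show ?case
          unfolding avg C(2) using C(1) by (auto simp: ennreal_mult[symmetric])
      qed
      have "wmeas (dualw 2 w) (cb z s) \<le> (\<integral>\<^sup>+x. ennreal (C * l / a) * indicator (cb z s) x \<partial>lebesgue)"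
        unfolding wmeas_def
      proof (rule nn_integral_mono_AE)
        show "AE x in lebesgue. ennreal (dualw 2 w x) * indicator (cb z s) x \<le> ennreal (C * l / a) * indicator (cb z s) x"
          using ae w(2)
        proof eventually_elim
          case (elim x)
          show ?case
          proof (cases "x \<in> cb z s")
            case True
            then have "inverse (w x) \<le> C * l / a"
              using elim a l by (simp add: field_simps)
            then show ?thesis
              using elim by (auto simp: dualw_def powr_minus indicator_def intro!: ennreal_leI)
          qed simp
        qed
      qed
      also have "\<dots> = ennreal (C * l / a) * emeasure lebesgue (cb z s)"
        by (rule nn_integral_cmult_indicator) measurable
      also have "\<dots> = ennreal (C * l / a * l)"
        unfolding emeasure_cb[OF s] l_def[symmetric] using C a l by (intro ennreal_mult[symmetric]) auto
      finally have d: "wmeas (dualw 2 w) (cb z s) \<le> ennreal (C * l / a * l)" .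
      then show "wmeas (dualw 2 w) (cb z s) < \<infinity>" by (rule le_less_trans) simp
      have "a * cmass (dualw 2 w) z s \<le> a * (C * l / a * l)"
        using C a l by (intro mult_left_mono cmass_leI d) auto
      also have "\<dots> = C * l powr 2" using a l by (simp add: power2_eq_square)
      finally show "cmass w z s * cmass (dualw 2 w) z s powr (2 - 1) \<le> C * ((2 * s) ^ CARD('n)) powr 2"
        by (simp add: a_def l_def)
    qed
    then show ?thesis using that[of 2 C] by simp
  qed
qed

section \<open>Weights that are constant on the rings between concentric cubes\<close>

definition ring_weight :: "(nat \<Rightarrow> real) \<Rightarrow> real ^ 'n \<Rightarrow> real \<Rightarrow> real ^ 'n \<Rightarrow> real" where
  "ring_weight a z s x = a (LEAST k. x \<in> cb z (3 ^ k * s))"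

context
  fixes z :: "real ^ 'n" and s :: real and a :: "nat \<Rightarrow> real"
  assumes s: "0 < s" and a0: "a 0 = 1" and apos: "\<And>k. 0 < a k" and adec: "\<And>k. a (Suc k) \<le> a k"
begin

lemma ring_index:
  "\<exists>k. x \<in> cb z (3 ^ k * s)"
proof -
  obtain t where t: "{x} \<subseteq> cb z t" using bounded_subset_cb[of "{x}" z] by auto
  obtain k where "t / s < 3 ^ k" using real_arch_pow[of 3 "t / s"] by auto
  then have "t \<le> 3 ^ k * s" using s by (simp add: divide_less_eq)
  then show ?thesis using t cb_mono by blast
qed

lemma ring_mono: "i \<le> j \<Longrightarrow> cb z (3 ^ i * s) \<subseteq> cb z (3 ^ j * s)"
  using s by (intro cb_mono mult_right_mono power_increasing) auto

lemma a_antimono: "i \<le> j \<Longrightarrow> a j \<le> a i"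
  by (rule lift_Suc_antimono_le[of a]) (use adec in auto)

lemma ring_weight_ge: "x \<in> cb z (3 ^ k * s) \<Longrightarrow> a k \<le> ring_weight a z s x"
  unfolding ring_weight_def by (intro a_antimono Least_le)

lemma ring_weight_le: "x \<notin> cb z (3 ^ k * s) \<Longrightarrow> ring_weight a z s x \<le> a (Suc k)"
  unfolding ring_weight_def
proof (intro a_antimono)
  assume x: "x \<notin> cb z (3 ^ k * s)"
  show "Suc k \<le> (LEAST k. x \<in> cb z (3 ^ k * s))"
  proof (rule ccontr)
    assume "\<not> ?thesis"
    then have "(LEAST k. x \<in> cb z (3 ^ k * s)) \<le> k" by simp
    with ring_mono[OF this] LeastI_ex[OF ring_index[of x]] x show False by blast
  qed
qed

lemma ring_weight_le_1: "ring_weight a z s x \<le> 1"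
  unfolding ring_weight_def a0[symmetric] by (rule a_antimono) simp

lemma ring_weight_pos: "0 < ring_weight a z s x"
  unfolding ring_weight_def by (rule apos)

lemma ring_weight_witness:
  "\<exists>k. x \<in> cb z (3 ^ k * s) \<and> ring_weight a z s x = a k \<and> (\<forall>j. x \<in> cb z (3 ^ j * s) \<longrightarrow> k \<le> j)"
  unfolding ring_weight_def using LeastI_ex[OF ring_index[of x]] Least_le[of "\<lambda>k. x \<in> cb z (3 ^ k * s)"] by blast

lemma ring_weight_measurable [measurable]: "ring_weight a z s \<in> borel_measurable lebesgue"
proof -
  have "(\<lambda>x. LEAST k. x \<in> cb z (3 ^ k * s)) \<in> measurable lebesgue (count_space UNIV)"
    by measurable
  then show ?thesis
    unfolding ring_weight_def[abs_def] by (rule measurable_compose) simp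
qed

text \<open>Let P be a cube and Q_k the first of the concentric cubes containing it. The weight is
  at least \<open>a k\<close> on P, so its integral over P must be bounded by a multiple of
  \<open>a k\<close> w(P). If k <= 1 or P misses Q_(k-2), the weight is at most
  \<open>L * a k\<close> on P. Otherwise P meets Q_(k-2) and leaves Q_(k-1), so its half side is at
  least 3^(k-2) s; then doubling with ratio 9 compares w(Q_k) with w(P), and the sum condition
  bounds the integral over Q_k.\<close>

lemma A1_rel_ring_weight:
  fixes w :: "real ^ 'n \<Rightarrow> real"
  assumes q: "1 < q" and m: "muckenhoupt q B w"
    and L: "\<And>k. a k \<le> L * a (Suc k)" and L1: "1 \<le> L"
    and M: "\<And>k. (\<Sum>j\<le>k. a j * cmass w z (3 ^ j * s)) \<le> M * a k * cmass w z (3 ^ k * s)" and M1: "1 \<le> M"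
  shows "A1_rel (L * M * (B * 9 powr (real CARD('n) * q))) w (ring_weight a z s)"
  unfolding A1_rel_def
proof (intro conjI allI impI ring_weight_pos)
  note [measurable] = muck_measurable[OF m]
  note w0 = muck_nonneg[OF m]
  let ?v = "ring_weight a z s" and ?Q = "\<lambda>k. cb z (3 ^ k * s)" and ?E = "B * 9 powr (real CARD('n) * q)"
  have E: "1 \<le> ?E"
  proof -
    have "1 \<le> (9::real) powr (real CARD('n) * q)" by (rule ge_one_powr_ge_zero) (use q in auto)
    then have "1 * 1 \<le> ?E" using muck_ge_1[OF q m] by (intro mult_mono) auto
    then show ?thesis by simp
  qed
  have LM: "L \<le> L * M * ?E" "M * ?E \<le> L * M * ?E"
  proof -
    have "1 * 1 \<le> M * ?E" using M1 E by (intro mult_mono) auto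
    then show "L \<le> L * M * ?E" using L1 by (simp add: mult.assoc)
    show "M * ?E \<le> L * M * ?E" 
      using mult_right_mono[OF L1, of "M * ?E"] M1 E by (simp add: mult.assoc)
  qed
  fix y :: "real ^ 'n" and t :: real assume t: "0 < t"
  let ?P = "cb y t"
  have bound: "wmeas (\<lambda>x. w x * ?v x) ?P \<le> ennreal (c * cmass w y t)"
    if c: "\<And>x. x \<in> ?P \<Longrightarrow> ?v x \<le> c" "0 \<le> c" for c
  proof -
    have "wmeas (\<lambda>x. w x * ?v x) ?P \<le> (\<integral>\<^sup>+x. ennreal c * (ennreal (w x) * indicator ?P x) \<partial>lebesgue)"
      unfolding wmeas_def
    proof (rule nn_integral_mono)
      fix x show "ennreal (w x * ?v x) * indicator ?P x \<le> ennreal c * (ennreal (w x) * indicator ?P x)"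
        using c mult_left_mono[OF c(1) w0[of x]] w0[of x]
        by (auto simp: indicator_def ennreal_mult[symmetric] mult.commute intro!: ennreal_leI)
    qed
    also have "\<dots> = ennreal c * wmeas w ?P"
      unfolding wmeas_def by (rule nn_integral_cmult) measurable
    also have "\<dots> = ennreal (c * cmass w y t)"
      using c by (simp add: muck_wmeas[OF m t] ennreal_mult)
    finally show ?thesis .
  qed
  have "\<exists>k. ?P \<subseteq> ?Q k"
  proof -
    have "bounded ?P" by (simp add: cb_def)
    then obtain u where u: "?P \<subseteq> cb z u" by (rule bounded_subset_cb)
    obtain k where "u / s < 3 ^ k" using real_arch_pow[of 3 "u / s"] by auto
    then have "u \<le> 3 ^ k * s" using s by (simp add: divide_less_eq)
    then show ?thesis using u cb_mono by blast
  qed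
  define k where "k = (LEAST k. ?P \<subseteq> ?Q k)"
  have k: "?P \<subseteq> ?Q k" and kmin: "\<And>j. j < k \<Longrightarrow> \<not> ?P \<subseteq> ?Q j"
    unfolding k_def using LeastI_ex[OF \<open>\<exists>k. ?P \<subseteq> ?Q k\<close>] not_less_Least by auto
  have 1: "wmeas (\<lambda>x. w x * ?v x) ?P \<le> ennreal (L * M * ?E * a k * cmass w y t)"
  proof -
    have "\<exists>c\<le>L * M * ?E * a k. wmeas (\<lambda>x. w x * ?v x) ?P \<le> ennreal (c * cmass w y t)"
    proof (cases "k \<le> 1 \<or> ?P \<inter> ?Q (k - 2) = {}")
      case True
      have "?v x \<le> L * a k" if "x \<in> ?P" for x
      proof (cases "k \<le> 1")
        case True
        have "1 \<le> L * a k"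
        proof (cases k)
          case 0 then show ?thesis using L1 a0 by simp
        next
          case (Suc j) 
          then have "k = Suc 0" using True by simp
          then show ?thesis using L[of 0] a0 by simp
        qed
        then show ?thesis using ring_weight_le_1[of x] by simp
      next
        case False
        define j where "j = k - 2"
        have j: "k = Suc (Suc j)" using False by (simp add: j_def)
        have "x \<notin> ?Q j" using that True False by (auto simp: j_def)
        then have "?v x \<le> a (Suc j)" by (rule ring_weight_le)
        also have "\<dots> \<le> L * a k" unfolding j by (rule L)
        finally show ?thesis .
      qed
      moreover have "0 \<le> L * a k" using L1 apos[of k] by simp
      ultimately show ?thesis
        using bound[of "L * a k"] mult_right_mono[OF LM(1), of "a k"] apos[of k] by (intro exI[of _ "L * a k"]) auto
    next
      case False
      define j where "j = k - 2"
      have j: "k = Suc (Suc j)" using False unfolding j_def by linarith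
      obtain x where x: "x \<in> ?P" "x \<in> ?Q j" using False by (auto simp: j_def)
      obtain x' where x': "x' \<in> ?P" "x' \<notin> ?Q (Suc j)" using kmin[of "Suc j"] j by auto
      \<comment> \<open>In this coordinate x and x' are more than 2 * 3^j s apart, while both lie
        within t of y.\<close>
      obtain i where i: "3 * (3 ^ j * s) < \<bar>x' $ i - z $ i\<bar>"
        using x'(2) by (auto simp: mem_cb not_le mult.assoc)
      have "\<bar>x $ i - z $ i\<bar> \<le> 3 ^ j * s" "\<bar>x $ i - y $ i\<bar> \<le> t" "\<bar>x' $ i - y $ i\<bar> \<le> t"
        using x x'(1) by (auto simp: mem_cb)
      with i have tj: "3 ^ j * s \<le> t" by linarith
      have sk: "0 < 3 ^ k * s" using s by simp
      have "3 ^ k * s / t \<le> 9"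
        using tj t unfolding j by (simp add: divide_le_eq)
      then have "(3 ^ k * s / t) powr (real CARD('n) * q) \<le> 9 powr (real CARD('n) * q)"
        using t sk q by (intro powr_mono2) auto
      then have "B * (3 ^ k * s / t) powr (real CARD('n) * q) * cmass w y t \<le> ?E * cmass w y t"
        using muck_ge_1[OF q m] by (intro mult_right_mono mult_left_mono) auto
      then have dbl: "cmass w z (3 ^ k * s) \<le> ?E * cmass w y t"
        using muck_doubling[OF q m k t sk] by linarith
      have "wmeas (\<lambda>x. w x * ?v x) ?P \<le> wmeas (\<lambda>x. w x * ?v x) (?Q k)"
        by (rule wmeas_mono[OF k])
      also have "\<dots> \<le> (\<integral>\<^sup>+x. (\<Sum>i\<le>k. ennreal (a i) * (ennreal (w x) * indicator (?Q i) x)) \<partial>lebesgue)"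
        unfolding wmeas_def
      proof (rule nn_integral_mono)
        fix x
        obtain l where l: "x \<in> ?Q l" "?v x = a l" "\<And>j. x \<in> ?Q j \<Longrightarrow> l \<le> j"
          using ring_weight_witness[of x] by blast
        show "ennreal (w x * ?v x) * indicator (?Q k) x \<le> (\<Sum>i\<le>k. ennreal (a i) * (ennreal (w x) * indicator (?Q i) x))"
        proof (cases "x \<in> ?Q k")
          case True
          have "ennreal (w x * ?v x) * indicator (?Q k) x = ennreal (a l) * (ennreal (w x) * indicator (?Q l) x)"
            using True l w0[of x] apos[of l] by (simp add: ennreal_mult' mult.commute)
          also have "\<dots> \<le> (\<Sum>i\<le>k. ennreal (a i) * (ennreal (w x) * indicator (?Q i) x))"
            using l(3)[OF True] by (intro member_le_sum) auto
          finally show ?thesis .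
        qed simp
      qed
      also have "\<dots> = (\<Sum>i\<le>k. ennreal (a i) * wmeas w (?Q i))"
        unfolding wmeas_def by (subst nn_integral_sum, measurable) (intro sum.cong refl nn_integral_cmult, measurable)
      also have "\<dots> = ennreal (\<Sum>i\<le>k. a i * cmass w z (3 ^ i * s))"
        using s apos by (subst sum_ennreal[symmetric]) (auto simp: muck_wmeas[OF m] ennreal_mult less_imp_le)
      also have "\<dots> \<le> ennreal (M * ?E * a k * cmass w y t)"
      proof (rule ennreal_leI)
        have "M * a k * cmass w z (3 ^ k * s) \<le> M * a k * (?E * cmass w y t)"
          using dbl M1 apos[of k] by (intro mult_left_mono) auto
        with M[of k] show "(\<Sum>i\<le>k. a i * cmass w z (3 ^ i * s)) \<le> M * ?E * a k * cmass w y t"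
          by (simp add: mult_ac)
      qed
      finally show ?thesis
        using mult_right_mono[OF LM(2), of "a k"] apos[of k] by (intro exI[of _ "M * ?E * a k"]) auto
    qed
    then obtain c where "c \<le> L * M * ?E * a k" "wmeas (\<lambda>x. w x * ?v x) ?P \<le> ennreal (c * cmass w y t)"
      by blast
    then show ?thesis
      by (meson cmass_nonneg ennreal_leI mult_right_mono order_trans)
  qed
  show "AE x in lebesgue. x \<in> ?P \<longrightarrow> wmeas (\<lambda>x. w x * ?v x) ?P \<le> ennreal (L * M * ?E * ?v x * cmass w y t)"
  proof (intro AE_I2 impI)
    fix x assume "x \<in> ?P"
    then have "L * M * ?E * a k * cmass w y t \<le> L * M * ?E * ?v x * cmass w y t"
      using k ring_weight_ge[of x k] L1 M1 E by (intro mult_right_mono mult_left_mono) auto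
    then show "wmeas (\<lambda>x. w x * ?v x) ?P \<le> ennreal (L * M * ?E * ?v x * cmass w y t)"
      by (rule order_trans[OF 1 ennreal_leI])
  qed
qed measurable

end

section \<open>From ring weights to Morrey norms\<close>

definition pintQ :: "real \<Rightarrow> (real ^ 'n \<Rightarrow> real) \<Rightarrow> (real ^ 'n) set \<Rightarrow> (real ^ 'n \<Rightarrow> real) \<Rightarrow> ennreal" where
  "pintQ p w Q f = (\<integral>\<^sup>+x\<in>Q. ennreal (f x powr p * w x) \<partial>lebesgue)"

text \<open>Each point is counted at least in the smallest cube containing it. Whole cubes overcount
  the rings, but cubes are what a Morrey norm controls.\<close>

lemma pint_ring_weight_le:
  fixes z :: "real ^ 'n"
  assumes s: "0 < s" and a: "a 0 = 1" "\<And>k. 0 < a k" "\<And>k. a (Suc k) \<le> a k"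
    and [measurable]: "w \<in> borel_measurable lebesgue" "f \<in> borel_measurable lebesgue"
  shows "pint p (\<lambda>x. w x * ring_weight a z s x) f \<le> (\<Sum>k. ennreal (a k) * pintQ p w (cb z (3 ^ k * s)) f)"
proof -
  note [measurable] = ring_weight_measurable[OF s a]
  let ?Q = "\<lambda>k. cb z (3 ^ k * s)"
  have "pint p (\<lambda>x. w x * ring_weight a z s x) f
      \<le> (\<integral>\<^sup>+x. (\<Sum>k. ennreal (a k) * (ennreal (f x powr p * w x) * indicator (?Q k) x)) \<partial>lebesgue)"
    unfolding pint_def
  proof (rule nn_integral_mono)
    fix x
    let ?t = "\<lambda>k. ennreal (a k) * (ennreal (f x powr p * w x) * indicator (?Q k) x)"
    obtain l where l: "x \<in> ?Q l" "ring_weight a z s x = a l"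
      using ring_weight_witness[OF s a, of x] by blast
    have "ennreal (f x powr p * (w x * ring_weight a z s x)) = sum ?t {l}"
      using l a(2)[of l] by (simp add: ennreal_mult'[symmetric] mult_ac)
    also have "\<dots> \<le> (\<Sum>k. ?t k)"
      by (rule sum_le_suminf) (auto intro: summableI)
    finally show "ennreal (f x powr p * (w x * ring_weight a z s x)) \<le> (\<Sum>k. ?t k)" .
  qed
  also have "\<dots> = (\<Sum>k. ennreal (a k) * pintQ p w (?Q k) f)"
    unfolding pintQ_def by (subst nn_integral_suminf, measurable) (intro suminf_cong nn_integral_cmult, measurable)
  finally show ?thesis .
qed

lemma Lp_norm_pintQ:
  assumes "\<And>x. 0 \<le> f x"
  shows "Lp_norm p w Q f = enn_powr (pintQ p w Q f) (1 / p)"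
  using assms by (simp add: Lp_norm_def pintQ_def)

lemma morrey_term_le_iff:
  assumes p: "0 < p" and m: "0 < m" and X: "0 \<le> X"
  shows "enn_powr (ennreal m) (- \<beta>) * enn_powr J (1 / p) \<le> ennreal X \<longleftrightarrow> J \<le> ennreal (X powr p * m powr (\<beta> * p))"
proof (cases J)
  case top
  have "0 < m powr - \<beta>" using m by simp
  then show ?thesis
    using top p m by (simp add: enn_powr_ennreal_pos enn_powr_infinity[simplified] ennreal_mult_top top_unique)
next
  case (real j)
  have "enn_powr (ennreal m) (- \<beta>) * enn_powr J (1 / p) = ennreal (m powr - \<beta> * j powr (1 / p))"
    using real p m by (simp add: enn_powr_ennreal_pos enn_powr_ennreal ennreal_mult[symmetric])
  moreover have "m powr - \<beta> * j powr (1 / p) \<le> X \<longleftrightarrow> j \<le> X powr p * m powr (\<beta> * p)"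
  proof -
    have "m powr - \<beta> * j powr (1 / p) \<le> X \<longleftrightarrow> j powr (1 / p) \<le> X * m powr \<beta>"
      using m by (simp add: powr_minus field_simps)
    also have "\<dots> \<longleftrightarrow> (j powr (1 / p)) powr p \<le> (X * m powr \<beta>) powr p"
      using p X m by (meson linorder_not_le mult_nonneg_nonneg powr_ge_zero powr_less_mono2 powr_mono2 less_imp_le)
    also have "\<dots> \<longleftrightarrow> j \<le> X powr p * m powr (\<beta> * p)"
      using p X m real by (simp add: powr_powr powr_mult)
    finally show ?thesis .
  qed
  ultimately show ?thesis
    using real X by (simp add: ennreal_le_iff)
qed

text \<open>Both norms are instances, with \<mu> the weighted or the Lebesgue measure. The condition
  \<open>L\<close> keeps neighbouring rings comparable, \<open>M\<close> makes a_k w(Q_k) grow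
  geometrically and so gives A_1, and \<open>S\<close> makes the series of local integrals converge.
  All constants are uniform in the cube, so that one \<open>C\<close> serves every cube before the
  supremum is taken.\<close>

lemma morrey_transfer:
  fixes F :: "((real ^ 'n \<Rightarrow> real) \<times> (real ^ 'n \<Rightarrow> real)) set"
    and w :: "real ^ 'n \<Rightarrow> real" and \<mu> :: "(real ^ 'n) set \<Rightarrow> ennreal" and \<beta> p :: real
  defines "N \<equiv> \<lambda>h :: real ^ 'n \<Rightarrow> real. SUP Q\<in>cubes. enn_powr (\<mu> Q) (- \<beta>) * Lp_norm p w Q h"
  assumes F: "\<And>f g. (f, g) \<in> F \<Longrightarrow> f \<in> borel_measurable lebesgue \<and> g \<in> borel_measurable lebesgue
           \<and> (\<forall>x. 0 \<le> f x) \<and> (\<forall>x. 0 \<le> g x)"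
    and dom: "dominated F p" and p: "0 < p"
    and q: "1 < q" and m: "muckenhoupt q B w"
    and \<mu>: "\<And>z s. 0 < s \<Longrightarrow> \<mu> (cb z s) = ennreal (\<nu> z s)" "\<And>z s. 0 < s \<Longrightarrow> 0 < \<nu> z s"
    and a: "\<And>z s. 0 < s \<Longrightarrow> a z s 0 = 1" "\<And>z s k. 0 < s \<Longrightarrow> 0 < a z s k"
      "\<And>z s k. 0 < s \<Longrightarrow> a z s (Suc k) \<le> a z s k"
    and L: "\<And>z s k. 0 < s \<Longrightarrow> a z s k \<le> L * a z s (Suc k)" and L1: "1 \<le> L"
    and M: "\<And>z s k j. 0 < s \<Longrightarrow> j \<le> k \<Longrightarrow>
       a z s j * cmass w z (3 ^ j * s) \<le> M * \<tau> ^ (k - j) * (a z s k * cmass w z (3 ^ k * s))" and M1: "1 \<le> M"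
    and \<tau>: "0 \<le> \<tau>" "\<tau> < 1"
    and S: "\<And>z s k. 0 < s \<Longrightarrow> a z s k * \<nu> z (3 ^ k * s) powr (\<beta> * p) \<le> \<rho> ^ k * \<nu> z s powr (\<beta> * p)"
    and \<rho>: "0 \<le> \<rho>" "\<rho> < 1"
  shows "\<exists>c>0. \<forall>(f, g)\<in>F. N g < \<infinity> \<longrightarrow> N g \<le> ennreal c * N f"
proof -
  note [measurable] = muck_measurable[OF m]
  define M' where "M' = M / (1 - \<tau>)"
  have M'1: "1 \<le> M'" unfolding M'_def using M1 \<tau> by (simp add: le_divide_eq)
  define K where "K = L * M' * (B * 9 powr (real CARD('n) * q))"
  have B: "1 \<le> B" by (rule muck_ge_1[OF q m])
  have K: "0 < K" unfolding K_def using L1 M'1 B by simp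
  obtain C where C: "0 < C"
    "\<And>f g w. (f, g) \<in> F \<Longrightarrow> muckenhoupt q (K * B) w \<Longrightarrow> pint p w g < \<infinity> \<Longrightarrow> pint p w g \<le> ennreal C * pint p w f"
    using dominatedE[OF dom q] by blast
  have A1: "A1_rel K w (ring_weight (a z s) z s)" if s: "0 < s" for z s
    unfolding K_def
  proof (rule A1_rel_ring_weight[OF s a[OF s] q m L[OF s] L1 _ M'1])
    fix k
    have "(\<Sum>j\<le>k. a z s j * cmass w z (3 ^ j * s)) \<le> (\<Sum>j\<le>k. M * \<tau> ^ (k - j) * (a z s k * cmass w z (3 ^ k * s)))"
      by (intro sum_mono M s) auto
    also have "\<dots> = M * (a z s k * cmass w z (3 ^ k * s)) * (\<Sum>j\<le>k. \<tau> ^ (k - j))"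
      unfolding sum_distrib_left by (intro sum.cong) (simp_all add: mult_ac)
    also have "(\<Sum>j\<le>k. \<tau> ^ (k - j)) = (\<Sum>j\<le>k. \<tau> ^ j)"
      by (rule sum.reindex_bij_witness[of _ "\<lambda>j. k - j" "\<lambda>j. k - j"]) auto
    also have "M * (a z s k * cmass w z (3 ^ k * s)) * (\<Sum>j\<le>k. \<tau> ^ j)
        \<le> M * (a z s k * cmass w z (3 ^ k * s)) * (1 / (1 - \<tau>))"
    proof (rule mult_left_mono)
      have "(\<Sum>j\<le>k. \<tau> ^ j) \<le> (\<Sum>j. \<tau> ^ j)"
        using \<tau> by (intro sum_le_suminf summable_geometric) auto
      then show "(\<Sum>j\<le>k. \<tau> ^ j) \<le> 1 / (1 - \<tau>)" using \<tau> by (simp add: suminf_geometric)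
    qed (use M1 a(2)[OF s, of z k] in simp)
    finally show "(\<Sum>j\<le>k. a z s j * cmass w z (3 ^ j * s)) \<le> M' * a z s k * cmass w z (3 ^ k * s)"
      by (simp add: M'_def mult_ac)
  qed
  define c where "c = (C / (1 - \<rho>)) powr (1 / p)"
  have c: "0 < c" unfolding c_def using C \<rho> by simp
  \<comment> \<open>Applied twice: to g only to secure the finiteness that the hypothesis asks for,
    to f for the actual bound.\<close>
  have ring_sum: "pint p (\<lambda>x. w x * ring_weight (a z s) z s x) h \<le> ennreal (X powr p / (1 - \<rho>) * \<nu> z s powr (\<beta> * p))"
    if s: "0 < s" and N: "N h = ennreal X" "0 \<le> X" and h: "h \<in> borel_measurable lebesgue" "\<And>x. 0 \<le> h x" for z s h X
  proof -
    have Q: "pintQ p w (cb z (3 ^ k * s)) h \<le> ennreal (X powr p * \<nu> z (3 ^ k * s) powr (\<beta> * p))" for k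
    proof -
      have s': "0 < 3 ^ k * s" using s by simp
      then have "cb z (3 ^ k * s) \<in> cubes" by (auto simp: cubes_eq)
      then have "enn_powr (\<mu> (cb z (3 ^ k * s))) (- \<beta>) * Lp_norm p w (cb z (3 ^ k * s)) h \<le> N h"
        unfolding N_def by (rule SUP_upper)
      then show ?thesis
        unfolding N(1) \<mu>(1)[OF s'] Lp_norm_pintQ[OF h(2)]
        by (subst (asm) morrey_term_le_iff[OF p \<mu>(2)[OF s'] N(2)])
    qed
    have "pint p (\<lambda>x. w x * ring_weight (a z s) z s x) h \<le> (\<Sum>k. ennreal (a z s k) * pintQ p w (cb z (3 ^ k * s)) h)"
      by (intro pint_ring_weight_le s a h(1)) measurable
    also have "\<dots> \<le> (\<Sum>k. ennreal (X powr p * \<nu> z s powr (\<beta> * p) * \<rho> ^ k))"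
    proof (intro suminf_le summableI)
      fix k
      have "ennreal (a z s k) * pintQ p w (cb z (3 ^ k * s)) h
          \<le> ennreal (a z s k) * ennreal (X powr p * \<nu> z (3 ^ k * s) powr (\<beta> * p))"
        by (intro mult_left_mono Q) auto
      also have "\<dots> = ennreal (X powr p * (a z s k * \<nu> z (3 ^ k * s) powr (\<beta> * p)))"
        using a(2)[OF s, of z k] by (simp add: ennreal_mult'[symmetric] mult_ac)
      also have "\<dots> \<le> ennreal (X powr p * (\<rho> ^ k * \<nu> z s powr (\<beta> * p)))"
        by (intro ennreal_leI mult_left_mono S s) auto
      finally show "ennreal (a z s k) * pintQ p w (cb z (3 ^ k * s)) h \<le> ennreal (X powr p * \<nu> z s powr (\<beta> * p) * \<rho> ^ k)"
        by (simp add: mult_ac)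
    qed
    also have "\<dots> = ennreal (X powr p * \<nu> z s powr (\<beta> * p) * (1 / (1 - \<rho>)))"
      using \<rho> by (intro suminf_ennreal_eq sums_mult geometric_sums) auto
    finally show ?thesis by (simp add: mult_ac)
  qed
  have main: "N g \<le> ennreal c * N f" if fg: "(f, g) \<in> F" and fin: "N g < \<infinity>" for f g
  proof (cases "N f")
    case top
    then show ?thesis using c by (simp add: ennreal_mult_top)
  next
    case (real X)
    obtain Y where Y: "0 \<le> Y" "N g = ennreal Y" using fin by (cases "N g") auto
    have f: "f \<in> borel_measurable lebesgue" "\<And>x. 0 \<le> f x" and g: "g \<in> borel_measurable lebesgue" "\<And>x. 0 \<le> g x"
      using F[OF fg] by auto
    have "N g \<le> ennreal (c * X)"
      unfolding N_def
    proof (rule SUP_least)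
      fix Q :: "(real ^ 'n) set" assume "Q \<in> cubes"
      then obtain z s where s: "0 < s" and Q: "Q = cb z s" by (auto simp: cubes_eq)
      let ?v = "\<lambda>x. w x * ring_weight (a z s) z s x"
      have "pint p ?v g < \<infinity>"
        by (rule le_less_trans[OF ring_sum[OF s Y(2,1) g]]) simp
      then have "pint p ?v g \<le> ennreal C * pint p ?v f"
        by (intro C(2)[OF fg muck_mult[OF q m A1[OF s] K]])
      also have "\<dots> \<le> ennreal C * ennreal (X powr p / (1 - \<rho>) * \<nu> z s powr (\<beta> * p))"
        by (intro mult_left_mono ring_sum[OF s real(2,1) f]) simp
      also have "\<dots> = ennreal ((c * X) powr p * \<nu> z s powr (\<beta> * p))"
        unfolding c_def using C(1) \<rho> p real(1) by (simp add: ennreal_mult'[symmetric] powr_mult powr_powr)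
      finally have 1: "pint p ?v g \<le> ennreal ((c * X) powr p * \<nu> z s powr (\<beta> * p))" .
      have "pintQ p w (cb z s) g \<le> pint p ?v g"
        unfolding pintQ_def pint_def
      proof (rule nn_integral_mono)
        fix x
        show "ennreal (g x powr p * w x) * indicator (cb z s) x \<le> ennreal (g x powr p * ?v x)"
        proof (cases "x \<in> cb z s")
          case True
          then have "a z s 0 \<le> ring_weight (a z s) z s x"
            by (intro ring_weight_ge[OF s a[OF s]]) simp
          then have "1 \<le> ring_weight (a z s) z s x"
            using a(1)[OF s, of z] by simp
          from mult_left_mono[OF this, of "g x powr p * w x"]
          show ?thesis using True muck_nonneg[OF m, of x] by (simp add: ennreal_leI mult_ac)
        qed simp
      qed
      with 1 have "pintQ p w (cb z s) g \<le> ennreal ((c * X) powr p * \<nu> z s powr (\<beta> * p))" by simp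
      then show "enn_powr (\<mu> Q) (- \<beta>) * Lp_norm p w Q g \<le> ennreal (c * X)"
        unfolding Q \<mu>(1)[OF s] Lp_norm_pintQ[OF g(2)]
        using c real(1) by (subst morrey_term_le_iff[OF p \<mu>(2)[OF s]]) auto
    qed
    also have "\<dots> = ennreal c * N f" using c real by (simp add: ennreal_mult)
    finally show ?thesis .
  qed
  show ?thesis using c main by (intro exI[of _ c]) auto
qed

lemma muck_growth:
  fixes w :: "real ^ 'n \<Rightarrow> real"
  assumes q: "1 < q" and m: "muckenhoupt q B w"
  obtains \<rho> where "0 < \<rho>" "\<rho> < 1"
    "\<And>z s j k. 0 < s \<Longrightarrow> j \<le> k \<Longrightarrow> cmass w z (3 ^ j * s) \<le> \<rho> ^ (k - j) * cmass w z (3 ^ k * s)"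
proof -
  \<comment> \<open>The maximum with 1 / 2 keeps \<rho> positive, since real powers of it are taken
    later and \<open>rev_const\<close> is only known to be nonnegative.\<close>
  define \<rho> where "\<rho> = max (rev_const TYPE('n) q B) (1 / 2)"
  have \<rho>: "0 < \<rho>" "\<rho> < 1"
    using rev_const_bounds[OF q m] by (auto simp: \<rho>_def)
  have step: "cmass w z s \<le> \<rho> * cmass w z (3 * s)" if "0 < s" for z s
    using muck_reverse_doubling[OF q m that, of z] mult_right_mono[of "rev_const TYPE('n) q B" \<rho> "cmass w z (3 * s)"]
    by (simp add: \<rho>_def)
  have "cmass w z (3 ^ j * s) \<le> \<rho> ^ (k - j) * cmass w z (3 ^ k * s)" if s: "0 < s" and "j \<le> k" for z s j k
    using \<open>j \<le> k\<close>
  proof (induction k rule: dec_induct)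
    case (step i)
    have "\<rho> ^ (i - j) * cmass w z (3 ^ i * s) \<le> \<rho> ^ (i - j) * (\<rho> * cmass w z (3 * (3 ^ i * s)))"
      using \<rho> s by (intro mult_left_mono \<open>\<And>z s. 0 < s \<Longrightarrow> cmass w z s \<le> \<rho> * cmass w z (3 * s)\<close>) auto
    then show ?case
      using step by (simp add: Suc_diff_le mult_ac)
  qed simp
  with \<rho> that show thesis by blast
qed

text \<open>Write W_k for w(Q_k). With a_k = (W_0 / W_k)^\<theta>, the product a_k W_k =
  W_0^\<theta> W_k^(1-\<theta>) grows and a_k W_k^\<gamma> = W_0^\<theta> W_k^(\<gamma>-\<theta>)
  decays, both geometrically by reverse doubling. Doubling bounds the ratio of consecutive
  a_k.\<close>

lemma morrey_weighted:
  fixes F :: "((real ^ 'n \<Rightarrow> real) \<times> (real ^ 'n \<Rightarrow> real)) set" and w :: "real ^ 'n \<Rightarrow> real"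
  assumes F: "\<And>f g. (f, g) \<in> F \<Longrightarrow> f \<in> borel_measurable lebesgue \<and> g \<in> borel_measurable lebesgue
           \<and> (\<forall>x. 0 \<le> f x) \<and> (\<forall>x. 0 \<le> g x)"
    and dom: "dominated F p" and p: "0 < p"
    and r: "- (real CARD('n) / p) \<le> r" "r < 0" and w: "w \<in> A_inf"
  shows "\<exists>c>0. \<forall>(f, g)\<in>F. morrey_norm p r w g < \<infinity> \<longrightarrow> morrey_norm p r w g \<le> ennreal c * morrey_norm p r w f"
proof -
  obtain q B where q: "1 < q" and m: "muckenhoupt q B w"
    using A_inf_muckenhoupt[OF w] by blast
  obtain \<rho> where \<rho>: "0 < \<rho>" "\<rho> < 1"
    and grow: "\<And>z s j k. 0 < s \<Longrightarrow> j \<le> k \<Longrightarrow> cmass w z (3 ^ j * s) \<le> \<rho> ^ (k - j) * cmass w z (3 ^ k * s)"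
    using muck_growth[OF q m] by blast
  let ?n = "real CARD('n)"
  define \<gamma> where "\<gamma> = (1 / p + r / ?n) * p"
  have n: "0 < ?n" by simp
  have \<gamma>: "0 \<le> \<gamma>" "\<gamma> < 1"
  proof -
    have "0 \<le> r * p + ?n" using r p by (simp add: field_simps)
    moreover have "\<gamma> = (r * p + ?n) / ?n" using p n by (simp add: \<gamma>_def field_simps)
    moreover have "r * p < 0" using r p by (simp add: mult_neg_pos)
    ultimately show "0 \<le> \<gamma>" "\<gamma> < 1" using n by (auto simp: divide_less_eq)
  qed
  \<comment> \<open>Half of the gap between \<gamma> and 1: \<theta> becomes the midpoint, and the
    growth and the decay have the same rate \<open>\<rho> powr \<delta>\<close>.\<close>
  define \<delta> where "\<delta> = (1 - \<gamma>) / 2"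
  define \<theta> where "\<theta> = \<gamma> + \<delta>"
  have \<delta>: "0 < \<delta>" "0 \<le> \<theta>" "1 - \<theta> = \<delta>" "\<theta> - \<gamma> = \<delta>"
    using \<gamma> by (auto simp: \<delta>_def \<theta>_def field_simps)
  define W where "W z s k = cmass w z (3 ^ k * s)" for z s and k :: nat
  have W: "0 < W z s k" if "0 < s" for z s k
    unfolding W_def using that by (intro muck_cmass_pos[OF m]) simp
  have W0: "W z s 0 = cmass w z s" for z s by (simp add: W_def)
  have Wmono: "W z s j \<le> \<rho> ^ (k - j) * W z s k" if "0 < s" "j \<le> k" for z s j k
    unfolding W_def by (rule grow[OF that])
  have \<rho>\<delta>: "0 < \<rho> powr \<delta>" "\<rho> powr \<delta> < 1"
    using \<rho> \<delta> powr_less_mono2[of \<delta> \<rho> 1] by auto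
  have pow: "(\<rho> ^ i) powr \<delta> = (\<rho> powr \<delta>) ^ i" for i
    using \<rho> by (simp add: powr_realpow[symmetric] powr_powr mult.commute)
  define a where "a z s k = (W z s 0 / W z s k) powr \<theta>" for z s k
  define D where "D = B * 3 powr (?n * q)"
  have B: "1 \<le> B" by (rule muck_ge_1[OF q m])
  have D: "1 \<le> D"
  proof -
    have "1 \<le> (3::real) powr (?n * q)" by (rule ge_one_powr_ge_zero) (use q in auto)
    then have "1 * 1 \<le> D" unfolding D_def using B by (intro mult_mono) auto
    then show ?thesis by simp
  qed
  have "\<exists>c>0. \<forall>(f, g)\<in>F.
      (SUP Q\<in>cubes. enn_powr (wmeas w Q) (- (1 / p + r / ?n)) * Lp_norm p w Q g) < \<infinity> \<longrightarrow>
      (SUP Q\<in>cubes. enn_powr (wmeas w Q) (- (1 / p + r / ?n)) * Lp_norm p w Q g)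
        \<le> ennreal c * (SUP Q\<in>cubes. enn_powr (wmeas w Q) (- (1 / p + r / ?n)) * Lp_norm p w Q f)"
  proof (rule morrey_transfer[OF F dom p q m, where \<nu> = "cmass w" and a = a and L = "D powr \<theta>" and M = 1
        and \<tau> = "\<rho> powr \<delta>" and \<rho> = "\<rho> powr \<delta>"])
    show "1 \<le> D powr \<theta>" using D \<delta> by (intro ge_one_powr_ge_zero) auto
    fix z :: "real ^ 'n" and s :: real and j k :: nat assume s: "0 < s"
    show "wmeas w (cb z s) = ennreal (cmass w z s)" by (rule muck_wmeas[OF m s])
    show "0 < cmass w z s" by (rule muck_cmass_pos[OF m s])
    show "a z s 0 = 1" using W[OF s, of z 0] by (simp add: a_def)
    show "0 < a z s k" using W[OF s, of z] by (simp add: a_def less_imp_neq[symmetric])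
    have S: "W z s k \<le> W z s (Suc k)"
      unfolding W_def using s by (intro cmass_mono cb_mono) (auto simp: muck_wmeas[OF m])
    show "a z s (Suc k) \<le> a z s k"
      unfolding a_def using W[OF s, of z] S \<delta>
      by (intro powr_mono2 divide_left_mono) (auto simp: less_imp_le intro: mult_pos_pos)
    show "a z s k \<le> D powr \<theta> * a z s (Suc k)"
    proof -
      have s': "0 < 3 ^ k * s" "0 < 3 * (3 ^ k * s)" using s by auto
      have "W z s (Suc k) \<le> D * W z s k"
        using muck_doubling[OF q m cb_mono[of "3 ^ k * s" "3 * (3 ^ k * s)" z] s'] s
        by (simp add: W_def D_def mult.assoc)
      then have "W z s 0 / W z s k \<le> D * (W z s 0 / W z s (Suc k))"
        using W[OF s, of z k] W[OF s, of z "Suc k"] W[OF s, of z 0] by (simp add: field_simps)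
      then have "(W z s 0 / W z s k) powr \<theta> \<le> (D * (W z s 0 / W z s (Suc k))) powr \<theta>"
        using W[OF s, of z] \<delta> by (intro powr_mono2) (auto simp: less_imp_le)
      then show ?thesis
        unfolding a_def by (simp only: powr_mult)
    qed
    show "a z s k * cmass w z (3 ^ k * s) powr ((1 / p + r / ?n) * p)
        \<le> (\<rho> powr \<delta>) ^ k * cmass w z s powr ((1 / p + r / ?n) * p)"
    proof -
      have pos: "0 < W z s 0" "0 < W z s k" using W[OF s, of z] by auto
      have "a z s k * W z s k powr \<gamma> = (W z s 0 / W z s k) powr \<delta> * W z s 0 powr \<gamma>"
        unfolding a_def \<theta>_def using pos by (simp add: powr_divide powr_add)
      also have "\<dots> \<le> (\<rho> ^ k) powr \<delta> * W z s 0 powr \<gamma>"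
        using Wmono[OF s, of 0 k z] pos \<delta> by (intro mult_right_mono powr_mono2) (auto simp: divide_le_eq)
      finally show ?thesis by (simp add: pow W0 \<gamma>_def[symmetric] W_def)
    qed
    assume jk: "j \<le> k"
    show "a z s j * cmass w z (3 ^ j * s) \<le> 1 * (\<rho> powr \<delta>) ^ (k - j) * (a z s k * cmass w z (3 ^ k * s))"
    proof -
      have pos: "0 < W z s 0" "0 < W z s k" "0 < W z s j" using W[OF s, of z] by auto
      have aW: "a z s i * W z s i = W z s 0 powr \<theta> * W z s i powr \<delta>" for i
      proof -
        have "0 < W z s i" by (rule W[OF s])
        then have "W z s i = W z s i powr \<theta> * W z s i powr \<delta>"
        proof -
          have "\<theta> + \<delta> = 1" using \<delta>(3) by linarith
          with \<open>0 < W z s i\<close> show ?thesis unfolding powr_add[symmetric] by simp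
        qed
        then have "a z s i * W z s i = (W z s 0 / W z s i) powr \<theta> * (W z s i powr \<theta> * W z s i powr \<delta>)"
          unfolding a_def by simp
        then show ?thesis using pos \<open>0 < W z s i\<close> by (simp add: powr_divide)
      qed
      have "W z s j powr \<delta> \<le> (\<rho> ^ (k - j) * W z s k) powr \<delta>"
        using Wmono[OF s jk, of z] pos \<delta> by (intro powr_mono2) auto
      also have "\<dots> = (\<rho> powr \<delta>) ^ (k - j) * W z s k powr \<delta>"
        using pos \<rho> by (simp add: powr_mult pow)
      finally have "W z s 0 powr \<theta> * W z s j powr \<delta> \<le> W z s 0 powr \<theta> * ((\<rho> powr \<delta>) ^ (k - j) * W z s k powr \<delta>)"
        by (intro mult_left_mono) auto
      then have "a z s j * W z s j \<le> (\<rho> powr \<delta>) ^ (k - j) * (a z s k * W z s k)"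
        unfolding aW by (simp add: mult_ac)
      then show ?thesis by (simp add: W_def)
    qed
  qed (use \<rho>\<delta> in auto)
  then show ?thesis by (simp add: morrey_norm_def)
qed

text \<open>The exponent 1 + \<sigma> (q - 1) is the one at which the dual weight of w^\<sigma>
  coincides with that of w at q. The reverse Hoelder inequality bounds the mass of w^\<sigma> by
  that of w, and the A_q product of w raised to the power \<sigma> appears.\<close>

lemma RH_muckenhoupt_powr:
  fixes w :: "real ^ 'n \<Rightarrow> real"
  assumes q: "1 < q" and m: "muckenhoupt q B w" and \<sigma>: "1 < \<sigma>" and RH: "w \<in> RH \<sigma>"
  obtains c B' where "1 \<le> c" "muckenhoupt (1 + \<sigma> * (q - 1)) B' (\<lambda>x. w x powr \<sigma>)"
    "\<And>z s. 0 < s \<Longrightarrow> cmass (\<lambda>x. w x powr \<sigma>) z s \<le> c powr \<sigma> * cmass w z s powr \<sigma> * ((2 * s) ^ CARD('n)) powr (1 - \<sigma>)"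
proof -
  note [measurable] = muck_measurable[OF m]
  let ?u = "\<lambda>x. w x powr \<sigma>" and ?r = "1 + \<sigma> * (q - 1)"
  obtain c0 where c0: "\<forall>Q\<in>cubes. enn_powr (avg ?u Q) (1 / \<sigma>) \<le> ennreal c0 * avg w Q"
    using RH by (auto simp: RH_def)
  define c where "c = max c0 1"
  have c: "1 \<le> c" "c0 \<le> c" by (auto simp: c_def)
  have r: "1 < ?r" using \<sigma> q by simp
  have u: "wmeas ?u (cb z s) < \<infinity> \<and> cmass ?u z s \<le> c powr \<sigma> * cmass w z s powr \<sigma> * ((2 * s) ^ CARD('n)) powr (1 - \<sigma>)"
    if s: "0 < s" for z :: "real ^ 'n" and s
  proof -
    define l where "l = (2 * s) ^ CARD('n)"
    have l: "0 < l" using s by (simp add: l_def)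
    define b where "b = cmass w z s"
    have b: "0 < b" unfolding b_def by (rule muck_cmass_pos[OF m s])
    have avg: "avg w (cb z s) = ennreal (b / l)"
      unfolding avg_def muck_wmeas[OF m s] emeasure_cb[OF s] l_def[symmetric] b_def[symmetric]
      using l b by (simp add: divide_ennreal)
    have "cb z s \<in> cubes" using s by (auto simp: cubes_eq)
    with c0 have "enn_powr (avg ?u (cb z s)) (1 / \<sigma>) \<le> ennreal c0 * avg w (cb z s)" by blast
    also have "\<dots> \<le> ennreal c * avg w (cb z s)" using c by (intro mult_right_mono ennreal_leI) auto
    also have "\<dots> = ennreal c * enn_powr (ennreal ((b / l) powr \<sigma>)) (1 / \<sigma>)"
      unfolding avg using b l \<sigma> by (simp add: enn_powr_ennreal powr_powr)
    finally have "avg ?u (cb z s) \<le> ennreal (c powr \<sigma>) * ennreal ((b / l) powr \<sigma>)"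
      using c \<sigma> by (subst (asm) enn_powr_le_iff) auto
    also have "\<dots> = ennreal (c powr \<sigma> * (b / l) powr \<sigma>)" by (simp add: ennreal_mult)
    finally have A: "avg ?u (cb z s) \<le> ennreal (c powr \<sigma> * (b / l) powr \<sigma>)" .
    have "wmeas ?u (cb z s) = avg ?u (cb z s) * ennreal l"
      unfolding avg_def emeasure_cb[OF s] l_def[symmetric]
      using l by (simp add: ennreal_divide_times ennreal_mult_divide_eq)
    also have "\<dots> \<le> ennreal (c powr \<sigma> * (b / l) powr \<sigma>) * ennreal l"
      by (intro mult_right_mono A) simp
    also have "\<dots> = ennreal (c powr \<sigma> * (b / l) powr \<sigma> * l)"
      using l by (simp add: ennreal_mult)
    also have "c powr \<sigma> * (b / l) powr \<sigma> * l = c powr \<sigma> * b powr \<sigma> * l powr (1 - \<sigma>)"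
      using l b by (simp add: powr_divide powr_diff)
    finally have W: "wmeas ?u (cb z s) \<le> ennreal (c powr \<sigma> * b powr \<sigma> * l powr (1 - \<sigma>))" .
    show ?thesis
      using cmass_leI[OF W] le_less_trans[OF W] by (simp add: b_def l_def)
  qed
  have dual: "dualw ?r ?u = dualw q w"
  proof
    fix x
    have "\<sigma> * (1 - ?r / (?r - 1)) = 1 - q / (q - 1)"
      unfolding dual_exponent[OF r] dual_exponent[OF q] using \<sigma> by simp
    then show "dualw ?r ?u x = dualw q w x"
      unfolding dualw_def powr_powr by simp
  qed
  have "muckenhoupt ?r (c powr \<sigma> * B powr \<sigma>) ?u"
    unfolding muckenhoupt_def dual
  proof (intro conjI allI impI)
    show "?u \<in> borel_measurable lebesgue" by measurable
    show "AE x in lebesgue. 0 < w x powr \<sigma>" using muck_pos[OF m] by eventually_elim simp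
    fix z :: "real ^ 'n" and s :: real assume s: "0 < s"
    show "wmeas ?u (cb z s) < \<infinity>" using u[OF s] by simp
    show "wmeas (dualw q w) (cb z s) < \<infinity>" by (simp add: muck_dual_wmeas[OF m s])
    define l where "l = (2 * s) ^ CARD('n)"
    have l: "0 < l" using s by (simp add: l_def)
    let ?a = "cmass w z s" and ?b = "cmass (dualw q w) z s"
    have "cmass ?u z s * ?b powr (?r - 1) \<le> (c powr \<sigma> * ?a powr \<sigma> * l powr (1 - \<sigma>)) * ?b powr (?r - 1)"
      using u[OF s, of z] by (intro mult_right_mono) (auto simp: l_def)
    also have "\<dots> = c powr \<sigma> * l powr (1 - \<sigma>) * (?a * ?b powr (q - 1)) powr \<sigma>"
      by (simp add: powr_mult powr_powr mult_ac)
    also have "\<dots> \<le> c powr \<sigma> * l powr (1 - \<sigma>) * (B * l powr q) powr \<sigma>"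
      using muck_ineq[OF m s, of z] \<sigma> by (intro mult_left_mono powr_mono2) (auto simp: l_def)
    also have "\<dots> = c powr \<sigma> * B powr \<sigma> * (l powr (1 - \<sigma>) * l powr (q * \<sigma>))"
      using muck_ge_1[OF q m] by (simp add: powr_mult powr_powr)
    also have "l powr (1 - \<sigma>) * l powr (q * \<sigma>) = l powr ?r"
      unfolding powr_add[symmetric] by (simp add: algebra_simps)
    finally show "cmass ?u z s * ?b powr (?r - 1) \<le> c powr \<sigma> * B powr \<sigma> * ((2 * s) ^ CARD('n)) powr ?r"
      by (simp add: l_def)
  qed simp
  with c u that show thesis by blast
qed

text \<open>Hoelder's inequality between \<open>w\<close> and \<open>w\<^sup>\<sigma>\<close> gains the factor \<open>|Q\<^sub>j| / |Q\<^sub>k|\<close> to the power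
  \<open>1 - 1/\<sigma>\<close>; the growth of \<open>w\<^sup>\<sigma>\<close> itself gives the extra geometric factor
  needed in the endpoint case \<open>r = -n/(p \<sigma>)\<close>, where Gehring's lemma would be used otherwise.\<close>

lemma RH_growth:
  fixes w :: "real ^ 'n \<Rightarrow> real"
  assumes q: "1 < q" and m: "muckenhoupt q B w" and \<sigma>: "1 < \<sigma>" and RH: "w \<in> RH \<sigma>"
  obtains c \<epsilon> where "1 \<le> c" "0 < \<epsilon>" "\<epsilon> < 1"
    "\<And>z s j k. 0 < s \<Longrightarrow> j \<le> k \<Longrightarrow>
       cmass w z (3 ^ j * s) \<le> c * (\<epsilon>\<^sup>2 * 3 powr (- real CARD('n) * (1 - 1 / \<sigma>))) ^ (k - j) * cmass w z (3 ^ k * s)"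
proof -
  note [measurable] = muck_measurable[OF m]
  let ?u = "\<lambda>x. w x powr \<sigma>" and ?n = "real CARD('n)"
  obtain c B' where c: "1 \<le> c" and mu: "muckenhoupt (1 + \<sigma> * (q - 1)) B' ?u"
    and u: "\<And>z s. 0 < s \<Longrightarrow> cmass ?u z s \<le> c powr \<sigma> * cmass w z s powr \<sigma> * ((2 * s) ^ CARD('n)) powr (1 - \<sigma>)"
    using RH_muckenhoupt_powr[OF q m \<sigma> RH] by blast
  have r: "1 < 1 + \<sigma> * (q - 1)" using \<sigma> q by simp
  obtain \<rho> where \<rho>: "0 < \<rho>" "\<rho> < 1"
    and grow: "\<And>z s j k. 0 < s \<Longrightarrow> j \<le> k \<Longrightarrow> cmass ?u z (3 ^ j * s) \<le> \<rho> ^ (k - j) * cmass ?u z (3 ^ k * s)"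
    using muck_growth[OF r mu] by blast
  \<comment> \<open>A square root of the available factor \<open>\<rho> powr (1 / \<sigma>)\<close>:
    one factor \<epsilon> will serve the growth condition on the sequence and the other the decay
    condition.\<close>
  define \<epsilon> where "\<epsilon> = \<rho> powr (1 / (2 * \<sigma>))"
  have \<epsilon>: "0 < \<epsilon>" "\<epsilon> < 1"
    unfolding \<epsilon>_def using \<rho> \<sigma> powr_less_mono2[of "1 / (2 * \<sigma>)" \<rho> 1] by auto
  have \<epsilon>2: "\<epsilon>\<^sup>2 = \<rho> powr (1 / \<sigma>)"
    unfolding \<epsilon>_def power2_eq_square powr_add[symmetric] by simp
  have holder: "cmass w z s \<le> cmass ?u z s powr (1 / \<sigma>) * ((2 * s) ^ CARD('n)) powr (1 - 1 / \<sigma>)"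
    if s: "0 < s" for z s
  proof -
    have "wmeas w (cb z s) = (\<integral>\<^sup>+x\<in>cb z s. ennreal (?u x powr (1 / \<sigma>) * 1 powr (1 - 1 / \<sigma>)) \<partial>lebesgue)"
      unfolding wmeas_def using \<sigma> muck_nonneg[OF m] by (intro nn_integral_cong) (simp add: powr_powr)
    also have "\<dots> \<le> ennreal (cmass ?u z s powr (1 / \<sigma>) * ((2 * s) ^ CARD('n)) powr (1 - 1 / \<sigma>))"
    proof (rule nn_integral_Holder)
      show "(\<integral>\<^sup>+t\<in>cb z s. ennreal (?u t) \<partial>lebesgue) \<le> ennreal (cmass ?u z s)"
        using muck_wmeas[OF mu s, of z] by (simp add: wmeas_def)
      show "(\<integral>\<^sup>+t\<in>cb z s. ennreal 1 \<partial>lebesgue) \<le> ennreal ((2 * s) ^ CARD('n))"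
        unfolding emeasure_cb[OF s, of z, symmetric] ennreal_1 mult_1
        using nn_integral_indicator[OF cb_sets, of z s] by (simp only: order_refl)
      show "0 < cmass ?u z s" by (rule muck_cmass_pos[OF mu s])
    qed (use \<sigma> s in auto)
    finally show ?thesis by (intro cmass_leI) auto
  qed
  have "cmass w z (3 ^ j * s) \<le> c * (\<epsilon>\<^sup>2 * 3 powr (- ?n * (1 - 1 / \<sigma>))) ^ (k - j) * cmass w z (3 ^ k * s)"
    if s: "0 < s" and jk: "j \<le> k" for z s j k
  proof -
    define l where "l i = (2 * (3 ^ i * s)) ^ CARD('n)" for i :: nat
    have l: "0 < l i" for i using s by (simp add: l_def)
    have s': "0 < 3 ^ i * s" for i :: nat using s by simp
    define b where "b = cmass w z (3 ^ k * s)"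
    have b: "0 < b" unfolding b_def by (rule muck_cmass_pos[OF m s'])
    define \<theta> where "\<theta> = 1 - 1 / \<sigma>"
    have lj: "l j = l k * (3 powr - ?n) ^ (k - j)"
    proof -
      have "l k = l j * (3 ^ CARD('n)) ^ (k - j)"
      proof -
        have "(3::real) ^ k = 3 ^ j * 3 ^ (k - j)" using jk by (simp add: power_add[symmetric])
        then show ?thesis by (simp add: l_def power_mult_distrib power_mult[symmetric] mult.commute)
      qed
      moreover have "(3 powr - ?n) ^ (k - j) = inverse ((3 ^ CARD('n)) ^ (k - j))"
        by (simp add: powr_minus powr_realpow power_inverse)
      ultimately show ?thesis by simp
    qed
    have "cmass w z (3 ^ j * s) \<le> cmass ?u z (3 ^ j * s) powr (1 / \<sigma>) * l j powr \<theta>"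
      using holder[OF s', of z j] by (simp add: l_def \<theta>_def)
    also have "\<dots> \<le> (\<rho> ^ (k - j) * (c powr \<sigma> * b powr \<sigma> * l k powr (1 - \<sigma>))) powr (1 / \<sigma>) * l j powr \<theta>"
    proof (intro mult_right_mono powr_mono2)
      have "cmass ?u z (3 ^ j * s) \<le> \<rho> ^ (k - j) * cmass ?u z (3 ^ k * s)" by (rule grow[OF s jk])
      also have "\<dots> \<le> \<rho> ^ (k - j) * (c powr \<sigma> * b powr \<sigma> * l k powr (1 - \<sigma>))"
        using u[OF s', of z k] \<rho> by (intro mult_left_mono) (auto simp: l_def b_def)
      finally show "cmass ?u z (3 ^ j * s) \<le> \<rho> ^ (k - j) * (c powr \<sigma> * b powr \<sigma> * l k powr (1 - \<sigma>))" .
    qed (use \<sigma> in auto)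
    also have "(\<rho> ^ (k - j) * (c powr \<sigma> * b powr \<sigma> * l k powr (1 - \<sigma>))) powr (1 / \<sigma>)
        = (\<epsilon>\<^sup>2) ^ (k - j) * (c * b * l k powr - \<theta>)"
    proof -
      have "(\<rho> ^ (k - j)) powr (1 / \<sigma>) = (\<epsilon>\<^sup>2) ^ (k - j)"
        unfolding \<epsilon>2 using \<rho> by (simp add: powr_realpow[symmetric] powr_powr mult.commute)
      moreover have "(1 - \<sigma>) * (1 / \<sigma>) = - \<theta>" using \<sigma> by (simp add: \<theta>_def field_simps)
      then have "(l k powr (1 - \<sigma>)) powr (1 / \<sigma>) = l k powr - \<theta>" by (simp only: powr_powr)
      moreover have "(c powr \<sigma>) powr (1 / \<sigma>) = c" "(b powr \<sigma>) powr (1 / \<sigma>) = b"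
        using \<sigma> c b by (auto simp: powr_powr)
      ultimately show ?thesis
        using \<rho> by (simp only: powr_mult)
    qed
    also have "l j powr \<theta> = l k powr \<theta> * (3 powr (- ?n * \<theta>)) ^ (k - j)"
    proof -
      have "((3 powr - ?n) ^ (k - j)) powr \<theta> = (3 powr (- ?n * \<theta>)) ^ (k - j)"
        by (simp add: powr_power powr_powr mult_ac)
      then show ?thesis unfolding lj using l[of k] by (simp add: powr_mult)
    qed
    also have "(\<epsilon>\<^sup>2) ^ (k - j) * (c * b * l k powr - \<theta>) * (l k powr \<theta> * (3 powr (- ?n * \<theta>)) ^ (k - j))
        = c * (\<epsilon>\<^sup>2 * 3 powr (- ?n * \<theta>)) ^ (k - j) * b * (l k powr - \<theta> * l k powr \<theta>)"
      by (simp add: power_mult_distrib mult_ac)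
    also have "l k powr - \<theta> * l k powr \<theta> = 1"
      using l[of k] by (simp add: powr_add[symmetric])
    finally show ?thesis by (simp add: b_def \<theta>_def)
  qed
  with c \<epsilon> that show thesis by blast
qed

text \<open>The condition on r says \<gamma> <= \<theta> = 1 - 1/\<sigma>, with equality allowed.
  For a_k = (d \<epsilon>)^k with d = 3^(-n \<theta>), the factor \<epsilon>^2 d of
  \<open>RH_growth\<close> leaves \<epsilon>^(k-j) for the growth of a_k w(Q_k). In a_k
  |Q_k|^\<gamma> the powers d^k and 3^(n k \<gamma>) have product at most 1, which leaves
  \<epsilon>^k for the decay, also at the endpoint.\<close>

lemma morrey_lambda:
  fixes F :: "((real ^ 'n \<Rightarrow> real) \<times> (real ^ 'n \<Rightarrow> real)) set" and w :: "real ^ 'n \<Rightarrow> real"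
  assumes F: "\<And>f g. (f, g) \<in> F \<Longrightarrow> f \<in> borel_measurable lebesgue \<and> g \<in> borel_measurable lebesgue
           \<and> (\<forall>x. 0 \<le> f x) \<and> (\<forall>x. 0 \<le> g x)"
    and dom: "dominated F p" and p: "0 < p" and \<sigma>: "1 < \<sigma>"
    and r: "r \<le> - (real CARD('n) / (p * \<sigma>))" and w: "w \<in> A_inf" "w \<in> RH \<sigma>"
  shows "\<exists>c>0. \<forall>(f, g)\<in>F. morrey_norm_lambda p r w g < \<infinity> \<longrightarrow> morrey_norm_lambda p r w g \<le> ennreal c * morrey_norm_lambda p r w f"
proof -
  obtain q B where q: "1 < q" and m: "muckenhoupt q B w"
    using A_inf_muckenhoupt[OF w(1)] by blast
  let ?n = "real CARD('n)"
  define \<theta> where "\<theta> = 1 - 1 / \<sigma>"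
  define d where "d = 3 powr (- ?n * \<theta>)"
  obtain c \<epsilon> where c: "1 \<le> c" and \<epsilon>: "0 < \<epsilon>" "\<epsilon> < 1"
    and grow: "\<And>z s j k. 0 < s \<Longrightarrow> j \<le> k \<Longrightarrow>
       cmass w z (3 ^ j * s) \<le> c * (\<epsilon>\<^sup>2 * d) ^ (k - j) * cmass w z (3 ^ k * s)"
    unfolding d_def \<theta>_def using RH_growth[OF q m \<sigma> w(2)] by blast
  define \<gamma> where "\<gamma> = (1 / p + r / ?n) * p"
  have \<gamma>: "\<gamma> \<le> \<theta>"
  proof -
    have "r * p \<le> - (?n / (p * \<sigma>)) * p" using r p by (intro mult_right_mono) auto
    also have "\<dots> = - (?n / \<sigma>)" using p by simp
    finally have "r * p / ?n \<le> - (?n / \<sigma>) / ?n" by (intro divide_right_mono) auto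
    then show ?thesis using p by (simp add: \<gamma>_def \<theta>_def distrib_right)
  qed
  have \<theta>: "0 < \<theta>" using \<sigma> by (simp add: \<theta>_def)
  have d: "0 < d" "d \<le> 1"
    unfolding d_def using \<theta> powr_mono[of "- ?n * \<theta>" 0 3] by auto
  have d\<epsilon>: "0 < d * \<epsilon>" "d * \<epsilon> \<le> 1" using d \<epsilon> by (auto simp: mult_le_one)
  have "\<exists>c>0. \<forall>(f, g)\<in>F.
      (SUP Q\<in>cubes. enn_powr (emeasure lebesgue Q) (- (1 / p + r / ?n)) * Lp_norm p w Q g) < \<infinity> \<longrightarrow>
      (SUP Q\<in>cubes. enn_powr (emeasure lebesgue Q) (- (1 / p + r / ?n)) * Lp_norm p w Q g)
        \<le> ennreal c * (SUP Q\<in>cubes. enn_powr (emeasure lebesgue Q) (- (1 / p + r / ?n)) * Lp_norm p w Q f)"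
  proof (rule morrey_transfer[OF F dom p q m, where \<nu> = "\<lambda>z s. (2 * s) ^ CARD('n)" and a = "\<lambda>z s k. (d * \<epsilon>) ^ k"
        and L = "1 / (d * \<epsilon>)" and M = c and \<tau> = \<epsilon> and \<rho> = \<epsilon>])
    fix z :: "real ^ 'n" and s :: real and j k :: nat assume s: "0 < s"
    show "emeasure lebesgue (cb z s) = ennreal ((2 * s) ^ CARD('n))" by (rule emeasure_cb[OF s])
    show "(d * \<epsilon>) ^ Suc k \<le> (d * \<epsilon>) ^ k" using d\<epsilon> by (intro power_decreasing) auto
    show "(d * \<epsilon>) ^ k * ((2 * (3 ^ k * s)) ^ CARD('n)) powr ((1 / p + r / ?n) * p)
        \<le> \<epsilon> ^ k * ((2 * s) ^ CARD('n)) powr ((1 / p + r / ?n) * p)"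
    proof -
      define l where "l = (2 * s) ^ CARD('n)"
      have l: "0 < l" using s by (simp add: l_def)
      have "(2 * (3 ^ k * s)) ^ CARD('n) = (3 powr ?n) ^ k * l"
        by (simp add: l_def powr_realpow power_mult_distrib power_mult[symmetric] mult_ac)
      then have "((2 * (3 ^ k * s)) ^ CARD('n)) powr \<gamma> = ((3 powr ?n) ^ k) powr \<gamma> * l powr \<gamma>"
        using l by (simp add: powr_mult)
      also have "((3 powr ?n) ^ k) powr \<gamma> = (3 powr (?n * \<gamma>)) ^ k"
        by (simp add: powr_power powr_powr mult_ac)
      finally have "(d * \<epsilon>) ^ k * ((2 * (3 ^ k * s)) ^ CARD('n)) powr \<gamma> = (d * 3 powr (?n * \<gamma>)) ^ k * \<epsilon> ^ k * l powr \<gamma>"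
        by (simp add: power_mult_distrib mult_ac)
      also have "\<dots> \<le> 1 * \<epsilon> ^ k * l powr \<gamma>"
      proof (intro mult_right_mono power_le_one)
        have "d * 3 powr (?n * \<gamma>) = 3 powr (?n * (\<gamma> - \<theta>))"
          unfolding d_def powr_add[symmetric] by (simp add: algebra_simps)
        also have "\<dots> \<le> 3 powr 0"
          using \<gamma> by (intro powr_mono) (auto simp: mult_nonneg_nonpos)
        finally show "d * 3 powr (?n * \<gamma>) \<le> 1" by simp
      qed (use \<epsilon> d in auto)
      finally show ?thesis by (simp add: \<gamma>_def l_def)
    qed
    assume jk: "j \<le> k"
    show "(d * \<epsilon>) ^ j * cmass w z (3 ^ j * s) \<le> c * \<epsilon> ^ (k - j) * ((d * \<epsilon>) ^ k * cmass w z (3 ^ k * s))"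
    proof -
      have "(d * \<epsilon>) ^ j * cmass w z (3 ^ j * s) \<le> (d * \<epsilon>) ^ j * (c * (\<epsilon>\<^sup>2 * d) ^ (k - j) * cmass w z (3 ^ k * s))"
        using d\<epsilon> by (intro mult_left_mono grow s jk) auto
      also have "(\<epsilon>\<^sup>2 * d) ^ (k - j) = \<epsilon> ^ (k - j) * (d * \<epsilon>) ^ (k - j)"
        by (simp add: power_mult_distrib power2_eq_square mult_ac)
      also have "(d * \<epsilon>) ^ j * (c * (\<epsilon> ^ (k - j) * (d * \<epsilon>) ^ (k - j)) * cmass w z (3 ^ k * s))
          = c * \<epsilon> ^ (k - j) * (((d * \<epsilon>) ^ j * (d * \<epsilon>) ^ (k - j)) * cmass w z (3 ^ k * s))"
        by (simp add: mult_ac)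
      also have "(d * \<epsilon>) ^ j * (d * \<epsilon>) ^ (k - j) = (d * \<epsilon>) ^ k"
        using jk by (simp add: power_add[symmetric])
      finally show ?thesis .
    qed
  qed (use \<epsilon> d d\<epsilon> c in \<open>auto simp: field_simps\<close>)
  then show ?thesis by (simp add: morrey_norm_lambda_def)
qed

theorem corollary4p3:
  fixes p0 :: real
    and F :: "((real ^ 'n \<Rightarrow> real) \<times> (real ^ 'n \<Rightarrow> real)) set"
  assumes "0 < p0"
    and "\<forall>(f, g)\<in>F. f \<in> borel_measurable lebesgue \<and> g \<in> borel_measurable lebesgue
           \<and> (\<forall>x. 0 \<le> f x) \<and> (\<forall>x. 0 \<le> g x)"
    and "\<exists>c1 :: real \<Rightarrow> ennreal \<Rightarrow> real. (\<forall>q t. 0 < c1 q t) \<and>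
           (\<forall>(f, g)\<in>F. \<forall>q\<ge>1. \<forall>w\<in>Ap q.
              Lp_norm p0 w UNIV g < \<infinity> \<longrightarrow>
              Lp_norm p0 w UNIV g \<le> ennreal (c1 q (Ap_const q w)) * Lp_norm p0 w UNIV f)"
  shows "(\<forall>p r w. 0 < p \<and> - (real CARD('n) / p) \<le> r \<and> r < 0 \<and> w \<in> A_inf \<longrightarrow>
            (\<exists>c2::real. 0 < c2 \<and> (\<forall>(f, g)\<in>F.
               morrey_norm p r w g < \<infinity> \<longrightarrow>
               morrey_norm p r w g \<le> ennreal c2 * morrey_norm p r w f)))
       \<and> (\<forall>p r \<sigma> w. 0 < p \<and> 1 < \<sigma> \<and> - (real CARD('n) / p) \<le> r \<and> r \<le> - (real CARD('n) / (p * \<sigma>))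
              \<and> w \<in> A_inf \<inter> RH \<sigma> \<longrightarrow>
            (\<exists>c3::real. 0 < c3 \<and> (\<forall>(f, g)\<in>F.
               morrey_norm_lambda p r w g < \<infinity> \<longrightarrow>
               morrey_norm_lambda p r w g \<le> ennreal c3 * morrey_norm_lambda p r w f)))"
proof -
  have F: "f \<in> borel_measurable lebesgue \<and> g \<in> borel_measurable lebesgue
           \<and> (\<forall>x. 0 \<le> f x) \<and> (\<forall>x. 0 \<le> g x)" if "(f, g) \<in> F" for f g
    using assms(2) that by blast
  obtain c1 :: "real \<Rightarrow> ennreal \<Rightarrow> real" where c1: "\<And>q t. 0 < c1 q t"
    "\<And>f g q w. (f, g) \<in> F \<Longrightarrow> 1 \<le> q \<Longrightarrow> w \<in> Ap q \<Longrightarrow> Lp_norm p0 w UNIV g < \<infinity>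
       \<Longrightarrow> Lp_norm p0 w UNIV g \<le> ennreal (c1 q (Ap_const q w)) * Lp_norm p0 w UNIV f"
    using assms(3) by blast
  have dom: "dominated F p" if "0 < p" for p
    using dominated_all[OF F dominated_base[OF assms(1) F c1] assms(1) that] by blast
  show ?thesis
  proof (intro conjI allI impI; elim conjE)
    fix p r :: real and w :: "real ^ 'n \<Rightarrow> real"
    assume "0 < p" "- (real CARD('n) / p) \<le> r" "r < 0" "w \<in> A_inf"
    then show "\<exists>c2>0. \<forall>(f, g)\<in>F. morrey_norm p r w g < \<infinity> \<longrightarrow> morrey_norm p r w g \<le> ennreal c2 * morrey_norm p r w f"
      by (intro morrey_weighted[OF F dom]) auto
  next
    fix p r \<sigma> :: real and w :: "real ^ 'n \<Rightarrow> real"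
    assume "0 < p" "1 < \<sigma>" "r \<le> - (real CARD('n) / (p * \<sigma>))" "w \<in> A_inf \<inter> RH \<sigma>"
    then show "\<exists>c3>0. \<forall>(f, g)\<in>F. morrey_norm_lambda p r w g < \<infinity> \<longrightarrow> morrey_norm_lambda p r w g \<le> ennreal c3 * morrey_norm_lambda p r w f"
      by (intro morrey_lambda[OF F dom, where \<sigma> = \<sigma>]) auto
  qed
qed

end
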